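(* Let $\nu>0$, $k_0\ge 0$, and let $(\sigma,n)$ satisfy one of: $\sigma\in(0,\tfrac12)$ and $n\ge 2$; $\sigma=\tfrac12$ and $n\ge 1$; $\sigma\in(\tfrac12,1]$ and $n\ge 3$. Suppose $(u_0,u_1)\in (H^{k_0+1}(\mathbb{R}^n)\cap L^1(\mathbb{R}^n))\times(H^{k_0}(\mathbb{R}^n)\cap L^1(\mathbb{R}^n))$. Then there exists a unique solution $u\in C([0,\infty);H^{k_0+1}(\mathbb{R}^n))\cap C^1([0,\infty);H^{k_0}(\mathbb{R}^n))$ of the Cauchy problem $$\partial_t^2u-\Delta u+\nu(-\Delta)^\sigma\partial_tu=0\ \ (t>0,\ x\in\mathbb{R}^n),\qquad u(0,x)=u_0(x),\quad \partial_tu(0,x)=u_1(x),$$ and there is a constant $C>0$ independent of $t$ such that for all $t\ge 0$, $\ell\in\{0,1\}$ and $k\in[0,k_0+1]$ with $k+\ell\le k_0+1$, $$\|\partial_t^\ell\nabla_x^ku(t)\|_2\le C(1+t)^{-\gamma_{\sigma,k}-\ell}\quad\text{if }\sigma\in(0,\tfrac12],$$ $$\|\partial_t^\ell\nabla_x^ku(t)\|_2\le C(1+t)^{-\gamma_{\sigma,k}-\frac{\ell}{2\sigma}}\quad\text{if }\sigma\in(\tfrac12,1].$$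
   Context: $\|\cdot\|_p$ is the norm of $L^p(\mathbb{R}^n)$. For real $k\ge0$, $\nabla_x^kf$ denotes $\mathcal{F}^{-1}[|\xi|^k\hat f]$ (that is, $(-\Delta)^{k/2}f$), and $H^k(\mathbb{R}^n)$ is the Sobolev space of real-valued $f$ with $\|f\|_{H^k}=(\|f\|_2^2+\|\nabla_x^kf\|_2^2)^{1/2}<\infty$. $(-\Delta)^\sigma$ is the Fourier multiplier $|\xi|^{2\sigma}$. The equation is understood on the Fourier side: $\partial_t^2\hat u+|\xi|^2\hat u+\nu|\xi|^{2\sigma}\partial_t\hat u=0$ with $\hat u(0)=\hat u_0$, $\partial_t\hat u(0)=\hat u_1$. The decay exponents are $$\gamma_{\sigma,k}=\begin{cases}\frac{n}{4(1-\sigma)}-\frac{\sigma}{1-\sigma}+\frac{k}{2(1-\sigma)},&0<\sigma<\frac12,\\ \frac n2-1+k,&\sigma=\frac12,\\ \frac{n}{4\sigma}-\frac{1}{2\sigma}+\frac{k}{2\sigma},&\frac12<\sigma\le1.\end{cases}$$ *)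

theory Defs
  imports "HOL-Analysis.Analysis"
begin

text \<open>Elements of \<open>L\<^sup>2\<close> are represented by Borel functions; two representatives of the same
  element agree almost everywhere. The value of \<open>norm_L2\<close> is meaningful only on \<open>L2_space\<close>.\<close>

definition L2_space :: "('a::euclidean_space \<Rightarrow> 'b::real_normed_vector) set" where
  "L2_space = {f. f \<in> borel_measurable lborel \<and> integrable lborel (\<lambda>x. (norm (f x))\<^sup>2)}"

definition norm_L2 :: "('a::euclidean_space \<Rightarrow> 'b::real_normed_vector) \<Rightarrow> real" where
  "norm_L2 f = sqrt (LINT x|lborel. (norm (f x))\<^sup>2)"

text \<open>The unitary normalisation is used. All notions below that refer to the Fourier transform
  are independent of its normalisation.\<close>

definition fourier_integral :: "('a::euclidean_space \<Rightarrow> complex) \<Rightarrow> 'a \<Rightarrow> complex" where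
  "fourier_integral f \<xi> =
     complex_of_real ((2 * pi) powr (- (real DIM('a) / 2))) *
     (LINT x|lborel. exp (- (\<i> * complex_of_real (\<xi> \<bullet> x))) * f x)"

text \<open>The Fourier transform on \<open>L\<^sup>2\<close>, as the \<open>L\<^sup>2\<close>-limit of the integrals over growing balls. The
  distance is a Lebesgue integral in \<^typ>\<open>ennreal\<close>, so that convergence to 0 cannot be due to
  non-integrability. The limit is determined almost everywhere.\<close>

definition is_fourier :: "('a::euclidean_space \<Rightarrow> complex) \<Rightarrow> ('a \<Rightarrow> complex) \<Rightarrow> bool" where
  "is_fourier f g \<longleftrightarrow> f \<in> L2_space \<and> g \<in> L2_space \<and>
     ((\<lambda>R. \<integral>\<^sup>+ \<xi>. ennreal ((norm (g \<xi> - fourier_integral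
              (\<lambda>x. indicator (cball 0 R) x *\<^sub>R f x) \<xi>))\<^sup>2) \<partial>lborel) \<longlongrightarrow> 0) at_top"

definition fourier :: "('a::euclidean_space \<Rightarrow> complex) \<Rightarrow> 'a \<Rightarrow> complex" where
  "fourier f = (SOME g. is_fourier f g)"

definition inv_fourier :: "('a::euclidean_space \<Rightarrow> complex) \<Rightarrow> 'a \<Rightarrow> complex" where
  "inv_fourier g = (SOME f. is_fourier f g)"

abbreviation fourier_real :: "('a::euclidean_space \<Rightarrow> real) \<Rightarrow> 'a \<Rightarrow> complex" where
  "fourier_real f \<equiv> fourier (\<lambda>x. complex_of_real (f x))"

text \<open>\<open>0 powr 0 = 0\<close> affects the symbol for \<open>k = 0\<close> only at \<open>\<xi> = 0\<close>, a null set.\<close>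

definition nabla_symbol :: "real \<Rightarrow> ('a::euclidean_space \<Rightarrow> real) \<Rightarrow> 'a \<Rightarrow> complex" where
  "nabla_symbol k f \<xi> = complex_of_real (norm \<xi> powr k) * fourier_real f \<xi>"

definition nabla :: "real \<Rightarrow> ('a::euclidean_space \<Rightarrow> real) \<Rightarrow> 'a \<Rightarrow> complex" where
  "nabla k f = inv_fourier (nabla_symbol k f)"

text \<open>Finiteness of the \<open>L\<^sup>2\<close> norm of \<open>nabla k f\<close> is expressed by membership of its Fourier
  transform in \<open>L\<^sup>2\<close>, which is what makes \<open>nabla k f\<close> well defined as an element of \<open>L\<^sup>2\<close>.\<close>

definition sobolev :: "real \<Rightarrow> ('a::euclidean_space \<Rightarrow> real) set" where
  "sobolev k = {f. f \<in> L2_space \<and> nabla_symbol k f \<in> L2_space}"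

definition norm_sobolev :: "real \<Rightarrow> ('a::euclidean_space \<Rightarrow> real) \<Rightarrow> real" where
  "norm_sobolev k f = sqrt ((norm_L2 f)\<^sup>2 + (norm_L2 (nabla k f))\<^sup>2)"

definition C0_sobolev :: "real \<Rightarrow> (real \<Rightarrow> 'a::euclidean_space \<Rightarrow> real) set" where
  "C0_sobolev s = {u. (\<forall>t\<ge>0. u t \<in> sobolev s) \<and>
     (\<forall>t\<ge>0. ((\<lambda>\<tau>. norm_sobolev s (\<lambda>x. u \<tau> x - u t x)) \<longlongrightarrow> 0) (at t within {0..}))}"

definition has_time_deriv ::
    "real \<Rightarrow> (real \<Rightarrow> 'a::euclidean_space \<Rightarrow> real) \<Rightarrow> ('a \<Rightarrow> real) \<Rightarrow> real \<Rightarrow> bool" where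
  "has_time_deriv s u w t \<longleftrightarrow> w \<in> sobolev s \<and>
     ((\<lambda>\<tau>. norm_sobolev s (\<lambda>x. (u \<tau> x - u t x) / (\<tau> - t) - w x)) \<longlongrightarrow> 0) (at t within {0..})"

definition C1_sobolev :: "real \<Rightarrow> (real \<Rightarrow> 'a::euclidean_space \<Rightarrow> real) set" where
  "C1_sobolev s = {u. u \<in> C0_sobolev s \<and>
     (\<exists>u'\<in>C0_sobolev s. \<forall>t\<ge>0. has_time_deriv s u (u' t) t)}"

definition time_deriv ::
    "real \<Rightarrow> (real \<Rightarrow> 'a::euclidean_space \<Rightarrow> real) \<Rightarrow> real \<Rightarrow> 'a \<Rightarrow> real" where
  "time_deriv s u t = (SOME w. has_time_deriv s u w t)"

definition fourier_ode ::
    "real \<Rightarrow> real \<Rightarrow> 'a::euclidean_space \<Rightarrow> complex \<Rightarrow> complex \<Rightarrow> (real \<Rightarrow> complex) \<Rightarrow> bool" where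
  "fourier_ode \<nu> \<sigma> \<xi> a b y \<longleftrightarrow>
     (\<exists>y' y''. (\<forall>t\<ge>0. (y has_vector_derivative y' t) (at t within {0..})) \<and>
        continuous_on {0..} y' \<and>
        (\<forall>t>0. (y' has_vector_derivative y'' t) (at t)) \<and>
        (\<forall>t>0. y'' t + complex_of_real ((norm \<xi>)\<^sup>2) * y t
               + complex_of_real (\<nu> * norm \<xi> powr (2 * \<sigma>)) * y' t = 0) \<and>
        y 0 = a \<and> y' 0 = b)"

text \<open>The equation holds on the Fourier side: for almost every \<open>\<xi>\<close>, the function
  \<open>t \<mapsto> v t \<xi>\<close> solves the ordinary differential equation. Since each spatial Fourier transform is
  only determined up to a null set (which may depend on \<open>t\<close>), one has to pass to a suitable family
  \<open>v\<close> of representatives.\<close>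

definition is_solution ::
    "real \<Rightarrow> real \<Rightarrow> real \<Rightarrow> ('a::euclidean_space \<Rightarrow> real) \<Rightarrow> ('a \<Rightarrow> real) \<Rightarrow>
     (real \<Rightarrow> 'a \<Rightarrow> real) \<Rightarrow> bool" where
  "is_solution \<nu> \<sigma> k0 u0 u1 u \<longleftrightarrow>
     u \<in> C0_sobolev (k0 + 1) \<and> u \<in> C1_sobolev k0 \<and>
     (\<exists>v. (\<forall>t\<ge>0. AE \<xi> in lborel. v t \<xi> = fourier_real (u t) \<xi>) \<and>
          (AE \<xi> in lborel. fourier_ode \<nu> \<sigma> \<xi> (fourier_real u0 \<xi>) (fourier_real u1 \<xi>) (\<lambda>t. v t \<xi>)))"

definition decay_exponent :: "nat \<Rightarrow> real \<Rightarrow> real \<Rightarrow> real" where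
  "decay_exponent n \<sigma> k =
     (if \<sigma> < 1/2 then real n / (4 * (1 - \<sigma>)) - \<sigma> / (1 - \<sigma>) + k / (2 * (1 - \<sigma>))
      else if \<sigma> = 1/2 then real n / 2 - 1 + k
      else real n / (4 * \<sigma>) - 1 / (2 * \<sigma>) + k / (2 * \<sigma>))"

end

theory Submission
  imports Defs "HOL-Probability.Characteristic_Functions"
begin

text \<open>On the Fourier side the equation is, for each frequency, the damped oscillator
  \<open>y'' + b y' + a\<^sup>2 y = 0\<close> with \<open>a = \<bar>\<xi>\<bar>\<close> and \<open>b = \<nu> \<bar>\<xi>\<bar> powr (2 \<sigma>)\<close>. It is solved explicitly through the
  characteristic roots. A Lyapunov functional gives the decay \<open>exp (- c \<rho> t)\<close> of the energy
  \<open>\<bar>y'\<bar>\<^sup>2 + a\<^sup>2 \<bar>y\<bar>\<^sup>2\<close>, where \<open>\<rho> = a\<^sup>2 b / (a\<^sup>2 + b\<^sup>2)\<close>, and with it uniqueness. The energy bound suffices for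
  regularity, for exponential decay at high frequencies and for the low frequencies when \<open>\<sigma> \<ge> 1 / 2\<close>. For
  \<open>\<sigma> < 1 / 2\<close> the low frequencies are overdamped and the explicit roots \<open>- a\<^sup>2 / b\<close> and \<open>- b\<close> (to
  leading order) are used. At low frequencies the transforms of the integrable data are bounded, so the
  polynomial rates come from scaling the integral of \<open>\<bar>\<xi>\<bar> powr q * exp (- c \<bar>\<xi>\<bar> powr p t)\<close>.

  Plancherel's theorem follows from the Gaussian regularisation of the autocorrelation of a function
  and the continuity of translations, the latter from outer regularity of Lebesgue measure.\<close>

section \<open>The space of square integrable functions\<close>

text \<open>Near frequency 0 the solution is bounded by
  \<open>a powr m * exp (- c * a powr P * t)\<close>, possibly with a factor
  \<open>(1 + t) powr e\<close>; scaling turns this into the rate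
  \<open>(2 * (k + m) + n) / (2 * P) - e\<close>. The singular factor is \<open>1 / b\<close>, so
  \<open>m = - 2 * \<sigma>\<close>, for \<sigma> < 1/2, and \<open>1 / a\<close>, so
  \<open>m = - 1\<close>, for \<sigma> > 1/2. Its square must be integrable at the origin, that is
  \<open>2 * m + n > 0\<close>, and this is what n \<ge> 2 and n \<ge> 3 secure. One constant must
  serve a whole interval of real orders k, so the integral estimates are uniform in the exponent.
  The operators \<open>fourier\<close>, \<open>inv_fourier\<close> and \<open>time_deriv\<close>
  choose representatives by \<open>SOME\<close>. The arguments therefore run on the relation
  \<open>is_fourier\<close> and on explicit functions of the frequency; the choices enter only
  through almost everywhere equality.\<close>

lemma L2_measurable: "f \<in> L2_space \<Longrightarrow> f \<in> borel_measurable borel"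
  by (simp add: L2_space_def)

lemma L2_space_iff:
  "f \<in> L2_space \<longleftrightarrow> f \<in> borel_measurable borel \<and> (\<integral>\<^sup>+x. ennreal ((norm (f x))\<^sup>2) \<partial>lborel) < \<infinity>"
  unfolding L2_space_def by (auto simp: integrable_iff_bounded)

lemma norm_L2_nonneg [simp]: "norm_L2 f \<ge> 0"
  by (simp add: norm_L2_def)

lemma norm_L2_sq: "(norm_L2 f)\<^sup>2 = (LINT x|lborel. (norm (f x))\<^sup>2)"
  by (simp add: norm_L2_def)

lemma nn_integral_L2:
  "f \<in> L2_space \<Longrightarrow> (\<integral>\<^sup>+x. ennreal ((norm (f x))\<^sup>2) \<partial>lborel) = ennreal ((norm_L2 f)\<^sup>2)"
  unfolding norm_L2_sq L2_space_def by (simp add: nn_integral_eq_integral)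

lemma power2_le_imp_le_ennreal:
  fixes x y :: ennreal
  assumes "x\<^sup>2 \<le> y\<^sup>2" shows "x \<le> y"
proof (cases "x = top \<or> y = top")
  case True
  then show ?thesis using assms by (cases y) (auto simp: ennreal_power top_unique)
next
  case False
  then show ?thesis
    using assms by (cases x; cases y) (auto simp: ennreal_power power2_le_iff_abs_le)
qed

text \<open>The Bochner integral inside \<open>norm_L2\<close> is 0 for a non-integrable function,
  so a bound on \<open>norm_L2\<close> alone proves nothing. A bound in \<open>ennreal\<close>
  yields membership and the norm estimate together.\<close>

lemma norm_L2_leI:
  fixes f :: "'a::euclidean_space \<Rightarrow> 'b::real_normed_vector"
  assumes [measurable]: "f \<in> borel_measurable borel"
    and le: "(\<integral>\<^sup>+x. ennreal ((norm (f x))\<^sup>2) \<partial>lborel) \<le> ennreal (c\<^sup>2)" and "c \<ge> 0"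
  shows "f \<in> L2_space" "norm_L2 f \<le> c"
proof -
  show f: "f \<in> L2_space"
    using le by (auto simp: L2_space_iff intro: le_less_trans)
  have "ennreal ((norm_L2 f)\<^sup>2) \<le> ennreal (c\<^sup>2)"
    using le nn_integral_L2[OF f] by simp
  then show "norm_L2 f \<le> c"
    using \<open>c \<ge> 0\<close> by (simp add: power2_le_iff_abs_le)
qed

lemma L2_dominated:
  fixes f :: "'a::euclidean_space \<Rightarrow> 'b::real_normed_vector"
    and g :: "'a::euclidean_space \<Rightarrow> 'c::real_normed_vector"
  assumes f: "f \<in> borel_measurable borel" and g: "g \<in> L2_space"
    and le: "AE x in lborel. norm (f x) \<le> c * norm (g x)" and c: "c \<ge> 0"
  shows "f \<in> L2_space" "norm_L2 f \<le> c * norm_L2 g"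
proof -
  note [measurable] = f L2_measurable[OF g]
  have "(\<integral>\<^sup>+x. ennreal ((norm (f x))\<^sup>2) \<partial>lborel) \<le> (\<integral>\<^sup>+x. ennreal (c\<^sup>2) * ennreal ((norm (g x))\<^sup>2) \<partial>lborel)"
    using le
    by (intro nn_integral_mono_AE)
       (auto simp: ennreal_mult[symmetric] power_mult_distrib[symmetric] intro!: ennreal_leI power_mono)
  also have "\<dots> = ennreal (c\<^sup>2) * ennreal ((norm_L2 g)\<^sup>2)"
    by (subst nn_integral_cmult) (auto simp: nn_integral_L2[OF g])
  also have "\<dots> = ennreal ((c * norm_L2 g)\<^sup>2)"
    by (simp add: ennreal_mult power_mult_distrib)
  finally show "f \<in> L2_space" "norm_L2 f \<le> c * norm_L2 g"
    using norm_L2_leI[OF f] c by auto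
qed

lemma norm_L2_cong_AE:
  fixes f g :: "'a::euclidean_space \<Rightarrow> 'b::real_normed_vector"
  assumes "f \<in> borel_measurable borel" "g \<in> borel_measurable borel"
    and "AE x in lborel. norm (f x) = norm (g x)"
  shows "norm_L2 f = norm_L2 g"
  unfolding norm_L2_def using assms by (intro arg_cong[where f = sqrt] integral_cong_AE) auto

lemma L2_cong_AE:
  fixes f :: "'a::euclidean_space \<Rightarrow> 'b::real_normed_vector"
    and g :: "'a::euclidean_space \<Rightarrow> 'b::real_normed_vector"
  assumes "f \<in> L2_space" "g \<in> borel_measurable borel" "AE x in lborel. f x = g x"
  shows "g \<in> L2_space"
proof -
  have "AE x in lborel. norm (g x) \<le> 1 * norm (f x)"
    using assms(3) by eventually_elim simp
  from L2_dominated(1)[OF assms(2,1) this] show ?thesis by simp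
qed

lemma norm_L2_zero [simp]: "norm_L2 (\<lambda>x. 0) = 0"
  by (simp add: norm_L2_def)

lemma norm_L2_minus: "norm_L2 (\<lambda>x. - f x) = norm_L2 f"
  by (simp add: norm_L2_def)

lemma norm_L2_minus_commute: "norm_L2 (\<lambda>x. f x - g x) = norm_L2 (\<lambda>x. g x - f x)"
  by (simp add: norm_L2_def norm_minus_commute)

lemma L2_Cauchy_Schwarz:
  fixes f :: "'a::euclidean_space \<Rightarrow> 'b::real_normed_vector"
    and g :: "'a::euclidean_space \<Rightarrow> 'c::real_normed_vector"
  assumes f: "f \<in> L2_space" and g: "g \<in> L2_space"
  shows "integrable lborel (\<lambda>x. norm (f x) * norm (g x))"
    and "(LINT x|lborel. norm (f x) * norm (g x)) \<le> norm_L2 f * norm_L2 g"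
proof -
  note [measurable] = L2_measurable[OF f] L2_measurable[OF g]
  have "(\<integral>\<^sup>+x. ennreal (norm (f x)) * ennreal (norm (g x)) \<partial>lborel)\<^sup>2
      \<le> (\<integral>\<^sup>+x. (ennreal (norm (f x)))\<^sup>2 \<partial>lborel) * (\<integral>\<^sup>+x. (ennreal (norm (g x)))\<^sup>2 \<partial>lborel)"
    by (intro Cauchy_Schwarz_nn_integral) auto
  also have "\<dots> = ennreal ((norm_L2 f)\<^sup>2) * ennreal ((norm_L2 g)\<^sup>2)"
    by (simp add: ennreal_power nn_integral_L2[OF f] nn_integral_L2[OF g])
  also have "\<dots> = (ennreal (norm_L2 f * norm_L2 g))\<^sup>2"
    by (simp add: ennreal_mult[symmetric] ennreal_power power_mult_distrib)
  finally have *: "(\<integral>\<^sup>+x. ennreal (norm (f x) * norm (g x)) \<partial>lborel) \<le> ennreal (norm_L2 f * norm_L2 g)"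
    unfolding ennreal_mult'[OF norm_ge_zero] by (rule power2_le_imp_le_ennreal)
  then show "integrable lborel (\<lambda>x. norm (f x) * norm (g x))"
    by (intro integrableI_bounded) (auto intro: le_less_trans)
  show "(LINT x|lborel. norm (f x) * norm (g x)) \<le> norm_L2 f * norm_L2 g"
    using * by (subst integral_eq_nn_integral) (auto intro!: enn2real_leI)
qed

lemma L2_inner_bound:
  fixes f g :: "'a::euclidean_space \<Rightarrow> complex"
  assumes f: "f \<in> L2_space" and g: "g \<in> L2_space"
  shows "integrable lborel (\<lambda>x. f x * g x)"
    and "norm (LINT x|lborel. f x * g x) \<le> norm_L2 f * norm_L2 g"
proof -
  note [measurable] = L2_measurable[OF f] L2_measurable[OF g]
  note CS = L2_Cauchy_Schwarz[OF f g]
  show "integrable lborel (\<lambda>x. f x * g x)"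
    by (rule Bochner_Integration.integrable_bound[OF CS(1)]) (auto simp: norm_mult)
  have "norm (LINT x|lborel. f x * g x) \<le> (LINT x|lborel. norm (f x * g x))"
    by (rule integral_norm_bound)
  also have "\<dots> = (LINT x|lborel. norm (f x) * norm (g x))" by (simp add: norm_mult)
  finally show "norm (LINT x|lborel. f x * g x) \<le> norm_L2 f * norm_L2 g"
    using CS(2) by linarith
qed

lemma L2_add:
  fixes f g :: "'a::euclidean_space \<Rightarrow> 'b::{real_normed_vector,second_countable_topology}"
  assumes f: "f \<in> L2_space" and g: "g \<in> L2_space"
  shows "(\<lambda>x. f x + g x) \<in> L2_space" "norm_L2 (\<lambda>x. f x + g x) \<le> norm_L2 f + norm_L2 g"
proof -
  note [measurable] = L2_measurable[OF f] L2_measurable[OF g]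
  note CS = L2_Cauchy_Schwarz[OF f g]
  have sq: "integrable lborel (\<lambda>x. (norm (f x))\<^sup>2)" "integrable lborel (\<lambda>x. (norm (g x))\<^sup>2)"
    using f g by (auto simp: L2_space_def)
  let ?h = "\<lambda>x. (norm (f x))\<^sup>2 + 2 * (norm (f x) * norm (g x)) + (norm (g x))\<^sup>2"
  have int: "integrable lborel ?h" using sq CS(1) by auto
  have le: "(norm (f x + g x))\<^sup>2 \<le> ?h x" for x
  proof -
    have "(norm (f x + g x))\<^sup>2 \<le> (norm (f x) + norm (g x))\<^sup>2"
      by (intro power_mono norm_triangle_ineq) auto
    then show ?thesis by (simp add: power2_eq_square algebra_simps)
  qed
  have int': "integrable lborel (\<lambda>x. (norm (f x + g x))\<^sup>2)"
    using le by (intro Bochner_Integration.integrable_bound[OF int]) (auto intro!: AE_I2)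
  then show "(\<lambda>x. f x + g x) \<in> L2_space" by (simp add: L2_space_def)
  have "(norm_L2 (\<lambda>x. f x + g x))\<^sup>2 \<le> (LINT x|lborel. ?h x)"
    unfolding norm_L2_sq by (intro integral_mono int int' le)
  also have "\<dots> = (norm_L2 f)\<^sup>2 + 2 * (LINT x|lborel. norm (f x) * norm (g x)) + (norm_L2 g)\<^sup>2"
    using sq CS(1) by (simp add: norm_L2_sq)
  also have "\<dots> \<le> (norm_L2 f + norm_L2 g)\<^sup>2"
    using CS(2) by (simp add: power2_eq_square algebra_simps)
  finally show "norm_L2 (\<lambda>x. f x + g x) \<le> norm_L2 f + norm_L2 g"
    by (rule power2_le_imp_le) simp
qed

lemma L2_uminus:
  fixes f :: "'a::euclidean_space \<Rightarrow> 'b::{real_normed_vector,second_countable_topology}"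
  shows "f \<in> L2_space \<Longrightarrow> (\<lambda>x. - f x) \<in> L2_space"
  by (auto simp: L2_space_def)

lemma L2_diff:
  fixes f g :: "'a::euclidean_space \<Rightarrow> 'b::{real_normed_vector,second_countable_topology}"
  assumes f: "f \<in> L2_space" and g: "g \<in> L2_space"
  shows "(\<lambda>x. f x - g x) \<in> L2_space" "norm_L2 (\<lambda>x. f x - g x) \<le> norm_L2 f + norm_L2 g"
  using L2_add[OF f L2_uminus[OF g]] by (auto simp: norm_L2_minus)

lemma L2_diff_triangle:
  fixes f g h :: "'a::euclidean_space \<Rightarrow> 'b::{real_normed_vector,second_countable_topology}"
  assumes "f \<in> L2_space" "g \<in> L2_space" "h \<in> L2_space"
  shows "norm_L2 (\<lambda>x. f x - h x) \<le> norm_L2 (\<lambda>x. f x - g x) + norm_L2 (\<lambda>x. g x - h x)"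
  using L2_add(2)[OF L2_diff(1)[OF assms(1,2)] L2_diff(1)[OF assms(2,3)]] by simp

lemma norm_L2_diff_ge:
  fixes f g :: "'a::euclidean_space \<Rightarrow> 'b::{real_normed_vector,second_countable_topology}"
  assumes f: "f \<in> L2_space" and g: "g \<in> L2_space"
  shows "\<bar>norm_L2 f - norm_L2 g\<bar> \<le> norm_L2 (\<lambda>x. f x - g x)"
  using L2_add(2)[OF L2_diff(1)[OF f g] g] L2_add(2)[OF L2_diff(1)[OF g f] f]
    norm_L2_minus_commute[of f g] by simp

lemma L2_scale:
  fixes f :: "'a::euclidean_space \<Rightarrow> complex"
  assumes f: "f \<in> L2_space"
  shows "(\<lambda>x. c * f x) \<in> L2_space" "norm_L2 (\<lambda>x. c * f x) = norm c * norm_L2 f"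
  using f by (auto simp: L2_space_def norm_mult power_mult_distrib norm_L2_def real_sqrt_mult)

lemma norm_L2_eq_0_AE:
  fixes f :: "'a::euclidean_space \<Rightarrow> 'b::real_normed_vector"
  assumes f: "f \<in> L2_space" and "norm_L2 f = 0"
  shows "AE x in lborel. f x = 0"
proof -
  note [measurable] = L2_measurable[OF f]
  have "(\<integral>\<^sup>+x. ennreal ((norm (f x))\<^sup>2) \<partial>lborel) = 0"
    using nn_integral_L2[OF f] assms(2) by simp
  then show ?thesis by (subst (asm) nn_integral_0_iff_AE) auto
qed

lemma L2_limit_norm:
  fixes f :: "'i \<Rightarrow> 'a::euclidean_space \<Rightarrow> 'b::{real_normed_vector,second_countable_topology}"
  assumes "\<And>n. f n \<in> L2_space" "g \<in> L2_space" "((\<lambda>n. norm_L2 (\<lambda>x. g x - f n x)) \<longlongrightarrow> 0) F"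
  shows "((\<lambda>n. norm_L2 (f n)) \<longlongrightarrow> norm_L2 g) F"
proof -
  have "((\<lambda>n. norm_L2 (f n) - norm_L2 g) \<longlongrightarrow> 0) F"
    by (rule Lim_null_comparison[OF _ assms(3)])
       (use norm_L2_diff_ge[OF assms(2,1)] in \<open>auto simp: abs_minus_commute\<close>)
  then show ?thesis by (simp add: LIM_zero_iff)
qed

text \<open>Riesz-Fischer. Along a subsequence with increments \<open>d k\<close> of norm at most
  \<open>(1/4)^k\<close>, the weighted sum of \<open>4^k * (norm (d k x))\<^sup>2\<close> has finite
  integral. Where it is finite, \<open>norm (d k x)\<close> is at most a constant times
  \<open>(1/2)^k\<close>, so the subsequence converges pointwise. The weight replaces an infinite
  Minkowski inequality.\<close>

lemma L2_complete:
  fixes f :: "nat \<Rightarrow> 'a::euclidean_space \<Rightarrow> 'b::{banach,second_countable_topology}"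
  assumes f: "\<And>n. f n \<in> L2_space"
    and Cauchy: "\<And>e. e > 0 \<Longrightarrow> \<exists>N. \<forall>m\<ge>N. \<forall>n\<ge>N. norm_L2 (\<lambda>x. f m x - f n x) < e"
  shows "\<exists>g\<in>L2_space. (\<lambda>n. norm_L2 (\<lambda>x. g x - f n x)) \<longlonglongrightarrow> 0"
proof -
  note [measurable] = L2_measurable[OF f]
  have "\<exists>N. \<forall>m\<ge>N. \<forall>n\<ge>N. norm_L2 (\<lambda>x. f m x - f n x) < (1/4)^k" for k
    by (rule Cauchy) simp
  then obtain N where N: "\<And>k m n. m \<ge> N k \<Longrightarrow> n \<ge> N k \<Longrightarrow> norm_L2 (\<lambda>x. f m x - f n x) < (1/4)^k"
    by metis
  \<comment> \<open>This index is both monotone in k and at least \<open>N k\<close>.\<close>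
  define r where "r k = k + (\<Sum>i\<le>k. N i)" for k
  have rN: "N k \<le> r k" for k
    unfolding r_def using member_le_sum[of k "{..k}" N] by simp
  have rmono: "r k \<le> r (Suc k)" for k by (simp add: r_def)
  define d where "d k x = f (r (Suc k)) x - f (r k) x" for k x
  have dL2: "d k \<in> L2_space" for k unfolding d_def by (intro L2_diff f)
  note [measurable] = L2_measurable[OF dL2]
  have dle: "norm_L2 (d k) \<le> (1/4)^k" for k
    unfolding d_def using N[of k "r (Suc k)" "r k"] rN[of k] rmono[of k] by auto
  have "(\<integral>\<^sup>+x. (\<Sum>k. ennreal (4^k * (norm (d k x))\<^sup>2)) \<partial>lborel)
      = (\<Sum>k. (\<integral>\<^sup>+x. ennreal (4^k * (norm (d k x))\<^sup>2) \<partial>lborel))"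
    by (rule nn_integral_suminf) simp
  also have "\<dots> \<le> (\<Sum>k. ennreal ((1/4)^k))"
  proof (intro suminf_le allI)
    fix k
    have "(\<integral>\<^sup>+x. ennreal (4^k * (norm (d k x))\<^sup>2) \<partial>lborel) = ennreal (4^k * (norm_L2 (d k))\<^sup>2)"
      by (simp add: ennreal_mult nn_integral_cmult nn_integral_L2[OF dL2])
    also have "\<dots> \<le> ennreal (4^k * ((1/4)^k)\<^sup>2)"
      by (intro ennreal_leI mult_left_mono power_mono dle) auto
    also have "(4::real)^k * ((1/4)^k)\<^sup>2 = (1/4)^k"
      by (simp add: power2_eq_square field_simps)
    finally show "(\<integral>\<^sup>+x. ennreal (4^k * (norm (d k x))\<^sup>2) \<partial>lborel) \<le> ennreal ((1/4)^k)" .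
  qed auto
  also have "\<dots> = ennreal (\<Sum>k. (1/4)^k)"
    by (rule suminf_ennreal2) (auto intro: summable_geometric)
  also have "\<dots> < \<infinity>" by simp
  finally have "(\<integral>\<^sup>+x. (\<Sum>k. ennreal (4^k * (norm (d k x))\<^sup>2)) \<partial>lborel) \<noteq> \<infinity>" by simp
  then have AE1: "AE x in lborel. (\<Sum>k. ennreal (4^k * (norm (d k x))\<^sup>2)) \<noteq> \<infinity>"
    by (intro nn_integral_noteq_infinite) auto
  have conv: "convergent (\<lambda>k. f (r k) x)" if "(\<Sum>k. ennreal (4^k * (norm (d k x))\<^sup>2)) \<noteq> \<infinity>" for x
  proof -
    define S where "S = (\<Sum>k. ennreal (4^k * (norm (d k x))\<^sup>2))"
    have "norm (d k x) \<le> sqrt (enn2real S) * (1/2)^k" for k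
    proof -
      have "ennreal (4^k * (norm (d k x))\<^sup>2) \<le> S"
      proof -
        have "(\<Sum>j\<in>{k}. ennreal (4^j * (norm (d j x))\<^sup>2)) \<le> S"
          unfolding S_def by (rule sum_le_suminf) auto
        then show ?thesis by simp
      qed
      then have "4^k * (norm (d k x))\<^sup>2 \<le> enn2real S"
        using that unfolding S_def[symmetric] by (cases S) (auto simp: top_unique)
      then have "(2^k * norm (d k x))\<^sup>2 \<le> enn2real S"
        unfolding power_mult_distrib by (subst power_mult[symmetric], subst mult.commute) (simp add: power_mult)
      then have "2^k * norm (d k x) \<le> sqrt (enn2real S)" by (simp add: real_le_rsqrt)
      then show ?thesis by (simp add: field_simps)
    qed
    then have "summable (\<lambda>k. d k x)"
      by (rule summable_comparison_test'[of "\<lambda>k. sqrt (enn2real S) * (1/2)^k" 0, rotated])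
         (rule summable_mult, rule summable_geometric, simp)
    then have "convergent (\<lambda>n. \<Sum>k<n. d k x)" by (simp only: summable_iff_convergent)
    moreover have "(\<Sum>k<n. d k x) = f (r n) x - f (r 0) x" for n
      unfolding d_def by (rule sum_lessThan_telescope)
    ultimately have "convergent (\<lambda>n. (f (r n) x - f (r 0) x) + f (r 0) x)"
      by (intro convergent_add convergent_const) simp
    then show ?thesis by simp
  qed
  define g where "g x = lim (\<lambda>k. f (r k) x)" for x
  have [measurable]: "g \<in> borel_measurable borel"
    unfolding g_def by (rule borel_measurable_lim_metric) simp
  have AE2: "AE x in lborel. (\<lambda>k. f (r k) x) \<longlonglongrightarrow> g x"
    unfolding g_def convergent_LIMSEQ_iff[symmetric] using AE1 by eventually_elim (rule conv)
  \<comment> \<open>Fatou along the subsequence carries the Cauchy estimate to the limit. The bound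
    concerns every large n, so the full sequence converges.\<close>
  have bound: "(\<lambda>x. g x - f n x) \<in> L2_space \<and> norm_L2 (\<lambda>x. g x - f n x) \<le> (1/4)^k" if n: "n \<ge> N k" for n k
  proof -
    have "AE x in lborel. ennreal ((norm (g x - f n x))\<^sup>2) = liminf (\<lambda>j. ennreal ((norm (f (r j) x - f n x))\<^sup>2))"
      using AE2
    proof eventually_elim
      case (elim x)
      have *: "(\<lambda>j. ennreal ((norm (f (r j) x - f n x))\<^sup>2)) \<longlonglongrightarrow> ennreal ((norm (g x - f n x))\<^sup>2)"
        by (intro tendsto_ennrealI tendsto_intros elim)
      show ?case by (rule lim_imp_Liminf[OF _ *, symmetric]) simp
    qed
    then have "(\<integral>\<^sup>+x. ennreal ((norm (g x - f n x))\<^sup>2) \<partial>lborel)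
        = (\<integral>\<^sup>+x. liminf (\<lambda>j. ennreal ((norm (f (r j) x - f n x))\<^sup>2)) \<partial>lborel)"
      by (intro nn_integral_cong_AE) auto
    also have "\<dots> \<le> liminf (\<lambda>j. \<integral>\<^sup>+x. ennreal ((norm (f (r j) x - f n x))\<^sup>2) \<partial>lborel)"
      by (rule nn_integral_liminf) simp
    also have "\<dots> = liminf (\<lambda>j. ennreal ((norm_L2 (\<lambda>x. f (r j) x - f n x))\<^sup>2))"
      by (simp add: nn_integral_L2 L2_diff(1) f)
    also have "\<dots> \<le> liminf (\<lambda>j. ennreal (((1/4)^k)\<^sup>2))"
    proof (rule Liminf_mono, rule eventually_sequentiallyI[of k])
      fix j assume "j \<ge> k"
      then have "r j \<ge> N k" using rN[of k] lift_Suc_mono_le[of r k j] rmono by force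
      then show "ennreal ((norm_L2 (\<lambda>x. f (r j) x - f n x))\<^sup>2) \<le> ennreal (((1/4)^k)\<^sup>2)"
        using N[of k "r j" n] n by (intro ennreal_leI power_mono) auto
    qed
    also have "\<dots> = ennreal (((1/4)^k)\<^sup>2)" by (simp add: Liminf_const)
    finally show ?thesis by (intro conjI norm_L2_leI) auto
  qed
  have "g \<in> L2_space"
    using L2_add(1)[OF conjunct1[OF bound[of 0 "N 0"]] f[of "N 0"]] by simp
  moreover have "(\<lambda>n. norm_L2 (\<lambda>x. g x - f n x)) \<longlonglongrightarrow> 0"
  proof (rule LIMSEQ_I)
    fix e :: real assume "e > 0"
    then obtain k where k: "(1/4::real)^k < e" using real_arch_pow_inv[of e "1/4"] by auto
    then show "\<exists>n0. \<forall>n\<ge>n0. norm (norm_L2 (\<lambda>x. g x - f n x) - 0) < e"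
      using bound by (intro exI[of _ "N k"]) force
  qed
  ultimately show ?thesis by blast
qed

section \<open>Continuity of translations\<close>

lemma tendsto_null_squeeze:
  fixes a b :: "'i \<Rightarrow> real"
  assumes "(b \<longlongrightarrow> 0) F" "\<And>n. 0 \<le> a n" "\<And>n. a n \<le> b n"
  shows "(a \<longlongrightarrow> 0) F"
  by (rule tendsto_sandwich[OF always_eventually always_eventually tendsto_const assms(1)])
     (use assms in auto)

lemma nn_integral_affine_euclidean:
  fixes f :: "'a::euclidean_space \<Rightarrow> ennreal"
  assumes [measurable]: "f \<in> borel_measurable borel" and c: "c \<noteq> 0"
  shows "(\<integral>\<^sup>+x. f x \<partial>lborel) = ennreal (\<bar>c\<bar> ^ DIM('a)) * (\<integral>\<^sup>+x. f (t + c *\<^sub>R x) \<partial>lborel)"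
  by (subst lborel_affine[OF c, of t])
     (simp add: nn_integral_density nn_integral_distr nn_integral_cmult ennreal_power)

lemma integrable_affine_euclidean:
  fixes f :: "'a::euclidean_space \<Rightarrow> 'b::{banach,second_countable_topology}"
  assumes f: "integrable lborel f" and c: "c \<noteq> 0"
  shows "integrable lborel (\<lambda>x. f (t + c *\<^sub>R x))"
proof -
  have [measurable]: "f \<in> borel_measurable borel" using f by auto
  have fin: "(\<integral>\<^sup>+x. ennreal (norm (f x)) \<partial>lborel) < \<infinity>" using f by (auto simp: integrable_iff_bounded)
  have "ennreal (\<bar>c\<bar> ^ DIM('a)) \<noteq> 0" using c by simp
  then have "(\<integral>\<^sup>+x. ennreal (norm (f (t + c *\<^sub>R x))) \<partial>lborel) < \<infinity>"
    using fin nn_integral_affine_euclidean[of "\<lambda>x. ennreal (norm (f x))" c t] c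
    by (auto simp: ennreal_mult_less_top)
  then show ?thesis by (auto simp: integrable_iff_bounded)
qed

lemma integral_affine_euclidean:
  fixes f :: "'a::euclidean_space \<Rightarrow> 'b::{banach,second_countable_topology}"
  assumes [measurable]: "f \<in> borel_measurable borel" and c: "c \<noteq> 0"
  shows "(LINT x|lborel. f x) = \<bar>c\<bar> ^ DIM('a) *\<^sub>R (LINT x|lborel. f (t + c *\<^sub>R x))"
  by (subst lborel_affine[OF c, of t])
     (subst integral_density, simp_all add: integral_distr)

lemma L2_translate:
  fixes f :: "'a::euclidean_space \<Rightarrow> 'b::real_normed_vector"
  assumes f: "f \<in> L2_space"
  shows "(\<lambda>x. f (x + h)) \<in> L2_space" "norm_L2 (\<lambda>x. f (x + h)) = norm_L2 f"
proof -
  note [measurable] = L2_measurable[OF f]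
  have i: "integrable lborel (\<lambda>x. (norm (f x))\<^sup>2)" using f by (simp add: L2_space_def)
  show "(\<lambda>x. f (x + h)) \<in> L2_space"
    using integrable_affine_euclidean[OF i, of 1 h] by (simp add: L2_space_def add.commute)
  show "norm_L2 (\<lambda>x. f (x + h)) = norm_L2 f"
    unfolding norm_L2_def
    using integral_affine_euclidean[of "\<lambda>x. (norm (f x))\<^sup>2" 1 h] by (simp add: add.commute)
qed

text \<open>Passing from f to g costs the distance once at x and once at x + h; by translation
  invariance both costs equal the distance of f and g, whence the factor 2.\<close>

lemma L1_translation_bound:
  fixes f g :: "'a::euclidean_space \<Rightarrow> real"
  assumes f: "integrable lborel f" and g: "integrable lborel g"
  shows "(LINT x|lborel. \<bar>f (x + h) - f x\<bar>)
    \<le> (LINT x|lborel. \<bar>g (x + h) - g x\<bar>) + 2 * (LINT x|lborel. \<bar>f x - g x\<bar>)"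
proof -
  have fh: "integrable lborel (\<lambda>x. f (x + h))" and gh: "integrable lborel (\<lambda>x. g (x + h))"
    using integrable_affine_euclidean[of _ 1 h] f g by (auto simp: add.commute)
  have eq: "(LINT x|lborel. \<bar>f (x + h) - g (x + h)\<bar>) = (LINT x|lborel. \<bar>f x - g x\<bar>)"
    using integral_affine_euclidean[of "\<lambda>x. \<bar>f x - g x\<bar>" 1 h] f g by (simp add: add.commute)
  have "(LINT x|lborel. \<bar>f (x + h) - f x\<bar>)
     \<le> (LINT x|lborel. \<bar>g (x + h) - g x\<bar> + (\<bar>f (x + h) - g (x + h)\<bar> + \<bar>f x - g x\<bar>))"
    using f g fh gh by (intro integral_mono) auto
  also have "\<dots> = (LINT x|lborel. \<bar>g (x + h) - g x\<bar>)
      + ((LINT x|lborel. \<bar>f (x + h) - g (x + h)\<bar>) + (LINT x|lborel. \<bar>f x - g x\<bar>))"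
    using f g fh gh by (subst Bochner_Integration.integral_add; simp)+
  finally show ?thesis using eq by simp
qed

text \<open>Continuity of translations is preserved under approximation in \<open>L1\<close>,
  because the preceding bound is uniform in the shift. This closes both the indicator case and the
  limit case of the induction below.\<close>

lemma L1_translation_approx:
  fixes f :: "'a::euclidean_space \<Rightarrow> real"
  assumes f: "integrable lborel f"
    and ap: "\<And>e. e > 0 \<Longrightarrow> \<exists>g. integrable lborel g \<and> (LINT x|lborel. \<bar>f x - g x\<bar>) < e
                \<and> (\<lambda>n. LINT x|lborel. \<bar>g (x + h n) - g x\<bar>) \<longlonglongrightarrow> 0"
  shows "(\<lambda>n::nat. LINT x|lborel. \<bar>f (x + h n) - f x\<bar>) \<longlonglongrightarrow> 0"
proof (rule LIMSEQ_I)
  fix e :: real assume e: "e > 0"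
  then obtain g where g: "integrable lborel g" "(LINT x|lborel. \<bar>f x - g x\<bar>) < e/4"
      "(\<lambda>n. LINT x|lborel. \<bar>g (x + h n) - g x\<bar>) \<longlonglongrightarrow> 0"
    using ap[of "e/4"] by auto
  obtain N where N: "\<And>n. n \<ge> N \<Longrightarrow> norm ((LINT x|lborel. \<bar>g (x + h n) - g x\<bar>) - 0) < e/2"
    using LIMSEQ_D[OF g(3), of "e/2"] e by auto
  show "\<exists>N. \<forall>n\<ge>N. norm ((LINT x|lborel. \<bar>f (x + h n) - f x\<bar>) - 0) < e"
  proof (intro exI[of _ N] allI impI)
    fix n assume "n \<ge> N"
    then show "norm ((LINT x|lborel. \<bar>f (x + h n) - f x\<bar>) - 0) < e"
      using N[of n] L1_translation_bound[OF f g(1), of "h n"] g(2) by (simp add: integral_nonneg_AE)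
  qed
qed

text \<open>For an open set the positive part of the difference of indicators tends to zero pointwise, and
  it carries half of the integral of the absolute value.\<close>

lemma L1_translation_open:
  fixes U :: "'a::euclidean_space set"
  assumes U: "open U" and fin: "emeasure lborel U < \<infinity>" and h: "h \<longlonglongrightarrow> 0"
  shows "(\<lambda>n::nat. LINT x|lborel. \<bar>indicator U (x + h n) - indicator U x :: real\<bar>) \<longlonglongrightarrow> 0"
proof -
  have [measurable]: "U \<in> sets borel" using U by simp
  let ?i = "indicator U :: 'a \<Rightarrow> real"
  have i: "integrable lborel ?i" using fin by (intro integrable_real_indicator) auto
  have ih: "integrable lborel (\<lambda>x. ?i (x + h n))" for n
    using integrable_affine_euclidean[OF i, of 1 "h n"] by (simp add: add.commute)
  have eq: "(LINT x|lborel. ?i (x + h n)) = (LINT x|lborel. ?i x)" for n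
    using integral_affine_euclidean[of ?i 1 "h n"] by (simp add: add.commute)
  let ?p = "\<lambda>n x. max 0 (?i x - ?i (x + h n))"
  have p: "integrable lborel (?p n)" for n using i ih[of n] by auto
  have "(\<lambda>n. LINT x|lborel. ?p n x) \<longlonglongrightarrow> (LINT x::'a|lborel. 0)"
  proof (rule integral_dominated_convergence[where w = ?i])
    show "AE x in lborel. (\<lambda>n. ?p n x) \<longlonglongrightarrow> 0"
    proof (intro AE_I2)
      fix x
      show "(\<lambda>n. ?p n x) \<longlonglongrightarrow> 0"
      proof (cases "x \<in> U")
        case True
        have "(\<lambda>n. x + h n) \<longlonglongrightarrow> x + 0" by (intro tendsto_intros h)
        then have "\<forall>\<^sub>F n in sequentially. x + h n \<in> U"
          using topological_tendstoD[of "\<lambda>n. x + h n" x sequentially U] U True by simp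
        then show ?thesis by (intro tendsto_eventually) (auto elim!: eventually_mono simp: True)
      qed simp
    qed
  qed (use i in \<open>auto simp: indicator_def\<close>)
  then have "(\<lambda>n. 2 * (LINT x|lborel. ?p n x)) \<longlonglongrightarrow> 2 * 0" by (intro tendsto_mult tendsto_const) simp
  moreover have "(LINT x|lborel. \<bar>?i (x + h n) - ?i x\<bar>) = 2 * (LINT x|lborel. ?p n x)" for n
  proof -
    have "(LINT x|lborel. \<bar>?i (x + h n) - ?i x\<bar>) = (LINT x|lborel. 2 * ?p n x + (?i (x + h n) - ?i x))"
      by (intro Bochner_Integration.integral_cong) (auto simp: max_def)
    also have "\<dots> = 2 * (LINT x|lborel. ?p n x)"
      using p[of n] i ih[of n] eq[of n] by (subst Bochner_Integration.integral_add) auto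
    finally show ?thesis .
  qed
  ultimately show ?thesis by simp
qed

text \<open>Induction over integrable functions: a Borel set of finite measure is replaced by an
  open superset of nearly the same measure, sums use the triangle inequality, and limits are
  approximated in \<open>L1\<close>.\<close>

lemma L1_translation_continuous:
  fixes f :: "'a::euclidean_space \<Rightarrow> real"
  assumes f: "integrable lborel f" and h: "h \<longlonglongrightarrow> 0"
  shows "(\<lambda>n::nat. LINT x|lborel. \<bar>f (x + h n) - f x\<bar>) \<longlonglongrightarrow> 0"
  using f
proof (induction rule: integrable_induct)
  case (base A c)
  then have A[measurable]: "A \<in> sets borel" and finA: "emeasure lborel A < \<infinity>" by auto
  have iA: "integrable lborel (indicator A :: 'a \<Rightarrow> real)"
    using finA by (intro integrable_real_indicator) auto
  have "(\<lambda>n. LINT x|lborel. \<bar>indicator A (x + h n) - indicator A x :: real\<bar>) \<longlonglongrightarrow> 0"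
  proof (rule L1_translation_approx[OF iA])
    fix e :: real assume e: "e > 0"
    obtain U where U: "open U" "A \<subseteq> U" "emeasure lborel (U - A) < e"
      using outer_regular_lborel[OF A e] .
    have [measurable]: "U \<in> sets borel" using U by simp
    have finU: "emeasure lborel U < \<infinity>"
    proof -
      have "emeasure lborel U = emeasure lborel A + emeasure lborel (U - A)"
        using U by (subst plus_emeasure) (auto intro!: arg_cong[where f = "emeasure lborel"])
      then show ?thesis using finA U(3) by (auto simp: less_top[symmetric])
    qed
    have "(LINT x|lborel. \<bar>indicator A x - indicator U x :: real\<bar>) = (LINT x|lborel. indicator (U - A) x)"
      using U by (intro Bochner_Integration.integral_cong) (auto simp: indicator_def)
    also have "\<dots> = measure lborel (U - A)" by simp
    also have "\<dots> < e"
      using U(3) e by (cases "emeasure lborel (U - A)") (auto simp: measure_def ennreal_less_iff)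
    finally show "\<exists>g. integrable lborel g \<and> (LINT x|lborel. \<bar>indicator A x - g x\<bar>) < e
       \<and> (\<lambda>n. LINT x|lborel. \<bar>g (x + h n) - g x\<bar>) \<longlonglongrightarrow> 0"
      using L1_translation_open[OF U(1) finU h] finU
      by (intro exI[of _ "indicator U"] conjI integrable_real_indicator) auto
  qed
  then have "(\<lambda>n. \<bar>c\<bar> * (LINT x|lborel. \<bar>indicator A (x + h n) - indicator A x :: real\<bar>)) \<longlonglongrightarrow> \<bar>c\<bar> * 0"
    by (intro tendsto_mult tendsto_const)
  moreover have "\<bar>indicator A y *\<^sub>R c - indicator A x *\<^sub>R c\<bar> = \<bar>c\<bar> * \<bar>indicator A y - indicator A x :: real\<bar>" for x y
    by (simp add: indicator_def)
  ultimately show ?case by simp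
next
  case (add f g)
  have fh: "integrable lborel (\<lambda>x. f (x + h n))" and gh: "integrable lborel (\<lambda>x. g (x + h n))" for n
    using integrable_affine_euclidean[of _ 1 "h n"] add.hyps by (auto simp: add.commute)
  have "(\<lambda>n. (LINT x|lborel. \<bar>f (x + h n) - f x\<bar>) + (LINT x|lborel. \<bar>g (x + h n) - g x\<bar>)) \<longlonglongrightarrow> 0 + 0"
    by (intro tendsto_add add.IH)
  then have "(\<lambda>n. (LINT x|lborel. \<bar>f (x + h n) - f x\<bar>) + (LINT x|lborel. \<bar>g (x + h n) - g x\<bar>)) \<longlonglongrightarrow> 0"
    by simp
  then show ?case
  proof (rule tendsto_null_squeeze)
    show "0 \<le> (LINT x|lborel. \<bar>f (x + h n) + g (x + h n) - (f x + g x)\<bar>)" for n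
      by simp
    fix n
    show "(LINT x|lborel. \<bar>f (x + h n) + g (x + h n) - (f x + g x)\<bar>)
      \<le> (LINT x|lborel. \<bar>f (x + h n) - f x\<bar>) + (LINT x|lborel. \<bar>g (x + h n) - g x\<bar>)"
    proof -
      have "(LINT x|lborel. \<bar>f (x + h n) + g (x + h n) - (f x + g x)\<bar>)
          \<le> (LINT x|lborel. \<bar>f (x + h n) - f x\<bar> + \<bar>g (x + h n) - g x\<bar>)"
        using fh[of n] gh[of n] add.hyps by (intro integral_mono) auto
      also have "\<dots> = (LINT x|lborel. \<bar>f (x + h n) - f x\<bar>) + (LINT x|lborel. \<bar>g (x + h n) - g x\<bar>)"
        using fh[of n] gh[of n] add.hyps by (intro Bochner_Integration.integral_add) auto
      finally show ?thesis .
    qed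
  qed
next
  case (lim f s)
  show ?case
  proof (rule L1_translation_approx[OF lim.hyps(4)])
    fix e :: real assume e: "e > 0"
    have [measurable]: "f \<in> borel_measurable borel" "\<And>i. s i \<in> borel_measurable borel"
      using lim.hyps by auto
    have "(\<lambda>i. LINT x|lborel. \<bar>f x - s i x\<bar>) \<longlonglongrightarrow> (LINT x::'a|lborel. 0)"
    \<comment> \<open>The approximants satisfy
      \<open>\<bar>s i x\<bar> \<le> 2 * \<bar>f x\<bar>\<close>, so the difference is at most three
      times \<open>\<bar>f x\<bar>\<close>.\<close>
    proof (rule integral_dominated_convergence[where w = "\<lambda>x. 3 * \<bar>f x\<bar>"])
      show "AE x in lborel. (\<lambda>i. \<bar>f x - s i x\<bar>) \<longlonglongrightarrow> 0"
      proof (intro AE_I2)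
        fix x
        have "(\<lambda>i. \<bar>f x - s i x\<bar>) \<longlonglongrightarrow> \<bar>f x - f x\<bar>"
          by (intro tendsto_intros lim.hyps(2)) simp
        then show "(\<lambda>i. \<bar>f x - s i x\<bar>) \<longlonglongrightarrow> 0" by simp
      qed
      show "AE x in lborel. norm \<bar>f x - s i x\<bar> \<le> 3 * \<bar>f x\<bar>" for i
        using lim.hyps(3)[of _ i] by (intro AE_I2) (auto intro: order.trans[OF abs_triangle_ineq4])
    qed (use lim.hyps(4) in auto)
    then obtain i where "(LINT x|lborel. \<bar>f x - s i x\<bar>) < e"
      using LIMSEQ_D[of "\<lambda>i. LINT x|lborel. \<bar>f x - s i x\<bar>" 0 e] e by fastforce
    then show "\<exists>g. integrable lborel g \<and> (LINT x|lborel. \<bar>f x - g x\<bar>) < e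
                \<and> (\<lambda>n. LINT x|lborel. \<bar>g (x + h n) - g x\<bar>) \<longlonglongrightarrow> 0"
      using lim.hyps(1) lim.IH by blast
  qed
qed

text \<open>For nonnegative numbers
  \<open>(x - y)\<^sup>2 \<le> \<bar>x\<^sup>2 - y\<^sup>2\<bar>\<close>, which reduces the claim to
  the \<open>L1\<close> statement for the square of f. Nonnegativity is essential to this
  inequality.\<close>

lemma L2_translation_continuous_nonneg:
  fixes f :: "'a::euclidean_space \<Rightarrow> real"
  assumes f: "f \<in> L2_space" and nn: "\<And>x. f x \<ge> 0" and h: "h \<longlonglongrightarrow> 0"
  shows "(\<lambda>n::nat. norm_L2 (\<lambda>x. complex_of_real (f (x + h n)) - complex_of_real (f x))) \<longlonglongrightarrow> 0"
proof -
  have [measurable]: "f \<in> borel_measurable borel" using f by (rule L2_measurable)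
  have sq: "integrable lborel (\<lambda>x. (f x)\<^sup>2)" using f by (simp add: L2_space_def)
  have le: "(norm_L2 (\<lambda>x. complex_of_real (f (x + h n)) - complex_of_real (f x)))\<^sup>2
      \<le> (LINT x|lborel. \<bar>(f (x + h n))\<^sup>2 - (f x)\<^sup>2\<bar>)" for n
    unfolding norm_L2_sq
  proof (rule integral_mono)
    have 1: "integrable lborel (\<lambda>x. (f (x + h n))\<^sup>2)"
      using integrable_affine_euclidean[OF sq, of 1 "h n"] by (simp add: add.commute)
    then show 2: "integrable lborel (\<lambda>x. \<bar>(f (x + h n))\<^sup>2 - (f x)\<^sup>2\<bar>)" using sq by auto
    show le: "(cmod (complex_of_real (f (x + h n)) - complex_of_real (f x)))\<^sup>2 \<le> \<bar>(f (x + h n))\<^sup>2 - (f x)\<^sup>2\<bar>" for x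
    proof -
      have "cmod (complex_of_real (f (x + h n)) - complex_of_real (f x)) = \<bar>f (x + h n) - f x\<bar>"
        by (simp flip: of_real_diff)
      moreover have "\<bar>f (x + h n) - f x\<bar>\<^sup>2 \<le> \<bar>f (x + h n) - f x\<bar> * (f (x + h n) + f x)"
        unfolding power2_eq_square using nn[of "x + h n"] nn[of x] by (intro mult_left_mono) auto
      moreover have "\<bar>(f (x + h n))\<^sup>2 - (f x)\<^sup>2\<bar> = \<bar>f (x + h n) - f x\<bar> * (f (x + h n) + f x)"
      proof -
        have "(f (x + h n))\<^sup>2 - (f x)\<^sup>2 = (f (x + h n) - f x) * (f (x + h n) + f x)"
          by (simp add: power2_eq_square algebra_simps)
        then show ?thesis using nn[of "x + h n"] nn[of x] by (simp add: abs_mult)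
      qed
      ultimately show ?thesis by simp
    qed
    show "integrable lborel (\<lambda>x. (cmod (complex_of_real (f (x + h n)) - complex_of_real (f x)))\<^sup>2)"
      by (rule Bochner_Integration.integrable_bound[OF 2]) (use le in auto)
  qed
  have "(\<lambda>n. sqrt (LINT x|lborel. \<bar>(f (x + h n))\<^sup>2 - (f x)\<^sup>2\<bar>)) \<longlonglongrightarrow> sqrt 0"
    using L1_translation_continuous[OF sq h] by (intro tendsto_real_sqrt)
  then have "(\<lambda>n. sqrt (LINT x|lborel. \<bar>(f (x + h n))\<^sup>2 - (f x)\<^sup>2\<bar>)) \<longlonglongrightarrow> 0" by simp
  then show ?thesis
    by (rule tendsto_null_squeeze) (auto intro: real_le_rsqrt le)
qed

text \<open>A complex function is a linear combination of four nonnegative ones, the positive and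
  negative parts of its real and imaginary parts, and the property \<open>P\<close> is stable under
  sums and scalar multiples.\<close>

lemma L2_translation_continuous:
  fixes f :: "'a::euclidean_space \<Rightarrow> complex"
  assumes f: "f \<in> L2_space" and h: "h \<longlonglongrightarrow> 0"
  shows "(\<lambda>n::nat. norm_L2 (\<lambda>x. f (x + h n) - f x)) \<longlonglongrightarrow> 0"
proof -
  define P where "P g \<longleftrightarrow> g \<in> L2_space \<and> (\<lambda>n. norm_L2 (\<lambda>x. g (x + h n) - g x)) \<longlonglongrightarrow> 0"
    for g :: "'a \<Rightarrow> complex"
  have add: "P (\<lambda>x. g x + k x)" if g: "P g" and k: "P k" for g k
  proof -
    have "(\<lambda>n. norm_L2 (\<lambda>x. g (x + h n) - g x) + norm_L2 (\<lambda>x. k (x + h n) - k x)) \<longlonglongrightarrow> 0 + 0"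
      using g k unfolding P_def by (intro tendsto_add) auto
    moreover have "norm_L2 (\<lambda>x. g (x + h n) + k (x + h n) - (g x + k x))
        \<le> norm_L2 (\<lambda>x. g (x + h n) - g x) + norm_L2 (\<lambda>x. k (x + h n) - k x)" for n
      using L2_add(2)[of "\<lambda>x. g (x + h n) - g x" "\<lambda>x. k (x + h n) - k x"] g k
      by (simp add: P_def L2_diff L2_translate algebra_simps)
    ultimately have "(\<lambda>n. norm_L2 (\<lambda>x. g (x + h n) + k (x + h n) - (g x + k x))) \<longlonglongrightarrow> 0"
      by (intro tendsto_null_squeeze[OF _ norm_L2_nonneg]) simp_all
    then show ?thesis using g k by (auto simp: P_def L2_add)
  qed
  have scale: "P (\<lambda>x. c * g x)" if g: "P g" for g c
  proof -
    have "(\<lambda>n. norm c * norm_L2 (\<lambda>x. g (x + h n) - g x)) \<longlonglongrightarrow> norm c * 0"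
      using g unfolding P_def by (intro tendsto_mult tendsto_const) auto
    moreover have "norm_L2 (\<lambda>x. c * g (x + h n) - c * g x) = norm c * norm_L2 (\<lambda>x. g (x + h n) - g x)" for n
      using L2_scale(2)[of "\<lambda>x. g (x + h n) - g x" c] g
      by (simp add: P_def L2_diff L2_translate right_diff_distrib)
    ultimately show ?thesis using g by (auto simp: P_def L2_scale)
  qed
  have part: "P (\<lambda>x. complex_of_real (g x))"
    if g: "g \<in> borel_measurable borel" and b: "\<And>x. 0 \<le> g x \<and> g x \<le> norm (f x)" for g :: "'a \<Rightarrow> real"
  proof -
    have "g \<in> L2_space" by (rule L2_dominated(1)[OF g f, of 1]) (use b in auto)
    moreover have "(\<lambda>x. complex_of_real (g x)) \<in> L2_space"
      by (rule L2_dominated(1)[OF _ f, of _ 1]) (use b g in auto)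
    ultimately show ?thesis
      unfolding P_def using L2_translation_continuous_nonneg[OF _ _ h] b by blast
  qed
  note [measurable] = L2_measurable[OF f]
  have re: "P (\<lambda>x. complex_of_real (max 0 (Re (f x))))" "P (\<lambda>x. complex_of_real (max 0 (- Re (f x))))"
    by (rule part; use abs_Re_le_cmod[of "f _"] in \<open>simp add: abs_le_iff\<close>)+
  have im: "P (\<lambda>x. complex_of_real (max 0 (Im (f x))))" "P (\<lambda>x. complex_of_real (max 0 (- Im (f x))))"
    by (rule part; use abs_Im_le_cmod[of "f _"] in \<open>simp add: abs_le_iff\<close>)+
  have "P (\<lambda>x. (complex_of_real (max 0 (Re (f x))) + (-1) * complex_of_real (max 0 (- Re (f x))))
      + \<i> * (complex_of_real (max 0 (Im (f x))) + (-1) * complex_of_real (max 0 (- Im (f x)))))"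
    by (rule add[OF add[OF re(1) scale[OF re(2), of "-1"]]
          scale[OF add[OF im(1) scale[OF im(2), of "-1"]], of \<i>]])
  moreover have "(complex_of_real (max 0 (Re z)) + (-1) * complex_of_real (max 0 (- Re z)))
      + \<i> * (complex_of_real (max 0 (Im z)) + (-1) * complex_of_real (max 0 (- Im z))) = z" for z
    by (simp add: complex_eq_iff max_def)
  ultimately show ?thesis by (simp add: P_def)
qed

section \<open>The Plancherel theorem\<close>

abbreviation fourier_kernel :: "'a::euclidean_space \<Rightarrow> 'a \<Rightarrow> complex" where
  "fourier_kernel \<xi> x \<equiv> exp (- (\<i> * complex_of_real (\<xi> \<bullet> x)))"

lemma fourier_kernel_measurable [measurable]:
  "(\<lambda>x. fourier_kernel \<xi> x) \<in> borel_measurable borel"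
  by (intro borel_measurable_continuous_onI continuous_intros)

lemma norm_fourier_kernel [simp]: "norm (exp (- (\<i> * complex_of_real r))) = 1"
  by (simp add: norm_exp_eq_Re)

lemma integrable_fourier_kernel:
  fixes f :: "'a::euclidean_space \<Rightarrow> complex"
  assumes "integrable lborel f"
  shows "integrable lborel (\<lambda>x. fourier_kernel \<xi> x * f x)"
  by (rule Bochner_Integration.integrable_bound[OF assms]) (use assms in \<open>auto simp: norm_mult\<close>)

lemma fourier_integral_measurable [measurable]:
  fixes f :: "'a::euclidean_space \<Rightarrow> complex"
  assumes [measurable]: "f \<in> borel_measurable borel"
  shows "fourier_integral f \<in> borel_measurable borel"
proof -
  have [measurable]: "(\<lambda>p. exp (- (\<i> * complex_of_real (fst p \<bullet> snd p :: real))))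
     \<in> borel_measurable (borel \<Otimes>\<^sub>M borel :: ('a \<times> 'a) measure)"
    unfolding borel_prod by (intro borel_measurable_continuous_onI continuous_intros)
  have "(\<lambda>\<xi>. LINT x|lborel. fourier_kernel \<xi> x * f x) \<in> borel_measurable borel"
    by (rule lborel.borel_measurable_lebesgue_integral) (simp add: split_beta', measurable)
  then show ?thesis unfolding fourier_integral_def[abs_def] by measurable
qed

lemma fourier_integral_add:
  assumes "integrable lborel f" "integrable lborel g"
  shows "fourier_integral (\<lambda>x. f x + g x) \<xi> = fourier_integral f \<xi> + fourier_integral g \<xi>"
  unfolding fourier_integral_def
  using integrable_fourier_kernel[OF assms(1)] integrable_fourier_kernel[OF assms(2)]
  by (simp add: distrib_left)

lemma fourier_integral_cmult: "fourier_integral (\<lambda>x. c * f x) \<xi> = c * fourier_integral f \<xi>"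
  unfolding fourier_integral_def
  by (simp add: mult.left_commute)

lemma fourier_integral_diff:
  assumes "integrable lborel f" "integrable lborel g"
  shows "fourier_integral (\<lambda>x. f x - g x) \<xi> = fourier_integral f \<xi> - fourier_integral g \<xi>"
  using fourier_integral_add[OF assms(1), of "\<lambda>x. (-1) * g x" \<xi>] fourier_integral_cmult[of "-1" g \<xi>] assms(2)
  by simp

lemma norm_fourier_integral_le:
  fixes f :: "'a::euclidean_space \<Rightarrow> complex"
  assumes "integrable lborel f"
  shows "norm (fourier_integral f \<xi>) \<le> (2 * pi) powr (- (real DIM('a) / 2)) * (LINT x|lborel. norm (f x))"
proof -
  have "norm (LINT x|lborel. fourier_kernel \<xi> x * f x) \<le> (LINT x|lborel. norm (f x))"
    using integral_norm_bound[of lborel "\<lambda>x. fourier_kernel \<xi> x * f x"]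
    by (simp add: norm_mult)
  then show ?thesis unfolding fourier_integral_def by (simp add: norm_mult mult_left_mono)
qed

lemma fourier_integral_cnj:
  "fourier_integral (\<lambda>x. cnj (f x)) \<xi> = cnj (fourier_integral f (- \<xi>))"
proof -
  have "cnj (LINT x|lborel. fourier_kernel (- \<xi>) x * f x)
      = (LINT x|lborel. cnj (fourier_kernel (- \<xi>) x * f x))"
    by (rule Bochner_Integration.integral_cnj[symmetric])
  also have "\<dots> = (LINT x|lborel. fourier_kernel \<xi> x * cnj (f x))"
    by (simp add: exp_cnj)
  finally show ?thesis unfolding fourier_integral_def by simp
qed

section \<open>The Gaussian as a fixed point of the Fourier transform\<close>

text \<open>Lebesgue measure on a Euclidean space is the image of a product of one-dimensional
  Lebesgue measures under the coordinate map, so tensor products integrate factor by factor.\<close>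

lemma integral_lborel_prod:
  fixes f :: "'a::euclidean_space \<Rightarrow> real \<Rightarrow> complex"
  assumes int: "\<And>b. b \<in> Basis \<Longrightarrow> integrable lborel (f b)"
  shows "integrable lborel (\<lambda>x::'a. \<Prod>b\<in>Basis. f b (x \<bullet> b))"
    and "(LINT x|lborel. (\<Prod>b\<in>Basis. f b (x \<bullet> b))) = (\<Prod>b\<in>Basis. LINT t|lborel. f b t)"
proof -
  interpret P: product_sigma_finite "\<lambda>b::'a. lborel :: real measure" ..
  have [measurable]: "b \<in> Basis \<Longrightarrow> f b \<in> borel_measurable borel" for b
    using int[of b] by auto
  have eq: "(\<lambda>g. \<Prod>b\<in>Basis. f b ((\<Sum>b'\<in>Basis. g b' *\<^sub>R b') \<bullet> b)) = (\<lambda>g. \<Prod>b\<in>Basis. f b (g b))"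
    by (intro ext prod.cong) auto
  show "integrable lborel (\<lambda>x::'a. \<Prod>b\<in>Basis. f b (x \<bullet> b))"
    by (subst lborel_eq, subst integrable_distr_eq)
       (auto simp: eq intro!: P.product_integrable_prod int)
  show "(LINT x|lborel. (\<Prod>b\<in>Basis. f b (x \<bullet> b))) = (\<Prod>b\<in>Basis. LINT t|lborel. f b t)"
    by (subst lborel_eq, subst integral_distr)
       (auto simp: eq intro!: P.product_integral_prod int)
qed

text \<open>The width is the one for which the unitary transform leaves the function
  unchanged.\<close>

definition gaussian :: "'a::euclidean_space \<Rightarrow> complex" where
  "gaussian x = complex_of_real (exp (- (x \<bullet> x) / 2))"

lemma gaussian_measurable [measurable]: "gaussian \<in> borel_measurable borel"
  unfolding gaussian_def[abs_def] by (intro borel_measurable_continuous_onI continuous_intros) auto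

text \<open>This is the characteristic function of the standard normal distribution at
  \<open>- t\<close>, with the normalising factor of the density moved to the other side.\<close>

lemma gaussian_integral_1:
  "integrable lborel (\<lambda>x::real. exp (- (\<i> * complex_of_real (t * x))) * complex_of_real (exp (- x\<^sup>2 / 2)))" (is "integrable _ ?f")
  "(LINT x|lborel. exp (- (\<i> * complex_of_real (t * x))) * complex_of_real (exp (- x\<^sup>2 / 2)))
     = complex_of_real (sqrt (2 * pi) * exp (- t\<^sup>2 / 2))"
proof -
  have eq: "std_normal_density x *\<^sub>R iexp (- t * x) = complex_of_real (1 / sqrt (2 * pi)) * ?f x" for x
    by (simp add: std_normal_density_def scaleR_conv_of_real)
  have i: "integrable lborel std_normal_density" by (rule integrable_normal_density) simp
  have "integrable lborel (\<lambda>x. std_normal_density x *\<^sub>R iexp (- t * x))"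
    by (rule Bochner_Integration.integrable_bound[OF i]) auto
  then have "integrable lborel (\<lambda>x. complex_of_real (sqrt (2 * pi)) * (complex_of_real (1 / sqrt (2 * pi)) * ?f x))"
    unfolding eq by (rule integrable_mult_right)
  then show "integrable lborel ?f" by (simp flip: mult.assoc of_real_mult)
  have "char std_normal_distribution (- t) = (LINT x|lborel. std_normal_density x *\<^sub>R iexp (- t * x))"
    unfolding char_def by (subst integral_density) auto
  also have "\<dots> = complex_of_real (1 / sqrt (2 * pi)) * (LINT x|lborel. ?f x)"
    unfolding eq by simp
  finally have "complex_of_real (1 / sqrt (2 * pi)) * (LINT x|lborel. ?f x) = complex_of_real (exp (- t\<^sup>2 / 2))"
    by (simp add: char_std_normal_distribution)
  then have "complex_of_real (sqrt (2 * pi)) * (complex_of_real (1 / sqrt (2 * pi)) * (LINT x|lborel. ?f x))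
      = complex_of_real (sqrt (2 * pi)) * complex_of_real (exp (- t\<^sup>2 / 2))" by simp
  then show "(LINT x|lborel. ?f x) = complex_of_real (sqrt (2 * pi) * exp (- t\<^sup>2 / 2))"
    by (simp flip: mult.assoc of_real_mult)
qed

lemma gaussian_kernel_prod:
  fixes x \<xi> :: "'a::euclidean_space"
  shows "fourier_kernel \<xi> x * gaussian x
    = (\<Prod>b\<in>Basis. exp (- (\<i> * complex_of_real ((\<xi> \<bullet> b) * (x \<bullet> b)))) * complex_of_real (exp (- (x \<bullet> b)\<^sup>2 / 2)))"
proof -
  have 1: "gaussian x = (\<Prod>b\<in>Basis. complex_of_real (exp (- (x \<bullet> b)\<^sup>2 / 2)))"
    unfolding gaussian_def of_real_prod[symmetric] exp_sum[symmetric, OF finite_Basis]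
    by (subst euclidean_inner) (simp add: power2_eq_square sum_negf sum_divide_distrib)
  have 2: "fourier_kernel \<xi> x = (\<Prod>b\<in>Basis. exp (- (\<i> * complex_of_real ((\<xi> \<bullet> b) * (x \<bullet> b)))))"
    unfolding exp_sum[symmetric, OF finite_Basis]
    by (subst euclidean_inner) (simp add: sum_negf sum_distrib_left)
  show ?thesis unfolding 1 2 prod.distrib ..
qed

lemma gaussian_norm: "gaussian x = complex_of_real (exp (- (norm x)\<^sup>2 / 2))"
  by (simp add: gaussian_def power2_norm_eq_inner)

lemma gaussian_integrable: "integrable lborel (gaussian :: 'a::euclidean_space \<Rightarrow> complex)"
proof -
  have "integrable lborel (\<lambda>x::'a. fourier_kernel 0 x * gaussian x)"
    unfolding gaussian_kernel_prod
    by (rule integral_lborel_prod(1)[where f="\<lambda>b t. exp (- (\<i> * complex_of_real ((0 \<bullet> b) * t))) * complex_of_real (exp (- t\<^sup>2 / 2))"]) (rule gaussian_integral_1)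
  then show ?thesis by simp
qed

lemma fourier_integral_gaussian: "fourier_integral gaussian = (gaussian :: 'a::euclidean_space \<Rightarrow> complex)"
proof
  fix \<xi> :: 'a
  have "(LINT x|lborel. fourier_kernel \<xi> x * gaussian x)
    = (\<Prod>b\<in>(Basis::'a set). LINT t|lborel. exp (- (\<i> * complex_of_real ((\<xi> \<bullet> b) * t))) * complex_of_real (exp (- t\<^sup>2 / 2)))"
    unfolding gaussian_kernel_prod
    by (rule integral_lborel_prod(2)[where f="\<lambda>b t. exp (- (\<i> * complex_of_real ((\<xi> \<bullet> b) * t))) * complex_of_real (exp (- t\<^sup>2 / 2))"]) (rule gaussian_integral_1)
  also have "\<dots> = (\<Prod>b\<in>(Basis::'a set). complex_of_real (sqrt (2 * pi) * exp (- (\<xi> \<bullet> b)\<^sup>2 / 2)))"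
    unfolding gaussian_integral_1(2) ..
  also have "\<dots> = complex_of_real (sqrt (2 * pi) ^ DIM('a)) * gaussian \<xi>"
    using gaussian_kernel_prod[of 0 \<xi>] by (simp add: prod.distrib)
  finally have "fourier_integral gaussian \<xi> = complex_of_real ((2 * pi) powr (- (real DIM('a) / 2)) * sqrt (2 * pi) ^ DIM('a)) * gaussian \<xi>"
    unfolding fourier_integral_def by simp
  also have "(2 * pi) powr (- (real DIM('a) / 2)) * sqrt (2 * pi) ^ DIM('a) = 1"
    by (simp add: powr_half_sqrt[symmetric] powr_power powr_minus field_simps)
  finally show "fourier_integral gaussian \<xi> = gaussian \<xi>" by simp
qed

section \<open>The multiplication formula, autocorrelation and Plancherel's identity\<close>

lemma integrable_pair_tensor:
  fixes f :: "'a::euclidean_space \<Rightarrow> complex" and g :: "'b::euclidean_space \<Rightarrow> complex"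
  assumes f: "integrable lborel f" and g: "integrable lborel g"
  shows "integrable (lborel \<Otimes>\<^sub>M lborel) (\<lambda>(x, y). f x * g y)"
proof (rule lborel_pair.Fubini_integrable)
  have [measurable]: "f \<in> borel_measurable borel" "g \<in> borel_measurable borel" using f g by auto
  show "(\<lambda>(x, y). f x * g y) \<in> borel_measurable (lborel \<Otimes>\<^sub>M lborel)" by measurable
qed (use f g in \<open>auto simp: norm_mult\<close>)

text \<open>The kernel is symmetric in the two variables and of modulus 1, so Fubini applies to the
  tensor product of the two integrable functions.\<close>

lemma fourier_integral_duality:
  fixes f g :: "'a::euclidean_space \<Rightarrow> complex"
  assumes f: "integrable lborel f" and g: "integrable lborel g"
  shows "(LINT \<xi>|lborel. fourier_integral f \<xi> * g \<xi>) = (LINT x|lborel. f x * fourier_integral g x)"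
proof -
  let ?c = "complex_of_real ((2 * pi) powr (- (real DIM('a) / 2)))"
  let ?k = "\<lambda>x \<xi>::'a. fourier_kernel \<xi> x"
  have [measurable]: "f \<in> borel_measurable borel" "g \<in> borel_measurable borel" using f g by auto
  have [measurable]: "(\<lambda>p. ?k (fst p) (snd p)) \<in> borel_measurable (borel \<Otimes>\<^sub>M borel)"
    unfolding borel_prod by (intro borel_measurable_continuous_onI continuous_intros)
  have i: "integrable (lborel \<Otimes>\<^sub>M lborel) (\<lambda>(x, \<xi>). ?k x \<xi> * (f x * g \<xi>))"
  proof (rule Bochner_Integration.integrable_bound[OF integrable_pair_tensor[OF f g]])
    show "(\<lambda>(x, \<xi>). ?k x \<xi> * (f x * g \<xi>)) \<in> borel_measurable (lborel \<Otimes>\<^sub>M lborel)"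
      unfolding split_beta' by measurable
    show "AE p in lborel \<Otimes>\<^sub>M lborel. norm (case p of (x, \<xi>) \<Rightarrow> ?k x \<xi> * (f x * g \<xi>))
        \<le> norm (case p of (x, \<xi>) \<Rightarrow> f x * g \<xi>)"
      by (intro AE_I2) (simp only: split_beta' norm_mult norm_fourier_kernel mult_1 order.refl)
  qed
  have "(LINT \<xi>|lborel. fourier_integral f \<xi> * g \<xi>) = ?c * (LINT \<xi>|lborel. (LINT x|lborel. ?k x \<xi> * (f x * g \<xi>)))"
  proof -
    have "fourier_integral f \<xi> * g \<xi> = ?c * (LINT x|lborel. ?k x \<xi> * (f x * g \<xi>))" for \<xi>
      unfolding fourier_integral_def mult.assoc[symmetric] by simp
    then show ?thesis by simp
  qed
  also have "\<dots> = ?c * (LINT x|lborel. (LINT \<xi>|lborel. ?k x \<xi> * (f x * g \<xi>)))"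
    by (simp only: lborel_pair.Fubini_integral[OF i])
  also have "\<dots> = (LINT x|lborel. f x * (?c * (LINT \<xi>|lborel. ?k x \<xi> * g \<xi>)))"
  proof -
    have "(LINT \<xi>|lborel. ?k x \<xi> * (f x * g \<xi>)) = f x * (LINT \<xi>|lborel. ?k x \<xi> * g \<xi>)" for x
      unfolding mult.left_commute[of _ "f x"] by simp
    then show ?thesis by (simp only: mult.left_commute[of ?c] integral_mult_right_zero[symmetric])
  qed
  also have "\<dots> = (LINT x|lborel. f x * fourier_integral g x)"
    unfolding fourier_integral_def by (simp add: inner_commute)
  finally show ?thesis .
qed

lemma borel_measurable_cnj [measurable]: "cnj \<in> borel_measurable borel"
  by (intro borel_measurable_continuous_onI continuous_intros)

text \<open>The constant depends on the dimension alone, hence on a type; the dummy argument carries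
  it.\<close>

definition fourier_const :: "'a::euclidean_space itself \<Rightarrow> real" where
  "fourier_const _ = (2 * pi) powr (- (real DIM('a) / 2))"

lemma fourier_integral_eq:
  fixes f :: "'a::euclidean_space \<Rightarrow> complex"
  shows "fourier_integral f \<xi> = complex_of_real (fourier_const TYPE('a)) *
     (LINT x|lborel. fourier_kernel \<xi> x * f x)"
  by (simp add: fourier_integral_def fourier_const_def)

lemma fourier_integral_scale:
  fixes f :: "'a::euclidean_space \<Rightarrow> complex"
  assumes [measurable]: "f \<in> borel_measurable borel" and e: "e > 0"
  shows "complex_of_real (e ^ DIM('a)) * fourier_integral (\<lambda>x. f (e *\<^sub>R x)) (e *\<^sub>R \<xi>) = fourier_integral f \<xi>"
proof -
  have "(LINT x|lborel. fourier_kernel \<xi> x * f x)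
     = \<bar>e\<bar> ^ DIM('a) *\<^sub>R (LINT x|lborel. exp (- (\<i> * complex_of_real (\<xi> \<bullet> (0 + e *\<^sub>R x)))) * f (0 + e *\<^sub>R x))"
    by (rule integral_affine_euclidean) (use e in auto)
  then show ?thesis using e by (simp add: fourier_integral_eq scaleR_conv_of_real)
qed

lemma integrable_shift:
  fixes f :: "'a::euclidean_space \<Rightarrow> 'b::{banach,second_countable_topology}"
  shows "integrable lborel f \<Longrightarrow> integrable lborel (\<lambda>x. f (t + x))"
  using integrable_affine_euclidean[of f 1 t] by simp

lemma integral_shift:
  fixes f :: "'a::euclidean_space \<Rightarrow> 'b::{banach,second_countable_topology}"
  shows "f \<in> borel_measurable borel \<Longrightarrow> (LINT x|lborel. f (t + x)) = (LINT x|lborel. f x)"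
  using integral_affine_euclidean[of f 1 t] by simp

text \<open>The convolution of f with its reflected conjugate. Its transform is the squared modulus
  of the transform of f up to a constant, and its value at 0 is the squared norm, so Plancherel's
  identity amounts to Fourier inversion of this function at 0.\<close>

definition autocorrelation :: "('a::euclidean_space \<Rightarrow> complex) \<Rightarrow> 'a \<Rightarrow> complex" where
  "autocorrelation f z = (LINT x|lborel. f (x + z) * cnj (f x))"

lemma autocorrelation_pair:
  fixes f :: "'a::euclidean_space \<Rightarrow> complex"
  assumes f: "integrable lborel f"
  shows "integrable (lborel \<Otimes>\<^sub>M lborel) (\<lambda>(x, z). f (x + z) * cnj (f x))"
proof (rule lborel_pair.Fubini_integrable)
  have [measurable]: "f \<in> borel_measurable borel" using f by auto
  show "(\<lambda>(x, z). f (x + z) * cnj (f x)) \<in> borel_measurable (lborel \<Otimes>\<^sub>M lborel)" by measurable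
  show "AE x in lborel. integrable lborel (\<lambda>z. case (x, z) of (x, z) \<Rightarrow> f (x + z) * cnj (f x))"
    using integrable_shift[OF f] by auto
  have "(LINT z|lborel. norm (case (x, z) of (x, z) \<Rightarrow> f (x + z) * cnj (f x)))
      = (LINT z|lborel. norm (f z)) * norm (f x)" for x
    using integral_shift[of "\<lambda>x. norm (f x)" x] by (simp add: norm_mult)
  then show "integrable lborel (\<lambda>x. LINT z|lborel. norm (case (x, z) of (x, z) \<Rightarrow> f (x + z) * cnj (f x)))"
    using f by simp
qed

lemma autocorrelation_integrable:
  assumes "integrable lborel f"
  shows "integrable lborel (autocorrelation f)"
  using lborel_pair.integrable_snd[OF autocorrelation_pair[OF assms]]
  by (simp add: autocorrelation_def[abs_def])

text \<open>Writing the kernel at z as the kernel at x + z times the conjugate kernel at x separates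
  the double integral into a product of an integral and its conjugate.\<close>

lemma fourier_integral_autocorrelation:
  fixes f :: "'a::euclidean_space \<Rightarrow> complex"
  assumes f: "integrable lborel f"
  shows "complex_of_real (fourier_const TYPE('a)) * fourier_integral (autocorrelation f) \<xi>
     = complex_of_real ((norm (fourier_integral f \<xi>))\<^sup>2)"
proof -
  let ?c = "complex_of_real (fourier_const TYPE('a))"
  let ?k = "\<lambda>z::'a. fourier_kernel \<xi> z"
  define I where "I = (LINT x|lborel. ?k x * f x)"
  have [measurable]: "f \<in> borel_measurable borel" using f by auto
  have i: "integrable (lborel \<Otimes>\<^sub>M lborel) (\<lambda>(x, z). ?k z * (f (x + z) * cnj (f x)))"
  proof (rule Bochner_Integration.integrable_bound[OF autocorrelation_pair[OF f]])
    show "(\<lambda>(x, z). ?k z * (f (x + z) * cnj (f x))) \<in> borel_measurable (lborel \<Otimes>\<^sub>M lborel)"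
      by measurable
    show "AE p in lborel \<Otimes>\<^sub>M lborel. norm (case p of (x, z) \<Rightarrow> ?k z * (f (x + z) * cnj (f x)))
        \<le> norm (case p of (x, z) \<Rightarrow> f (x + z) * cnj (f x))"
      by (intro AE_I2) (simp only: split_beta' norm_mult norm_fourier_kernel mult_1 order.refl)
  qed
  have inner: "(LINT z|lborel. ?k z * (f (x + z) * cnj (f x))) = I * cnj (?k x * f x)" for x
  proof -
    have "?k z * (f (x + z) * cnj (f x)) = cnj (?k x * f x) * (?k (x + z) * f (x + z))" for z
    proof -
      have "?k z = cnj (?k x) * ?k (x + z)"
        by (simp add: exp_cnj inner_add_right distrib_left flip: exp_add)
      then show ?thesis by (simp only: complex_cnj_mult mult_ac)
    qed
    then have "(LINT z|lborel. ?k z * (f (x + z) * cnj (f x)))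
       = cnj (?k x * f x) * (LINT z|lborel. ?k (x + z) * f (x + z))"
      by (simp only: integral_mult_right_zero)
    also have "(LINT z|lborel. ?k (x + z) * f (x + z)) = I"
      unfolding I_def by (rule integral_shift) simp
    finally show ?thesis by (simp add: mult.commute)
  qed
  have "(LINT z|lborel. ?k z * autocorrelation f z) = (LINT z|lborel. LINT x|lborel. ?k z * (f (x + z) * cnj (f x)))"
    by (simp add: autocorrelation_def)
  also have "\<dots> = (LINT x|lborel. LINT z|lborel. ?k z * (f (x + z) * cnj (f x)))"
    by (rule lborel_pair.Fubini_integral[OF i])
  also have "\<dots> = (LINT x|lborel. I * cnj (?k x * f x))" by (simp only: inner)
  also have "\<dots> = I * cnj I"
    unfolding I_def by (simp only: integral_mult_right_zero Bochner_Integration.integral_cnj)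
  finally have "?c * fourier_integral (autocorrelation f) \<xi> = ?c * ?c * (I * cnj I)"
    by (simp add: fourier_integral_eq)
  moreover have "fourier_integral f \<xi> = ?c * I" by (simp add: fourier_integral_eq I_def)
  ultimately show ?thesis
    by (simp only: complex_norm_square) simp
qed

lemma autocorrelation_bound:
  assumes f: "f \<in> L2_space"
  shows "norm (autocorrelation f z) \<le> (norm_L2 f)\<^sup>2"
proof -
  have c: "(\<lambda>x. cnj (f x)) \<in> L2_space"
    by (rule L2_dominated(1)[OF _ f, of _ 1]) (use L2_measurable[OF f] in auto)
  have "norm_L2 (\<lambda>x. cnj (f x)) = norm_L2 f" by (simp add: norm_L2_def)
  then show ?thesis
    using L2_inner_bound(2)[OF L2_translate(1)[OF f, of z] c]
    by (simp add: autocorrelation_def L2_translate[OF f] power2_eq_square)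
qed

text \<open>The error is the pairing of a translation difference with the conjugate of f; by
  Cauchy-Schwarz it vanishes with the translation difference. Continuity at 0 is all that the limit
  below requires.\<close>

lemma autocorrelation_tendsto:
  assumes f: "f \<in> L2_space" and h: "h \<longlonglongrightarrow> 0"
  shows "(\<lambda>n. autocorrelation f (h n)) \<longlonglongrightarrow> complex_of_real ((norm_L2 f)\<^sup>2)"
proof -
  have c: "(\<lambda>x. cnj (f x)) \<in> L2_space"
    by (rule L2_dominated(1)[OF _ f, of _ 1]) (use L2_measurable[OF f] in auto)
  have "norm (autocorrelation f (h n) - complex_of_real ((norm_L2 f)\<^sup>2))
      \<le> norm_L2 (\<lambda>x. f (x + h n) - f x) * norm_L2 (\<lambda>x. cnj (f x))" for n
  proof -
    have "complex_of_real ((norm_L2 f)\<^sup>2) = (LINT x|lborel. f x * cnj (f x))"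
      unfolding norm_L2_sq integral_complex_of_real[symmetric] complex_norm_square ..
    then have "autocorrelation f (h n) - complex_of_real ((norm_L2 f)\<^sup>2)
      = (LINT x|lborel. (f (x + h n) - f x) * cnj (f x))"
      unfolding autocorrelation_def left_diff_distrib
      by (subst Bochner_Integration.integral_diff)
         (auto intro!: L2_inner_bound L2_translate f c)
    then show ?thesis
      using L2_inner_bound(2)[OF L2_diff(1)[OF L2_translate(1)[OF f, of "h n"] f] c] by simp
  qed
  moreover have "(\<lambda>n. norm_L2 (\<lambda>x. f (x + h n) - f x) * norm_L2 (\<lambda>x. cnj (f x))) \<longlonglongrightarrow> 0"
    using tendsto_mult_right[OF L2_translation_continuous[OF f h]] by simp
  ultimately have "(\<lambda>n. autocorrelation f (h n) - complex_of_real ((norm_L2 f)\<^sup>2)) \<longlonglongrightarrow> 0"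
    by (rule Lim_null_comparison[OF always_eventually[OF allI]])
  then show ?thesis by (simp add: LIM_zero_iff)
qed

lemma gaussian_integral:
  "complex_of_real (fourier_const TYPE('a)) * (LINT x::'a::euclidean_space|lborel. gaussian x) = 1"
proof -
  have "fourier_integral gaussian (0::'a) = gaussian (0::'a)" by (simp add: fourier_integral_gaussian)
  then show ?thesis by (simp add: fourier_integral_eq gaussian_norm)
qed

text \<open>The multiplication formula is applied to the autocorrelation and a dilated Gaussian. The
  substitution by e then moves the dilation from the transform of the Gaussian to the
  autocorrelation.\<close>

lemma plancherel_gaussian:
  fixes f :: "'a::euclidean_space \<Rightarrow> complex"
  assumes f: "integrable lborel f" and e: "e > 0"
  shows "(LINT \<xi>|lborel. complex_of_real ((norm (fourier_integral f \<xi>))\<^sup>2) * gaussian (e *\<^sub>R \<xi>))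
     = complex_of_real (fourier_const TYPE('a)) * (LINT z|lborel. autocorrelation f (e *\<^sub>R z) * gaussian z)"
proof -
  let ?h = "autocorrelation f" and ?g = "\<lambda>x::'a. gaussian (e *\<^sub>R x)"
  have h: "integrable lborel ?h" by (rule autocorrelation_integrable[OF f])
  have [measurable]: "?h \<in> borel_measurable borel" using h by auto
  have g: "integrable lborel ?g"
    using integrable_affine_euclidean[OF gaussian_integrable, of e 0] e by simp
  have [measurable]: "?g \<in> borel_measurable borel" using g by auto
  have Fg: "complex_of_real (e ^ DIM('a)) * fourier_integral ?g (e *\<^sub>R z) = gaussian z" for z
    using fourier_integral_scale[of "gaussian :: 'a \<Rightarrow> _" e z] e by (simp add: fourier_integral_gaussian)
  have "(LINT \<xi>|lborel. fourier_integral ?h \<xi> * ?g \<xi>) = (LINT z|lborel. ?h z * fourier_integral ?g z)"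
    by (rule fourier_integral_duality[OF h g])
  also have "\<dots> = \<bar>e\<bar> ^ DIM('a) *\<^sub>R (LINT z|lborel. ?h (0 + e *\<^sub>R z) * fourier_integral ?g (0 + e *\<^sub>R z))"
    by (rule integral_affine_euclidean) (use e in auto)
  also have "\<dots> = (LINT z|lborel. ?h (e *\<^sub>R z) * (complex_of_real (e ^ DIM('a)) * fourier_integral ?g (e *\<^sub>R z)))"
    unfolding scaleR_conv_of_real integral_mult_right_zero[symmetric]
    using e by (intro Bochner_Integration.integral_cong refl) (simp add: mult_ac)
  finally have *: "(LINT \<xi>|lborel. fourier_integral ?h \<xi> * ?g \<xi>) = (LINT z|lborel. ?h (e *\<^sub>R z) * gaussian z)"
    unfolding Fg .
  show ?thesis
    unfolding *[symmetric] fourier_integral_autocorrelation[OF f, symmetric] mult.assoc by simp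
qed

text \<open>In the regularised identity e tends to 0. The right side converges by domination with a
  multiple of the Gaussian. On the left Fatou gives one inequality, and the Gaussian factor being at
  most 1 gives the other.\<close>

lemma plancherel_L1:
  fixes f :: "'a::euclidean_space \<Rightarrow> complex"
  assumes f: "integrable lborel f" and f2: "f \<in> L2_space"
  shows "fourier_integral f \<in> L2_space" "norm_L2 (fourier_integral f) = norm_L2 f"
proof -
  have [measurable]: "f \<in> borel_measurable borel" using f by auto
  have [measurable]: "autocorrelation f \<in> borel_measurable borel" using autocorrelation_integrable[OF f] by auto
  define e where "e n = 1 / real (Suc n)" for n
  have e: "e n > 0" for n by (simp add: e_def)
  have e0: "e \<longlonglongrightarrow> 0" unfolding e_def by (rule LIMSEQ_Suc[OF lim_1_over_n])
  let ?F = "\<lambda>\<xi>. (norm (fourier_integral f \<xi>))\<^sup>2"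
  define A where "A n = (LINT \<xi>|lborel. ?F \<xi> * exp (- (norm (e n *\<^sub>R \<xi>))\<^sup>2 / 2))" for n
  have Aeq: "complex_of_real (A n) = complex_of_real (fourier_const TYPE('a)) * (LINT z|lborel. autocorrelation f (e n *\<^sub>R z) * gaussian z)" for n
  proof -
    have "complex_of_real (A n) = (LINT \<xi>|lborel. complex_of_real (?F \<xi>) * gaussian (e n *\<^sub>R \<xi>))"
      unfolding A_def integral_complex_of_real[symmetric] gaussian_norm of_real_mult ..
    also have "\<dots> = complex_of_real (fourier_const TYPE('a)) * (LINT z|lborel. autocorrelation f (e n *\<^sub>R z) * gaussian z)"
      by (rule plancherel_gaussian[OF f e])
    finally show ?thesis .
  qed
  have "(\<lambda>n. LINT z|lborel. autocorrelation f (e n *\<^sub>R z) * gaussian z)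
     \<longlonglongrightarrow> (LINT z::'a|lborel. complex_of_real ((norm_L2 f)\<^sup>2) * gaussian z)"
  proof (rule integral_dominated_convergence[where w = "\<lambda>z. (norm_L2 f)\<^sup>2 * norm (gaussian z)"])
    show "AE z in lborel. (\<lambda>n. autocorrelation f (e n *\<^sub>R z) * gaussian z) \<longlonglongrightarrow> complex_of_real ((norm_L2 f)\<^sup>2) * gaussian z"
    proof (intro AE_I2 tendsto_mult tendsto_const autocorrelation_tendsto[OF f2])
      fix z :: 'a
      show "(\<lambda>n. e n *\<^sub>R z) \<longlonglongrightarrow> 0" using tendsto_scaleR[OF e0 tendsto_const[of z]] by simp
    qed
    show "AE z in lborel. norm (autocorrelation f (e n *\<^sub>R z) * gaussian z) \<le> (norm_L2 f)\<^sup>2 * norm (gaussian z)" for n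
      unfolding norm_mult by (intro AE_I2 mult_right_mono autocorrelation_bound f2 norm_ge_zero)
    show "integrable lborel (\<lambda>z::'a. (norm_L2 f)\<^sup>2 * norm (gaussian z))"
      by (intro integrable_mult_right integrable_norm gaussian_integrable)
    show "(\<lambda>z. autocorrelation f (e n *\<^sub>R z) * gaussian z) \<in> borel_measurable lborel" for n by measurable
    show "(\<lambda>z::'a. complex_of_real ((norm_L2 f)\<^sup>2) * gaussian z) \<in> borel_measurable lborel" by measurable
  qed
  then have "(\<lambda>n. complex_of_real (A n)) \<longlonglongrightarrow> complex_of_real (fourier_const TYPE('a)) *
     (LINT z::'a|lborel. complex_of_real ((norm_L2 f)\<^sup>2) * gaussian z)"
    unfolding Aeq by (rule tendsto_mult[OF tendsto_const])
  moreover have "complex_of_real (fourier_const TYPE('a)) *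
     (LINT z::'a|lborel. complex_of_real ((norm_L2 f)\<^sup>2) * gaussian z) = complex_of_real ((norm_L2 f)\<^sup>2)"
    unfolding integral_mult_right_zero mult.left_commute[of "complex_of_real (fourier_const TYPE('a))"] gaussian_integral by simp
  ultimately have Alim: "A \<longlonglongrightarrow> (norm_L2 f)\<^sup>2" by (simp only: tendsto_of_real_iff)
  define B where "B n \<xi> = ?F \<xi> * exp (- (norm (e n *\<^sub>R \<xi>))\<^sup>2 / 2)" for n \<xi>
  have [measurable]: "B n \<in> borel_measurable borel" for n unfolding B_def by measurable
  \<comment> \<open>The transform of an integrable function is bounded, so the Gaussian makes this
    integrable before square integrability of the transform is known.\<close>
  have Bint: "integrable lborel (B n)" for n
  proof -
    define M where "M = (2 * pi) powr (- (real DIM('a) / 2)) * (LINT x|lborel. norm (f x))"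
    have "integrable lborel (\<lambda>\<xi>::'a. M\<^sup>2 * norm (gaussian (e n *\<^sub>R \<xi>)))"
      using integrable_affine_euclidean[OF gaussian_integrable, of "e n" 0] e[of n] by auto
    then show ?thesis
    proof (rule Bochner_Integration.integrable_bound)
      show "AE \<xi> in lborel. norm (B n \<xi>) \<le> norm (M\<^sup>2 * norm (gaussian (e n *\<^sub>R \<xi>)))"
        using norm_fourier_integral_le[OF f]
        by (intro AE_I2) (auto simp: B_def abs_mult gaussian_norm M_def intro!: mult_right_mono power_mono)
    qed simp
  qed
  have An: "(\<integral>\<^sup>+\<xi>. ennreal (B n \<xi>) \<partial>lborel) = ennreal (A n)" for n
    unfolding A_def B_def[symmetric] by (rule nn_integral_eq_integral[OF Bint]) (simp add: B_def)
  have lim: "(\<lambda>n. ennreal (B n \<xi>)) \<longlonglongrightarrow> ennreal (?F \<xi>)" for \<xi>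
  proof (intro tendsto_ennrealI)
    have "(\<lambda>n. B n \<xi>) \<longlonglongrightarrow> ?F \<xi> * exp (- (norm (0 *\<^sub>R \<xi>))\<^sup>2 / 2)"
      unfolding B_def by (intro tendsto_intros e0) auto
    then show "(\<lambda>n. B n \<xi>) \<longlonglongrightarrow> ?F \<xi>" by simp
  qed
  have limA: "(\<lambda>n. ennreal (A n)) \<longlonglongrightarrow> ennreal ((norm_L2 f)\<^sup>2)" by (intro tendsto_ennrealI Alim)
  have "(\<integral>\<^sup>+\<xi>. ennreal (?F \<xi>) \<partial>lborel) = (\<integral>\<^sup>+\<xi>. liminf (\<lambda>n. ennreal (B n \<xi>)) \<partial>lborel)"
    using lim_imp_Liminf[OF _ lim] by simp
  also have "\<dots> \<le> liminf (\<lambda>n. \<integral>\<^sup>+\<xi>. ennreal (B n \<xi>) \<partial>lborel)"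
    by (rule nn_integral_liminf) simp
  also have "\<dots> = ennreal ((norm_L2 f)\<^sup>2)"
    unfolding An by (rule lim_imp_Liminf[OF _ limA]) simp
  finally have le: "(\<integral>\<^sup>+\<xi>. ennreal (?F \<xi>) \<partial>lborel) \<le> ennreal ((norm_L2 f)\<^sup>2)" .
  show FL2: "fourier_integral f \<in> L2_space"
    by (rule norm_L2_leI(1)[OF _ le]) auto
  have upper: "norm_L2 (fourier_integral f) \<le> norm_L2 f"
    by (rule norm_L2_leI(2)[OF _ le]) auto
  have "ennreal (A n) \<le> ennreal ((norm_L2 (fourier_integral f))\<^sup>2)" for n
    unfolding An[symmetric] nn_integral_L2[OF FL2, symmetric]
  proof (rule nn_integral_mono, rule ennreal_leI)
    fix \<xi>
    show "B n \<xi> \<le> ?F \<xi>" unfolding B_def by (rule mult_left_le) auto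
  qed
  then have "A n \<le> (norm_L2 (fourier_integral f))\<^sup>2" for n
    by (subst (asm) ennreal_le_iff) auto
  then have "(norm_L2 f)\<^sup>2 \<le> (norm_L2 (fourier_integral f))\<^sup>2"
    by (rule LIMSEQ_le_const2[OF Alim, OF exI, OF allI, OF impI])
  then have "norm_L2 f \<le> norm_L2 (fourier_integral f)" by (rule power2_le_imp_le) simp
  with upper show "norm_L2 (fourier_integral f) = norm_L2 f" by simp
qed

section \<open>The Fourier transform of square integrable functions\<close>

text \<open>The cut-off inside \<open>is_fourier\<close>, given a name.\<close>

definition truncate :: "real \<Rightarrow> ('a::euclidean_space \<Rightarrow> complex) \<Rightarrow> 'a \<Rightarrow> complex" where
  "truncate R f x = indicator (cball 0 R) x *\<^sub>R f x"

lemma truncate_L2: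
  assumes f: "f \<in> L2_space"
  shows "truncate R f \<in> L2_space"
  by (rule L2_dominated(1)[OF _ f, of _ 1])
     (use L2_measurable[OF f] in \<open>auto simp: truncate_def[abs_def] indicator_def\<close>)

text \<open>On a ball, which has finite measure, the modulus is at most 1 plus its square.\<close>

lemma truncate_integrable:
  fixes f :: "'a::euclidean_space \<Rightarrow> complex"
  assumes f: "f \<in> L2_space"
  shows "integrable lborel (truncate R f)"
proof -
  note [measurable] = L2_measurable[OF f] L2_measurable[OF truncate_L2[OF f, of R]]
  have "integrable lborel (\<lambda>x. indicator (cball 0 R) x + (norm (f x))\<^sup>2)"
    using f emeasure_bounded_finite[of "cball (0::'a) R"] by (auto simp: L2_space_def)
  then show ?thesis
  proof (rule Bochner_Integration.integrable_bound)
    have "norm z \<le> 1 + (norm z)\<^sup>2" for z :: complex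
      using zero_le_power2[of "norm z - 1/2"] by (simp add: power2_eq_square algebra_simps)
    then show "AE x in lborel. norm (truncate R f x) \<le> norm (indicator (cball 0 R) x + (norm (f x))\<^sup>2)"
      by (intro AE_I2) (simp add: truncate_def indicator_def)
  qed simp
qed

lemma truncate_tendsto:
  fixes f :: "'a::euclidean_space \<Rightarrow> complex"
  assumes f: "f \<in> L2_space"
  shows "((\<lambda>R. norm_L2 (\<lambda>x. f x - truncate R f x)) \<longlongrightarrow> 0) at_top"
proof -
  note [measurable] = L2_measurable[OF f] L2_measurable[OF truncate_L2[OF f]]
  have "((\<lambda>R. LINT x|lborel. (norm (f x - truncate R f x))\<^sup>2) \<longlongrightarrow> (LINT x::'a|lborel. 0)) at_top"
  proof (rule integral_dominated_convergence_at_top[where w = "\<lambda>x. (norm (f x))\<^sup>2"])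
    show "AE x in lborel. ((\<lambda>R. (norm (f x - truncate R f x))\<^sup>2) \<longlongrightarrow> 0) at_top"
    proof (intro AE_I2 tendsto_eventually)
      fix x
      show "\<forall>\<^sub>F R in at_top. (norm (f x - truncate R f x))\<^sup>2 = 0"
        using eventually_ge_at_top[of "norm x"] by eventually_elim (simp add: truncate_def)
    qed
  qed (use f in \<open>auto simp: truncate_def L2_space_def indicator_def\<close>)
  then have "((\<lambda>R. sqrt (LINT x|lborel. (norm (f x - truncate R f x))\<^sup>2)) \<longlongrightarrow> sqrt 0) at_top"
    by (intro tendsto_real_sqrt) simp
  then show ?thesis by (simp add: norm_L2_def)
qed

lemma fourier_integral_truncate_L2:
  assumes "f \<in> L2_space"
  shows "fourier_integral (truncate R f) \<in> L2_space"
  by (intro plancherel_L1 truncate_integrable truncate_L2 assms)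

lemma norm_L2_fourier_integral_diff:
  assumes "integrable lborel f" "f \<in> L2_space" "integrable lborel g" "g \<in> L2_space"
  shows "norm_L2 (\<lambda>\<xi>. fourier_integral f \<xi> - fourier_integral g \<xi>) = norm_L2 (\<lambda>x. f x - g x)"
proof -
  have "fourier_integral (\<lambda>x. f x - g x) = (\<lambda>\<xi>. fourier_integral f \<xi> - fourier_integral g \<xi>)"
    by (rule ext) (intro fourier_integral_diff assms)
  then show ?thesis using plancherel_L1(2)[of "\<lambda>x. f x - g x"] assms by (simp add: L2_diff)
qed

text \<open>By Plancherel the transform of each truncation is square integrable, so the distance in
  \<open>ennreal\<close> is finite and equals the square of a genuine
  \<open>norm_L2\<close>.\<close>

lemma is_fourier_iff:
  "is_fourier f g \<longleftrightarrow> f \<in> L2_space \<and> g \<in> L2_space \<and>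
     ((\<lambda>R. norm_L2 (\<lambda>\<xi>. g \<xi> - fourier_integral (truncate R f) \<xi>)) \<longlongrightarrow> 0) at_top"
proof -
  have "((\<lambda>R. \<integral>\<^sup>+ \<xi>. ennreal ((norm (g \<xi> - fourier_integral
              (\<lambda>x. indicator (cball 0 R) x *\<^sub>R f x) \<xi>))\<^sup>2) \<partial>lborel) \<longlongrightarrow> 0) at_top
    \<longleftrightarrow> ((\<lambda>R. norm_L2 (\<lambda>\<xi>. g \<xi> - fourier_integral (truncate R f) \<xi>)) \<longlongrightarrow> 0) at_top"
    (is "?L \<longleftrightarrow> ?R") if f: "f \<in> L2_space" and g: "g \<in> L2_space"
  proof -
    have eq: "(\<integral>\<^sup>+ \<xi>. ennreal ((norm (g \<xi> - fourier_integral (truncate R f) \<xi>))\<^sup>2) \<partial>lborel)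
        = ennreal ((norm_L2 (\<lambda>\<xi>. g \<xi> - fourier_integral (truncate R f) \<xi>))\<^sup>2)" for R
      by (intro nn_integral_L2 L2_diff g fourier_integral_truncate_L2 f)
    have "?L \<longleftrightarrow> ((\<lambda>R. ennreal ((norm_L2 (\<lambda>\<xi>. g \<xi> - fourier_integral (truncate R f) \<xi>))\<^sup>2)) \<longlongrightarrow> ennreal 0) at_top"
      unfolding eq[symmetric] by (simp add: truncate_def[abs_def])
    also have "\<dots> \<longleftrightarrow> ((\<lambda>R. (norm_L2 (\<lambda>\<xi>. g \<xi> - fourier_integral (truncate R f) \<xi>))\<^sup>2) \<longlongrightarrow> 0) at_top"
      by (rule tendsto_ennreal_iff) auto
    also have "\<dots> \<longleftrightarrow> ?R"
      by (simp add: power_tendsto_0_iff)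
    finally show ?thesis .
  qed
  then show ?thesis unfolding is_fourier_def by blast
qed

lemma is_fourier_L2: "is_fourier f g \<Longrightarrow> f \<in> L2_space" "is_fourier f g \<Longrightarrow> g \<in> L2_space"
  by (auto simp: is_fourier_def)

text \<open>The truncations are Cauchy, the transform is isometric on them, and \<open>L2\<close> is
  complete. Completeness is used along integer radii only.\<close>

lemma is_fourier_exists:
  fixes f :: "'a::euclidean_space \<Rightarrow> complex"
  assumes f: "f \<in> L2_space"
  shows "\<exists>g. is_fourier f g"
proof -
  let ?F = "\<lambda>R. fourier_integral (truncate R f)"
  let ?d = "\<lambda>R. norm_L2 (\<lambda>x. f x - truncate R f x)"
  have dist: "norm_L2 (\<lambda>\<xi>. ?F R \<xi> - ?F S \<xi>) \<le> ?d R + ?d S" for R S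
  proof -
    have "norm_L2 (\<lambda>\<xi>. ?F R \<xi> - ?F S \<xi>) = norm_L2 (\<lambda>x. truncate R f x - truncate S f x)"
      by (intro norm_L2_fourier_integral_diff truncate_integrable truncate_L2 f)
    also have "\<dots> \<le> norm_L2 (\<lambda>x. truncate R f x - f x) + norm_L2 (\<lambda>x. f x - truncate S f x)"
      by (intro L2_diff_triangle truncate_L2 f)
    finally show ?thesis by (simp add: norm_L2_minus_commute[of f])
  qed
  have dn: "(\<lambda>n. ?d (real n)) \<longlonglongrightarrow> 0"
    by (rule filterlim_compose[OF truncate_tendsto[OF f] filterlim_real_sequentially])
  have "\<exists>g\<in>L2_space. (\<lambda>n. norm_L2 (\<lambda>\<xi>. g \<xi> - ?F (real n) \<xi>)) \<longlonglongrightarrow> 0"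
  proof (rule L2_complete)
    show "?F (real n) \<in> L2_space" for n by (rule fourier_integral_truncate_L2[OF f])
    fix e :: real assume "e > 0"
    then obtain N where N: "\<And>n. n \<ge> N \<Longrightarrow> norm (?d (real n) - 0) < e/2"
      using LIMSEQ_D[OF dn, of "e/2"] by auto
    then have *: "\<And>n. n \<ge> N \<Longrightarrow> ?d (real n) < e/2" by simp
    show "\<exists>N. \<forall>m\<ge>N. \<forall>n\<ge>N. norm_L2 (\<lambda>x. ?F (real m) x - ?F (real n) x) < e"
    proof (intro exI[of _ N] allI impI)
      fix m n assume "m \<ge> N" "n \<ge> N"
      from *[OF this(1)] *[OF this(2)] dist[of "real m" "real n"]
      show "norm_L2 (\<lambda>x. ?F (real m) x - ?F (real n) x) < e" by linarith
    qed
  qed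
  then obtain g where g: "g \<in> L2_space" "(\<lambda>n. norm_L2 (\<lambda>\<xi>. g \<xi> - ?F (real n) \<xi>)) \<longlonglongrightarrow> 0" by blast
  \<comment> \<open>Passing to the limit in n with R fixed bounds the distance for every real
    radius, as the limit over \<open>at_top\<close> demands.\<close>
  have "norm_L2 (\<lambda>\<xi>. g \<xi> - ?F R \<xi>) \<le> ?d R" for R
  proof -
    have "(\<lambda>n. norm_L2 (\<lambda>\<xi>. g \<xi> - ?F (real n) \<xi>) + (?d (real n) + ?d R)) \<longlonglongrightarrow> 0 + (0 + ?d R)"
      by (intro tendsto_add g dn tendsto_const)
    moreover have "norm_L2 (\<lambda>\<xi>. g \<xi> - ?F R \<xi>) \<le> norm_L2 (\<lambda>\<xi>. g \<xi> - ?F (real n) \<xi>) + (?d (real n) + ?d R)" for n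
      using L2_diff_triangle[OF g(1) fourier_integral_truncate_L2[OF f, of "real n"] fourier_integral_truncate_L2[OF f, of R]]
        dist[of "real n" R] by linarith
    ultimately show ?thesis by (intro LIMSEQ_le_const) auto
  qed
  then have "((\<lambda>R. norm_L2 (\<lambda>\<xi>. g \<xi> - ?F R \<xi>)) \<longlongrightarrow> 0) at_top"
    by (intro tendsto_null_squeeze[OF truncate_tendsto[OF f]]) auto
  then show ?thesis using f g by (auto simp: is_fourier_iff)
qed

lemma is_fourier_norm:
  assumes "is_fourier f g"
  shows "norm_L2 g = norm_L2 f"
proof -
  note fg = is_fourier_L2[OF assms]
  have "((\<lambda>R. norm_L2 (fourier_integral (truncate R f))) \<longlongrightarrow> norm_L2 g) at_top"
    by (rule L2_limit_norm) (use assms in \<open>auto simp: is_fourier_iff fourier_integral_truncate_L2\<close>)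
  moreover have "((\<lambda>R. norm_L2 (truncate R f)) \<longlongrightarrow> norm_L2 f) at_top"
    by (rule L2_limit_norm) (use fg truncate_tendsto in \<open>auto simp: truncate_L2\<close>)
  moreover have "norm_L2 (fourier_integral (truncate R f)) = norm_L2 (truncate R f)" for R
    by (intro plancherel_L1 truncate_integrable truncate_L2 fg)
  ultimately show ?thesis by (simp add: tendsto_unique[OF trivial_limit_at_top_linorder])
qed

section \<open>Linearity, uniqueness, duality and surjectivity of the transform on square integrable
  functions\<close>

lemma is_fourier_add:
  assumes 1: "is_fourier f g" and 2: "is_fourier f' g'"
  shows "is_fourier (\<lambda>x. f x + f' x) (\<lambda>x. g x + g' x)"
proof -
  note L2 = is_fourier_L2[OF 1] is_fourier_L2[OF 2]
  have "((\<lambda>R. norm_L2 (\<lambda>\<xi>. g \<xi> - fourier_integral (truncate R f) \<xi>)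
      + norm_L2 (\<lambda>\<xi>. g' \<xi> - fourier_integral (truncate R f') \<xi>)) \<longlongrightarrow> 0) at_top"
    using tendsto_add[of _ 0 at_top _ 0] 1 2 by (auto simp: is_fourier_iff)
  then have "((\<lambda>R. norm_L2 (\<lambda>\<xi>. g \<xi> + g' \<xi> - fourier_integral (truncate R (\<lambda>x. f x + f' x)) \<xi>)) \<longlongrightarrow> 0) at_top"
  proof (rule tendsto_null_squeeze)
    fix R
    have "truncate R (\<lambda>x. f x + f' x) = (\<lambda>x. truncate R f x + truncate R f' x)"
      by (simp add: truncate_def fun_eq_iff scaleR_add_right)
    then have "fourier_integral (truncate R (\<lambda>x. f x + f' x)) \<xi>
        = fourier_integral (truncate R f) \<xi> + fourier_integral (truncate R f') \<xi>" for \<xi>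
      using fourier_integral_add[OF truncate_integrable[OF L2(1)] truncate_integrable[OF L2(3)]] by simp
    then show "norm_L2 (\<lambda>\<xi>. g \<xi> + g' \<xi> - fourier_integral (truncate R (\<lambda>x. f x + f' x)) \<xi>)
      \<le> norm_L2 (\<lambda>\<xi>. g \<xi> - fourier_integral (truncate R f) \<xi>)
        + norm_L2 (\<lambda>\<xi>. g' \<xi> - fourier_integral (truncate R f') \<xi>)"
      using L2_add(2)[of "\<lambda>\<xi>. g \<xi> - fourier_integral (truncate R f) \<xi>" "\<lambda>\<xi>. g' \<xi> - fourier_integral (truncate R f') \<xi>"] L2
      by (simp add: L2_diff fourier_integral_truncate_L2 add_diff_add)
  qed simp
  then show ?thesis using L2 by (simp add: is_fourier_iff L2_add)
qed

lemma is_fourier_cmult: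
  assumes 1: "is_fourier f g"
  shows "is_fourier (\<lambda>x. c * f x) (\<lambda>x. c * g x)"
proof -
  note L2 = is_fourier_L2[OF 1]
  have "((\<lambda>R. norm c * norm_L2 (\<lambda>\<xi>. g \<xi> - fourier_integral (truncate R f) \<xi>)) \<longlongrightarrow> norm c * 0) at_top"
    using 1 by (intro tendsto_mult tendsto_const) (simp add: is_fourier_iff)
  moreover have "norm_L2 (\<lambda>\<xi>. c * g \<xi> - fourier_integral (truncate R (\<lambda>x. c * f x)) \<xi>)
      = norm c * norm_L2 (\<lambda>\<xi>. g \<xi> - fourier_integral (truncate R f) \<xi>)" for R
  proof -
    have "truncate R (\<lambda>x. c * f x) = (\<lambda>x. c * truncate R f x)" by (simp add: truncate_def fun_eq_iff)
    then show ?thesis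
      using L2_scale(2)[of "\<lambda>\<xi>. g \<xi> - fourier_integral (truncate R f) \<xi>" c] L2
      by (simp add: fourier_integral_cmult L2_diff fourier_integral_truncate_L2 right_diff_distrib)
  qed
  ultimately show ?thesis using L2 by (simp add: is_fourier_iff L2_scale)
qed

lemma is_fourier_diff:
  assumes 1: "is_fourier f g" and 2: "is_fourier f' g'"
  shows "is_fourier (\<lambda>x. f x - f' x) (\<lambda>x. g x - g' x)"
  using is_fourier_add[OF 1 is_fourier_cmult[OF 2, of "-1"]] by simp

lemma is_fourier_cong:
  assumes 1: "is_fourier f g"
    and "AE x in lborel. f x = f' x" "AE x in lborel. g x = g' x"
    and [measurable]: "f' \<in> borel_measurable borel" "g' \<in> borel_measurable borel"
  shows "is_fourier f' g'"
proof -
  note L2 = is_fourier_L2[OF 1]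
  note [measurable] = L2_measurable[OF L2(1)] L2_measurable[OF L2(2)]
    L2_measurable[OF truncate_L2[OF L2(1)]]
    L2_measurable[OF truncate_L2[OF L2_cong_AE[OF L2(1) assms(4,2)]]]
  have "fourier_integral (truncate R f') \<xi> = fourier_integral (truncate R f) \<xi>" for R \<xi>
  proof -
    have "(LINT x|lborel. fourier_kernel \<xi> x * truncate R f' x)
      = (LINT x|lborel. fourier_kernel \<xi> x * truncate R f x)"
    proof (rule integral_cong_AE)
      show "AE x in lborel. fourier_kernel \<xi> x * truncate R f' x
          = fourier_kernel \<xi> x * truncate R f x"
        using assms(2) by eventually_elim (simp add: truncate_def)
    qed auto
    then show ?thesis by (simp add: fourier_integral_eq)
  qed
  moreover have "norm_L2 (\<lambda>\<xi>. g' \<xi> - fourier_integral (truncate R f) \<xi>)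
      = norm_L2 (\<lambda>\<xi>. g \<xi> - fourier_integral (truncate R f) \<xi>)" for R
    using assms(3) L2_measurable[OF fourier_integral_truncate_L2[OF L2(1), of R]]
    by (intro norm_L2_cong_AE) auto
  ultimately show ?thesis
    using 1 L2_cong_AE[OF L2(1) _ assms(2)] L2_cong_AE[OF L2(2) _ assms(3)] by (simp add: is_fourier_iff)
qed

lemma is_fourier_zero_AE:
  assumes "is_fourier f g"
  shows "(AE x in lborel. f x = 0) \<longleftrightarrow> (AE x in lborel. g x = 0)"
proof -
  note L2 = is_fourier_L2[OF assms]
  have *: "(AE x in lborel. h x = 0) \<longleftrightarrow> norm_L2 h = 0" if h: "h \<in> L2_space" for h :: "'a \<Rightarrow> complex"
    using norm_L2_eq_0_AE[OF h] norm_L2_cong_AE[OF L2_measurable[OF h], of "\<lambda>x. 0"] by auto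
  show ?thesis using is_fourier_norm[OF assms] *[OF L2(1)] *[OF L2(2)] by simp
qed

text \<open>The difference of the two pairs is again a transform pair and norms agree. One direction
  is uniqueness of the transform, the other its injectivity.\<close>

lemma is_fourier_AE_iff:
  assumes "is_fourier f g" "is_fourier f' g'"
  shows "(AE x in lborel. f x = f' x) \<longleftrightarrow> (AE x in lborel. g x = g' x)"
  using is_fourier_zero_AE[OF is_fourier_diff[OF assms]] by simp

lemma is_fourier_fourier: "f \<in> L2_space \<Longrightarrow> is_fourier f (fourier f)"
  unfolding fourier_def by (rule someI_ex[OF is_fourier_exists])

text \<open>Identifies the \<open>L2\<close> transform with the integral for integrable data; this
  is how the boundedness of the integral reaches \<open>fourier\<close>.\<close>

lemma is_fourier_L1:
  assumes f: "integrable lborel f" and f2: "f \<in> L2_space"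
  shows "is_fourier f (fourier_integral f)"
  using f f2 truncate_tendsto[OF f2]
  by (simp add: is_fourier_iff plancherel_L1 norm_L2_fourier_integral_diff truncate_integrable truncate_L2)

lemma L2_integral_tendsto:
  fixes f g :: "'a::euclidean_space \<Rightarrow> complex"
  assumes f: "f \<in> L2_space" and g: "g \<in> L2_space"
    and fn: "\<And>i. fn i \<in> L2_space" and gn: "\<And>i. gn i \<in> L2_space"
    and limf: "((\<lambda>i. norm_L2 (\<lambda>x. f x - fn i x)) \<longlongrightarrow> 0) F" and limg: "((\<lambda>i. norm_L2 (\<lambda>x. g x - gn i x)) \<longlongrightarrow> 0) F"
  shows "((\<lambda>i. LINT x|lborel. fn i x * gn i x) \<longlongrightarrow> (LINT x|lborel. f x * g x)) F"
proof -
  let ?b = "\<lambda>i. norm_L2 (\<lambda>x. f x - fn i x) * norm_L2 (gn i) + norm_L2 f * norm_L2 (\<lambda>x. g x - gn i x)"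
  have "(?b \<longlongrightarrow> 0 * norm_L2 g + norm_L2 f * 0) F"
    by (intro tendsto_intros limf limg L2_limit_norm[OF gn g limg])
  then have b: "(?b \<longlongrightarrow> 0) F" by simp
  have "norm ((LINT x|lborel. f x * g x) - (LINT x|lborel. fn i x * gn i x)) \<le> ?b i" for i
  proof -
    note int = L2_inner_bound(1)[OF f g] L2_inner_bound(1)[OF fn[of i] gn[of i]]
      L2_inner_bound(1)[OF L2_diff(1)[OF f fn[of i]] gn[of i]] L2_inner_bound(1)[OF f L2_diff(1)[OF g gn[of i]]]
    have "(LINT x|lborel. f x * g x) - (LINT x|lborel. fn i x * gn i x) = (LINT x|lborel. f x * g x - fn i x * gn i x)"
      by (rule Bochner_Integration.integral_diff[OF int(1,2), symmetric])
    also have "\<dots> = (LINT x|lborel. (f x - fn i x) * gn i x + f x * (g x - gn i x))"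
      by (simp add: algebra_simps)
    also have "\<dots> = (LINT x|lborel. (f x - fn i x) * gn i x) + (LINT x|lborel. f x * (g x - gn i x))"
      by (rule Bochner_Integration.integral_add[OF int(3,4)])
    finally have eq: "(LINT x|lborel. f x * g x) - (LINT x|lborel. fn i x * gn i x)
      = (LINT x|lborel. (f x - fn i x) * gn i x) + (LINT x|lborel. f x * (g x - gn i x))" .
    show ?thesis
      unfolding eq
      by (intro order.trans[OF norm_triangle_ineq] add_mono L2_inner_bound(2) L2_diff f g fn gn)
  qed
  then have "((\<lambda>i. (LINT x|lborel. fn i x * gn i x) - (LINT x|lborel. f x * g x)) \<longlongrightarrow> 0) F"
    by (intro Lim_null_comparison[OF _ b] always_eventually allI) (simp only: norm_minus_commute)
  then show ?thesis by (simp add: LIM_zero_iff)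
qed

text \<open>The multiplication formula holds for truncations, and the bilinear pairing is continuous
  in both arguments.\<close>

lemma is_fourier_duality:
  assumes 1: "is_fourier f f'" and 2: "is_fourier g g'"
  shows "(LINT x|lborel. f' x * g x) = (LINT x|lborel. f x * g' x)"
proof -
  note L2 = is_fourier_L2[OF 1] is_fourier_L2[OF 2]
  have "((\<lambda>R. LINT x|lborel. fourier_integral (truncate R f) x * truncate R g x) \<longlongrightarrow> (LINT x|lborel. f' x * g x)) at_top"
    using 1 2 L2 by (intro L2_integral_tendsto) (auto simp: is_fourier_iff fourier_integral_truncate_L2 truncate_L2 truncate_tendsto)
  moreover have "((\<lambda>R. LINT x|lborel. truncate R f x * fourier_integral (truncate R g) x) \<longlongrightarrow> (LINT x|lborel. f x * g' x)) at_top"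
    using 1 2 L2 by (intro L2_integral_tendsto) (auto simp: is_fourier_iff fourier_integral_truncate_L2 truncate_L2 truncate_tendsto)
  moreover have "(LINT x|lborel. fourier_integral (truncate R f) x * truncate R g x)
      = (LINT x|lborel. truncate R f x * fourier_integral (truncate R g) x)" for R
    by (intro fourier_integral_duality truncate_integrable L2)
  ultimately show ?thesis by (simp add: tendsto_unique[OF trivial_limit_at_top_linorder])
qed

lemma L2_cnj:
  assumes "f \<in> L2_space"
  shows "(\<lambda>x. cnj (f x)) \<in> L2_space"
  by (rule L2_dominated(1)[OF _ assms, of _ 1]) (use L2_measurable[OF assms] in auto)

text \<open>With \<open>q\<close> the inverse transform of \<open>g\<close> (the conjugate of the transform of the conjugate) and \<open>p\<close> its
  transform, duality gives \<open>\<langle>p, g\<rangle> = \<parallel>q\<parallel>\<^sup>2\<close>, and all three norms agree, so \<open>\<parallel>p - g\<parallel> = 0\<close>.\<close>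

lemma is_fourier_surj:
  fixes g :: "'a::euclidean_space \<Rightarrow> complex"
  assumes g: "g \<in> L2_space"
  shows "\<exists>f. is_fourier f g"
proof -
  define q where "q x = cnj (fourier (\<lambda>x. cnj (g x)) x)" for x
  have 1: "is_fourier (\<lambda>x. cnj (g x)) (\<lambda>x. cnj (q x))"
    unfolding q_def complex_cnj_cnj by (rule is_fourier_fourier[OF L2_cnj[OF g]])
  have q: "q \<in> L2_space" using L2_cnj[OF is_fourier_L2(2)[OF 1]] by simp
  define p where "p = fourier q"
  have 2: "is_fourier q p" unfolding p_def by (rule is_fourier_fourier[OF q])
  have p: "p \<in> L2_space" by (rule is_fourier_L2[OF 2])
  have np: "norm_L2 p = norm_L2 q" by (rule is_fourier_norm[OF 2])
  have nq: "norm_L2 q = norm_L2 g" using is_fourier_norm[OF 1] by (simp add: norm_L2_def)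
  have "(LINT x|lborel. p x * cnj (g x)) = (LINT x|lborel. q x * cnj (q x))"
    by (rule is_fourier_duality[OF 2 1])
  also have "\<dots> = complex_of_real ((norm_L2 q)\<^sup>2)"
    unfolding norm_L2_sq integral_complex_of_real[symmetric] complex_norm_square ..
  finally have ip: "(LINT x|lborel. Re (p x * cnj (g x))) = (norm_L2 q)\<^sup>2"
    using L2_inner_bound(1)[OF p L2_cnj[OF g]] by (simp del: times_complex.sel)
  have "(norm_L2 (\<lambda>x. p x - g x))\<^sup>2
     = (LINT x|lborel. ((norm (p x))\<^sup>2 + (norm (g x))\<^sup>2) - 2 * Re (p x * cnj (g x)))"
    unfolding norm_L2_sq
  proof (rule Bochner_Integration.integral_cong[OF refl])
    show "(norm (p x - g x))\<^sup>2 = ((norm (p x))\<^sup>2 + (norm (g x))\<^sup>2) - 2 * Re (p x * cnj (g x))" for x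
      unfolding cmod_power2 by (simp add: power2_eq_square algebra_simps)
  qed
  also have "\<dots> = ((norm_L2 p)\<^sup>2 + (norm_L2 g)\<^sup>2) - 2 * (norm_L2 q)\<^sup>2"
    using p g L2_inner_bound(1)[OF p L2_cnj[OF g]]
    by (subst Bochner_Integration.integral_diff)
       (auto simp: L2_space_def norm_L2_sq ip[unfolded norm_L2_sq] simp del: times_complex.sel)
  also have "\<dots> = 0" using np nq by simp
  finally have "norm_L2 (\<lambda>x. p x - g x) = 0" by simp
  then have "AE x in lborel. p x - g x = 0" by (intro norm_L2_eq_0_AE L2_diff p g)
  then have "is_fourier q g"
    by (intro is_fourier_cong[OF 2]) (use L2_measurable[OF q] L2_measurable[OF g] in auto)
  then show ?thesis by blast
qed

lemma is_fourier_inv_fourier: "g \<in> L2_space \<Longrightarrow> is_fourier (inv_fourier g) g"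
  unfolding inv_fourier_def by (rule someI_ex[OF is_fourier_surj])

lemma L2_reflect:
  fixes f :: "'a::euclidean_space \<Rightarrow> 'b::real_normed_vector"
  assumes f: "f \<in> L2_space"
  shows "(\<lambda>x. f (- x)) \<in> L2_space" "norm_L2 (\<lambda>x. f (- x)) = norm_L2 f"
proof -
  note [measurable] = L2_measurable[OF f]
  have i: "integrable lborel (\<lambda>x. (norm (f x))\<^sup>2)" using f by (simp add: L2_space_def)
  show "(\<lambda>x. f (- x)) \<in> L2_space"
    using integrable_affine_euclidean[OF i, of "-1" 0] by (simp add: L2_space_def)
  show "norm_L2 (\<lambda>x. f (- x)) = norm_L2 f"
    unfolding norm_L2_def
    using integral_affine_euclidean[of "\<lambda>x. (norm (f x))\<^sup>2" "-1" 0] by simp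
qed

text \<open>With injectivity this characterises real functions by Hermitian symmetry of their
  transforms.\<close>

lemma is_fourier_cnj:
  assumes 1: "is_fourier f g"
  shows "is_fourier (\<lambda>x. cnj (f x)) (\<lambda>\<xi>. cnj (g (- \<xi>)))"
proof -
  note L2 = is_fourier_L2[OF 1]
  have "norm_L2 (\<lambda>\<xi>. cnj (g (- \<xi>)) - fourier_integral (truncate R (\<lambda>x. cnj (f x))) \<xi>)
      = norm_L2 (\<lambda>\<xi>. g \<xi> - fourier_integral (truncate R f) \<xi>)" for R
  proof -
    have "truncate R (\<lambda>x. cnj (f x)) = (\<lambda>x. cnj (truncate R f x))"
      by (simp add: truncate_def fun_eq_iff scaleR_conv_of_real)
    then have "norm_L2 (\<lambda>\<xi>. cnj (g (- \<xi>)) - fourier_integral (truncate R (\<lambda>x. cnj (f x))) \<xi>)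
      = norm_L2 (\<lambda>\<xi>. cnj (g (- \<xi>) - fourier_integral (truncate R f) (- \<xi>)))"
      by (simp add: fourier_integral_cnj)
    also have "\<dots> = norm_L2 (\<lambda>\<xi>. g (- \<xi>) - fourier_integral (truncate R f) (- \<xi>))"
      unfolding norm_L2_def complex_mod_cnj ..
    also have "\<dots> = norm_L2 (\<lambda>\<xi>. g \<xi> - fourier_integral (truncate R f) \<xi>)"
      by (rule L2_reflect(2)) (intro L2_diff L2 fourier_integral_truncate_L2)
    finally show ?thesis .
  qed
  then show ?thesis using 1 L2_cnj[OF L2(1)] L2_cnj[OF L2_reflect(1)[OF L2(2)]]
    by (simp add: is_fourier_iff)
qed

section \<open>The damped oscillator\<close>

text \<open>A square root of the discriminant \<open>b\<^sup>2 / 4 - a\<^sup>2\<close> that is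
  complex-valued, so that oscillating and overdamped frequencies share one formula. The branch makes
  \<open>char_plus\<close> the real root closer to 0 in the overdamped case.\<close>

definition damping_root :: "real \<Rightarrow> real \<Rightarrow> complex" where
  "damping_root a b = (let d = b\<^sup>2 / 4 - a\<^sup>2 in
     if d \<ge> 0 then complex_of_real (sqrt d) else \<i> * complex_of_real (sqrt (- d)))"

lemma damping_root_sq: "(damping_root a b)\<^sup>2 = complex_of_real (b\<^sup>2 / 4 - a\<^sup>2)"
  by (simp add: damping_root_def Let_def power_mult_distrib flip: of_real_power)

definition char_plus :: "real \<Rightarrow> real \<Rightarrow> complex" where
  "char_plus a b = - complex_of_real (b / 2) + damping_root a b"

definition char_minus :: "real \<Rightarrow> real \<Rightarrow> complex" where
  "char_minus a b = - complex_of_real (b / 2) - damping_root a b"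

lemma char_sum: "char_plus a b + char_minus a b = - complex_of_real b"
  by (simp add: char_plus_def char_minus_def)

lemma char_prod: "char_plus a b * char_minus a b = complex_of_real (a\<^sup>2)"
proof -
  have "char_plus a b * char_minus a b = complex_of_real ((b / 2)\<^sup>2) - (damping_root a b)\<^sup>2"
    by (simp add: char_plus_def char_minus_def power2_eq_square algebra_simps)
  then show ?thesis by (simp add: damping_root_sq power_divide)
qed

text \<open>The solution with data 0 and 1: the divided difference of the exponential at the two
  roots, with its confluent value when they coincide. The argument is complex so that complex
  differentiation applies.\<close>

definition kernel :: "real \<Rightarrow> real \<Rightarrow> complex \<Rightarrow> complex" where
  "kernel a b z = (if damping_root a b = 0 then z * exp (char_plus a b * z)
     else (exp (char_plus a b * z) - exp (char_minus a b * z)) / (2 * damping_root a b))"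

text \<open>Here \<open>q - char_plus a b * p\<close> is the initial value of
  \<open>y' - char_plus a b * y\<close>. Unlike a combination of the two exponentials, this form
  remains valid for a double root.\<close>

definition damped :: "real \<Rightarrow> real \<Rightarrow> complex \<Rightarrow> complex \<Rightarrow> real \<Rightarrow> complex" where
  "damped a b p q t = exp (char_plus a b * t) * p + (q - char_plus a b * p) * kernel a b t"

text \<open>The derivative read off from the factored equation:
  \<open>y' - char_plus a b * y\<close> solves the first order equation of the other root.\<close>

definition damped' :: "real \<Rightarrow> real \<Rightarrow> complex \<Rightarrow> complex \<Rightarrow> real \<Rightarrow> complex" where
  "damped' a b p q t = char_plus a b * damped a b p q t + (q - char_plus a b * p) * exp (char_minus a b * t)"

lemma kernel_deriv:
  "(kernel a b has_field_derivative (char_plus a b * kernel a b z + exp (char_minus a b * z))) (at z)"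
proof (cases "damping_root a b = 0")
  case True
  then have "char_minus a b = char_plus a b" by (simp add: char_plus_def char_minus_def)
  then show ?thesis unfolding kernel_def[abs_def] using True
    by (auto intro!: derivative_eq_intros simp: algebra_simps)
next
  case False
  have "char_plus a b - char_minus a b = 2 * damping_root a b"
    by (simp add: char_plus_def char_minus_def)
  then have eq: "char_minus a b = char_plus a b - 2 * damping_root a b" by (simp add: algebra_simps)
  show ?thesis unfolding kernel_def[abs_def] using False
    by (auto intro!: derivative_eq_intros simp: field_simps eq)
qed

lemma damped_deriv: "(damped a b p q has_vector_derivative damped' a b p q t) (at t within S)"
proof -
  have "((\<lambda>z. exp (char_plus a b * z) * p + (q - char_plus a b * p) * kernel a b z)
     has_field_derivative damped' a b p q t) (at (complex_of_real t))"
    unfolding damped'_def damped_def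
    by (auto intro!: derivative_eq_intros kernel_deriv[THEN DERIV_chain2] simp: algebra_simps)
  from has_vector_derivative_real_field[OF this] show ?thesis unfolding damped_def[abs_def] .
qed

text \<open>Eliminating the exponential of \<open>char_minus\<close> leaves only the sum and the
  product of the roots, which are the coefficients of the equation.\<close>

lemma damped'_deriv:
  "(damped' a b p q has_vector_derivative
     - (complex_of_real b * damped' a b p q t + complex_of_real (a\<^sup>2) * damped a b p q t)) (at t within S)"
proof -
  let ?l = "char_plus a b" and ?m = "char_minus a b" and ?w = "q - char_plus a b * p"
  have "((\<lambda>z. ?w * exp (?m * z)) has_field_derivative ?w * (?m * exp (?m * t))) (at (complex_of_real t))"
    by (auto intro!: derivative_eq_intros)
  from has_vector_derivative_real_field[OF this, of S]
  have "((\<lambda>t. ?l * damped a b p q t + ?w * exp (?m * complex_of_real t)) has_vector_derivative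
     ?l * damped' a b p q t + ?w * (?m * exp (?m * t))) (at t within S)"
    by (rule has_vector_derivative_add[OF has_vector_derivative_mult_right[OF damped_deriv]])
  moreover have "?l * damped' a b p q t + ?w * (?m * exp (?m * t))
      = (?l + ?m) * damped' a b p q t - ?l * ?m * damped a b p q t"
    by (simp add: damped'_def algebra_simps)
  ultimately show ?thesis
    unfolding damped'_def[abs_def] by (simp add: char_sum char_prod flip: damped'_def)
qed

lemma damped_0 [simp]: "damped a b p q 0 = p" and damped'_0 [simp]: "damped' a b p q 0 = q"
  by (simp_all add: damped_def damped'_def kernel_def)

lemma damped_continuous: "continuous_on S (damped a b p q)" "continuous_on S (damped' a b p q)"
  by (auto simp: continuous_on_eq_continuous_within
      intro: has_vector_derivative_continuous damped_deriv damped'_deriv)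

section \<open>The Lyapunov estimate and energy bounds\<close>

text \<open>For positive a and b its reciprocal is \<open>1 / b + b / a\<^sup>2\<close>, so it is
  comparable to the smaller of b and \<open>a\<^sup>2 / b\<close>: the rate of weak damping and the
  size of the slow overdamped root.\<close>

definition damping_rate :: "real \<Rightarrow> real \<Rightarrow> real" where
  "damping_rate a b = a\<^sup>2 * b / (a\<^sup>2 + b\<^sup>2)"

lemma damping_rate_bounds:
  assumes "a > 0" "b > 0"
  shows "damping_rate a b > 0" "damping_rate a b \<le> a / 2" "damping_rate a b * (1 + (b / a)\<^sup>2) = b"
proof -
  have s: "a\<^sup>2 + b\<^sup>2 > 0" using assms by (simp add: add_pos_pos)
  show "damping_rate a b > 0" unfolding damping_rate_def using s assms by simp
  have "2 * a * b \<le> a\<^sup>2 + b\<^sup>2" by (rule sum_squares_bound)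
  then have "a * (2 * a * b) \<le> a * (a\<^sup>2 + b\<^sup>2)" using assms by (intro mult_left_mono) auto
  then show "damping_rate a b \<le> a / 2"
    unfolding damping_rate_def using s by (simp add: divide_le_eq power2_eq_square algebra_simps)
  define n where "n = a\<^sup>2 + b\<^sup>2"
  have "1 + (b / a)\<^sup>2 = n / a\<^sup>2" using assms by (simp add: n_def field_simps)
  then show "damping_rate a b * (1 + (b / a)\<^sup>2) = b"
    unfolding damping_rate_def n_def[symmetric] using s[folded n_def] assms by simp
qed

text \<open>The Lyapunov functional is \<open>\<bar>y'\<bar>\<^sup>2 + a\<^sup>2 \<bar>y\<bar>\<^sup>2 + \<rho> \<langle>y', y\<rangle>\<close>, where \<open>\<rho>\<close> is the damping rate.
  It is comparable to the energy because \<open>\<rho> \<le> a / 2\<close>.\<close>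

lemma lyapunov_algebra:
  fixes a b P Q J :: real
  assumes ab: "a > 0" "b > 0" and J: "\<bar>J\<bar> \<le> P * Q"
  defines "r \<equiv> damping_rate a b"
  shows "\<bar>r * J\<bar> \<le> (P\<^sup>2 + a\<^sup>2 * Q\<^sup>2) / 4"
    and "(r - 2 * b) * P\<^sup>2 - r * b * J - r * a\<^sup>2 * Q\<^sup>2 \<le> - (2 / 5) * r * (P\<^sup>2 + a\<^sup>2 * Q\<^sup>2 + r * J)"
proof -
  note r = damping_rate_bounds[OF ab, folded r_def]
  have "2 * P * (a * Q) \<le> P\<^sup>2 + (a * Q)\<^sup>2" by (rule sum_squares_bound)
  moreover have half: "X \<le> Y / 2" if "2 * X \<le> Y" for X Y :: real using that by simp
  moreover have "2 * P * (a * Q) = 2 * (a * (P * Q))" by simp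
  ultimately have 1: "a * (P * Q) \<le> (P\<^sup>2 + a\<^sup>2 * Q\<^sup>2) / 2"
    by (metis power_mult_distrib)
  have "\<bar>r * J\<bar> = r * \<bar>J\<bar>" using r by (simp add: abs_mult)
  also have "\<dots> \<le> (a / 2) * (P * Q)" using r J by (intro mult_mono) auto
  also have "\<dots> = a * (P * Q) / 2" by simp
  also have "\<dots> \<le> (P\<^sup>2 + a\<^sup>2 * Q\<^sup>2) / 2 / 2" using 1 by (rule divide_right_mono) simp
  finally show rJ: "\<bar>r * J\<bar> \<le> (P\<^sup>2 + a\<^sup>2 * Q\<^sup>2) / 4" by simp
  \<comment> \<open>Young's inequality with weight \<open>b / a\<close> for the cross term
    \<open>r * b * J\<close>: it uses up only half of the dissipation
    \<open>r * a\<^sup>2 * Q\<^sup>2\<close>, and the identity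
    \<open>r * (b / a)\<^sup>2 = b - r\<close> lets the other half be absorbed by
    \<open>b * P\<^sup>2\<close>.\<close>
  have "2 * (b / a * P) * (a * Q) \<le> (b / a * P)\<^sup>2 + (a * Q)\<^sup>2" by (rule sum_squares_bound)
  moreover have "2 * (b / a * P) * (a * Q) = 2 * (b * (P * Q))" using ab by simp
  ultimately have "b * (P * Q) \<le> ((b / a)\<^sup>2 * P\<^sup>2 + a\<^sup>2 * Q\<^sup>2) / 2"
    using half by (metis power_mult_distrib)
  then have "- (b * J) \<le> ((b / a)\<^sup>2 * P\<^sup>2 + a\<^sup>2 * Q\<^sup>2) / 2"
  proof -
    have "b * (- J) \<le> b * (P * Q)" using J ab by (intro mult_left_mono) auto
    with \<open>b * (P * Q) \<le> _\<close> show ?thesis by simp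
  qed
  then have 2: "r * (- (b * J)) \<le> r * (((b / a)\<^sup>2 * P\<^sup>2 + a\<^sup>2 * Q\<^sup>2) / 2)"
    using r by (intro mult_left_mono) auto
  have 3: "r * (r * J) \<le> r * ((P\<^sup>2 + a\<^sup>2 * Q\<^sup>2) / 4)"
    using r rJ by (intro mult_left_mono) auto
  have 4: "r * (b / a)\<^sup>2 = b - r" using r(3) by (simp add: algebra_simps)
  have 5: "r * ((b / a)\<^sup>2 * P\<^sup>2) = (b - r) * P\<^sup>2" using 4 by (simp flip: mult.assoc)
  have 6: "r * P\<^sup>2 \<le> b * P\<^sup>2"
  proof (rule mult_right_mono)
    have "r * 1 \<le> r * (1 + (b / a)\<^sup>2)" using r by (intro mult_left_mono) auto
    then show "r \<le> b" using r(3) by simp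
  qed simp
  \<comment> \<open>After Young's inequality at least half of \<open>u + v\<close> remains as
    dissipation, while the functional scaled by r is at most \<open>5 / 4\<close> of
    \<open>u + v\<close>; hence the factor 2/5.\<close>
  have "u - 2 * x - j - v \<le> - (2 / 5) * (u + v + k)"
    if "- j \<le> (w + v) / 2" "k \<le> (u + v) / 4" "w = x - u" "u \<le> x" "x \<ge> 0" for u v w x j k :: real
    using that by (simp add: field_simps)
  from this[of "r * (b * J)" "r * ((b / a)\<^sup>2 * P\<^sup>2)" "r * (a\<^sup>2 * Q\<^sup>2)" "r * (r * J)" "r * P\<^sup>2" "b * P\<^sup>2"]
  show "(r - 2 * b) * P\<^sup>2 - r * b * J - r * a\<^sup>2 * Q\<^sup>2 \<le> - (2 / 5) * r * (P\<^sup>2 + a\<^sup>2 * Q\<^sup>2 + r * J)"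
    using 2 3 5 6 ab by (simp add: algebra_simps)
qed

lemma energy_decay:
  fixes y y' :: "real \<Rightarrow> complex"
  assumes ab: "a > 0" "b > 0"
    and cont: "continuous_on {0..} y" "continuous_on {0..} y'"
    and dy: "\<And>t. t > 0 \<Longrightarrow> (y has_vector_derivative y' t) (at t)"
    and dy': "\<And>t. t > 0 \<Longrightarrow> (y' has_vector_derivative
        - (complex_of_real b * y' t + complex_of_real (a\<^sup>2) * y t)) (at t)"
    and t: "t \<ge> 0"
  shows "(norm (y' t))\<^sup>2 + a\<^sup>2 * (norm (y t))\<^sup>2
    \<le> 5 / 3 * exp (- (2 / 5) * damping_rate a b * t) * ((norm (y' 0))\<^sup>2 + a\<^sup>2 * (norm (y 0))\<^sup>2)"
proof -
  define r where "r = damping_rate a b"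
  define E where "E t = (norm (y' t))\<^sup>2 + a\<^sup>2 * (norm (y t))\<^sup>2" for t
  define L where "L t = y' t \<bullet> y' t + a\<^sup>2 * (y t \<bullet> y t) + r * (y' t \<bullet> y t)" for t
  define G where "G t = exp ((2 / 5) * r * t) * L t" for t
  have J: "\<bar>y' t \<bullet> y t\<bar> \<le> norm (y' t) * norm (y t)" for t by (rule Cauchy_Schwarz_ineq2)
  have LE: "L t = E t + r * (y' t \<bullet> y t)" for t by (simp add: L_def E_def power2_norm_eq_inner)
  have LEb: "\<bar>r * (y' t \<bullet> y t)\<bar> \<le> E t / 4" for t
    using lyapunov_algebra(1)[OF ab J[of t], folded r_def] by (simp add: E_def)
  have dL: "(L has_real_derivative
      ((r - 2 * b) * (norm (y' t))\<^sup>2 - r * b * (y' t \<bullet> y t) - r * a\<^sup>2 * (norm (y t))\<^sup>2)) (at t)" if t: "t > 0" for t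
  proof -
    note inner = bounded_bilinear.has_vector_derivative[OF bounded_bilinear_inner]
    have D: "(y' has_vector_derivative - (b *\<^sub>R y' t + a\<^sup>2 *\<^sub>R y t)) (at t)"
      using dy'[OF t] by (simp only: scaleR_conv_of_real)
    note d1 = inner[OF D D] and d2 = inner[OF dy[OF t] dy[OF t]] and d3 = inner[OF D dy[OF t]]
    have "(L has_real_derivative
       (y' t \<bullet> - (b *\<^sub>R y' t + a\<^sup>2 *\<^sub>R y t) + - (b *\<^sub>R y' t + a\<^sup>2 *\<^sub>R y t) \<bullet> y' t)
       + a\<^sup>2 * (y t \<bullet> y' t + y' t \<bullet> y t)
       + r * (y' t \<bullet> y' t + - (b *\<^sub>R y' t + a\<^sup>2 *\<^sub>R y t) \<bullet> y t)) (at t)"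
      unfolding L_def[abs_def]
      by (intro DERIV_add DERIV_cmult d1[folded has_real_derivative_iff_has_vector_derivative]
          d2[folded has_real_derivative_iff_has_vector_derivative] d3[folded has_real_derivative_iff_has_vector_derivative])
    then show ?thesis
      by (simp add: inner_add_left inner_add_right power2_norm_eq_inner inner_commute algebra_simps)
  qed
  have "G t \<le> G 0"
  proof (rule DERIV_nonpos_imp_decreasing_open[OF t])
    fix s assume s: "0 < s" "s < t"
    let ?D = "(r - 2 * b) * (norm (y' s))\<^sup>2 - r * b * (y' s \<bullet> y s) - r * a\<^sup>2 * (norm (y s))\<^sup>2"
    have "(G has_real_derivative exp ((2 / 5) * r * s) * (2 / 5 * r) * L s + ?D * exp ((2 / 5) * r * s)) (at s)"
      unfolding G_def[abs_def]
      by (rule derivative_eq_intros dL s refl | simp)+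
    moreover have "?D + (2 / 5) * r * L s \<le> 0"
      using lyapunov_algebra(2)[OF ab J[of s], folded r_def] by (simp add: LE E_def algebra_simps)
    then have "exp ((2 / 5) * r * s) * (?D + (2 / 5) * r * L s) \<le> 0"
      by (simp add: mult_nonneg_nonpos)
    ultimately show "\<exists>d. (G has_real_derivative d) (at s) \<and> d \<le> 0"
      by (intro exI conjI) (assumption, simp add: algebra_simps)
  next
    have "continuous_on {0..t} y" "continuous_on {0..t} y'"
      using cont by (auto elim: continuous_on_subset)
    then show "continuous_on {0..t} G" unfolding G_def L_def by (intro continuous_intros)
  qed
  then have "exp ((2 / 5) * r * t) * L t \<le> L 0" by (simp add: G_def)
  then have "L t \<le> exp (- (2 / 5) * r * t) * L 0" by (simp add: exp_minus field_simps)
  also have "\<dots> \<le> exp (- (2 / 5) * r * t) * (5 / 4 * E 0)"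
    using LEb[of 0] by (intro mult_left_mono) (auto simp: LE)
  finally have "3 / 4 * E t \<le> exp (- (2 / 5) * r * t) * (5 / 4 * E 0)"
    using LEb[of t] by (simp add: LE)
  moreover have "X \<le> 5 / 3 * e * Y" if "3 / 4 * X \<le> e * (5 / 4 * Y)" for X e Y :: real
    using that by (simp add: field_simps)
  ultimately have "E t \<le> 5 / 3 * exp (- (2 / 5) * r * t) * E 0" by blast
  then show ?thesis by (simp add: E_def r_def)
qed

text \<open>The difference of two solutions with equal data has zero initial energy, and
  \<open>a > 0\<close> recovers y from the energy.\<close>

lemma damped_unique:
  fixes y y' :: "real \<Rightarrow> complex"
  assumes ab: "a > 0" "b > 0"
    and cont: "continuous_on {0..} y" "continuous_on {0..} y'"
    and dy: "\<And>t. t > 0 \<Longrightarrow> (y has_vector_derivative y' t) (at t)"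
    and dy': "\<And>t. t > 0 \<Longrightarrow> (y' has_vector_derivative
        - (complex_of_real b * y' t + complex_of_real (a\<^sup>2) * y t)) (at t)"
    and t: "t \<ge> 0"
  shows "y t = damped a b (y 0) (y' 0) t"
proof -
  let ?z = "\<lambda>t. y t - damped a b (y 0) (y' 0) t" and ?z' = "\<lambda>t. y' t - damped' a b (y 0) (y' 0) t"
  have "(norm (?z' t))\<^sup>2 + a\<^sup>2 * (norm (?z t))\<^sup>2
    \<le> 5 / 3 * exp (- (2 / 5) * damping_rate a b * t) * ((norm (?z' 0))\<^sup>2 + a\<^sup>2 * (norm (?z 0))\<^sup>2)"
  proof (rule energy_decay[OF ab _ _ _ _ t])
    show "continuous_on {0..} ?z" "continuous_on {0..} ?z'"
      by (intro continuous_intros cont damped_continuous)+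
    show "(?z has_vector_derivative ?z' s) (at s)" if "s > 0" for s
      by (intro has_vector_derivative_diff dy that damped_deriv)
    show "(?z' has_vector_derivative - (complex_of_real b * ?z' s + complex_of_real (a\<^sup>2) * ?z s)) (at s)" if "s > 0" for s
      using has_vector_derivative_diff[OF dy'[OF that] damped'_deriv[of a b "y 0" "y' 0" s UNIV]]
      by (simp add: algebra_simps)
  qed
  then have "(norm (?z' t))\<^sup>2 + a\<^sup>2 * (norm (?z t))\<^sup>2 \<le> 0" by simp
  then have "a\<^sup>2 * (norm (?z t))\<^sup>2 \<le> 0" by (smt (verit) zero_le_power2)
  then show ?thesis using ab by (simp add: mult_le_0_iff)
qed

text \<open>Square root of the energy estimate: the rate 2/5 becomes 1/5, and 5/3 is enlarged to 4
  to make the root exact.\<close>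

lemma damped_energy:
  assumes ab: "a > 0" "b > 0" and t: "t \<ge> 0"
  shows "norm (damped' a b p q t) \<le> 2 * exp (- (1 / 5) * damping_rate a b * t) * (norm q + a * norm p)"
    and "a * norm (damped a b p q t) \<le> 2 * exp (- (1 / 5) * damping_rate a b * t) * (norm q + a * norm p)"
proof -
  define X where "X = 2 * exp (- (1 / 5) * damping_rate a b * t) * (norm q + a * norm p)"
  have X: "X \<ge> 0" using ab by (simp add: X_def)
  have "(norm (damped' a b p q t))\<^sup>2 + a\<^sup>2 * (norm (damped a b p q t))\<^sup>2
    \<le> 5 / 3 * exp (- (2 / 5) * damping_rate a b * t) * ((norm q)\<^sup>2 + a\<^sup>2 * (norm p)\<^sup>2)"
    using energy_decay[OF ab damped_continuous[of _ a b p q] damped_deriv damped'_deriv t] by simp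
  also have "\<dots> \<le> 4 * exp (- (2 / 5) * damping_rate a b * t) * (norm q + a * norm p)\<^sup>2"
  proof (intro mult_mono)
    show "(norm q)\<^sup>2 + a\<^sup>2 * (norm p)\<^sup>2 \<le> (norm q + a * norm p)\<^sup>2"
      using ab by (simp add: power2_sum power_mult_distrib)
  qed auto
  also have "\<dots> = X\<^sup>2"
    by (simp add: X_def power_mult_distrib exp_of_nat_mult[symmetric] mult_ac)
  finally have le: "(norm (damped' a b p q t))\<^sup>2 + (a * norm (damped a b p q t))\<^sup>2 \<le> X\<^sup>2"
    by (simp add: power_mult_distrib)
  show "norm (damped' a b p q t) \<le> X"
    by (rule power2_le_imp_le[OF _ X]) (use le in \<open>smt (verit) zero_le_power2\<close>)
  show "a * norm (damped a b p q t) \<le> X"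
    by (rule power2_le_imp_le[OF _ X]) (use le in \<open>smt (verit) zero_le_power2\<close>)
qed

lemma damped_energy_bound:
  assumes ab: "a > 0" "b > 0" and t: "t \<ge> 0"
  shows "norm (damped' a b p q t) \<le> 2 * (norm q + a * norm p)"
    and "a * norm (damped a b p q t) \<le> 2 * (norm q + a * norm p)"
proof -
  have "2 * exp (- (1 / 5) * damping_rate a b * t) * (norm q + a * norm p) \<le> 2 * 1 * (norm q + a * norm p)"
    using ab t damping_rate_bounds(1)[OF ab] by (intro mult_mono) auto
  then show "norm (damped' a b p q t) \<le> 2 * (norm q + a * norm p)"
     "a * norm (damped a b p q t) \<le> 2 * (norm q + a * norm p)"
    using damped_energy[OF ab t, of p q] by auto
qed

text \<open>A Lipschitz bound in time with the frequency-wise energy of the data as constant; it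
  dominates the difference quotients of the solution.\<close>

lemma damped_increment:
  assumes ab: "a > 0" "b > 0" and "s \<ge> 0" "t \<ge> 0"
  shows "norm (damped a b p q t - damped a b p q s) \<le> 2 * (norm q + a * norm p) * \<bar>t - s\<bar>"
proof -
  have "norm (damped a b p q t - damped a b p q s) \<le> 2 * (norm q + a * norm p) * norm (t - s)"
  proof (rule differentiable_bound[where S = "{0..}" and f' = "\<lambda>x h. h *\<^sub>R damped' a b p q x"])
    fix x :: real assume x: "x \<in> {0..}"
    show "(damped a b p q has_derivative (\<lambda>h. h *\<^sub>R damped' a b p q x)) (at x within {0..})"
      using damped_deriv by (simp add: has_vector_derivative_def)
    show "onorm (\<lambda>h. h *\<^sub>R damped' a b p q x) \<le> 2 * (norm q + a * norm p)"
      using damped_energy_bound(1)[OF ab, of x p q] x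
      by (subst onorm_scaleR_left) (auto simp: bounded_linear_ident onorm_id)
  qed (use assms in auto)
  then show ?thesis by simp
qed

text \<open>The energy controls only \<open>a * norm y\<close>. Integrating the derivative avoids
  the division by a, whose singularity at the origin need not be square integrable, at the price of
  growth in t.\<close>

lemma damped_linear_bound:
  assumes ab: "a > 0" "b > 0" and t: "t \<ge> 0"
  shows "norm (damped a b p q t) \<le> norm p + 2 * t * (norm q + a * norm p)"
proof -
  have "norm (damped a b p q t) \<le> norm p + norm (damped a b p q t - p)"
    using norm_triangle_ineq[of p "damped a b p q t - p"] by simp
  then show ?thesis
    using damped_increment[OF ab order.refl t, of p q] t by (simp add: mult_ac)
qed

text \<open>The slow root lies between \<open>- 2 * a\<^sup>2 / b\<close> and
  \<open>- a\<^sup>2 / b\<close>, the fast one below \<open>- b / 2\<close>. In the derivative the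
  slow mode gains the factor \<open>a\<^sup>2 / b\<close>, which gives the extra decay in time; the
  fast mode is kept as a separate term.\<close>

lemma damped_overdamped:
  assumes ab: "a > 0" "b > 0" and od: "8 * a\<^sup>2 \<le> b\<^sup>2" and t: "t \<ge> 0"
  shows "norm (damped a b p q t) \<le> 2 * exp (- (a\<^sup>2 / b) * t) * (norm p + norm q / b)"
    and "norm (damped' a b p q t) \<le> 2 * a\<^sup>2 / b * norm (damped a b p q t)
           + (norm q + b * norm p) * exp (- (b / 2) * t)"
proof -
  define s where "s = sqrt (b\<^sup>2 / 4 - a\<^sup>2)"
  \<comment> \<open>From \<open>a\<^sup>2 \<le> b\<^sup>2 / 8\<close> the discriminant is at least
    \<open>b\<^sup>2 / 8\<close>, hence at least \<open>(b / 3)\<^sup>2\<close>. This separates the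
    roots, so division by their difference in \<open>kernel\<close> costs a multiple of
    \<open>1 / b\<close>.\<close>
  have d: "b\<^sup>2 / 4 - a\<^sup>2 \<ge> (b / 3)\<^sup>2"
  proof -
    have "x / 9 \<le> x / 4 - y" if "8 * y \<le> x" "x \<ge> 0" for x y :: real using that by linarith
    from this[OF od] show ?thesis by (simp add: power_divide)
  qed
  have d0: "b\<^sup>2 / 4 - a\<^sup>2 \<ge> 0" using d zero_le_power2[of "b / 3"] by linarith
  have ssq: "s\<^sup>2 = b\<^sup>2 / 4 - a\<^sup>2" using d0 by (simp add: s_def)
  have s3: "s \<ge> b / 3" unfolding s_def using d by (rule real_le_rsqrt)
  have s0: "s > 0" using s3 ab by linarith
  have "s\<^sup>2 < (b / 2)\<^sup>2" using ssq ab by (simp add: power_divide)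
  then have s2: "s < b / 2" by (rule power2_less_imp_less) (use ab in simp)
  have root: "damping_root a b = complex_of_real s" using d0 by (simp add: damping_root_def s_def)
  define l m where "l = - b / 2 + s" and "m = - b / 2 - s"
  have cp: "char_plus a b = complex_of_real l" and cm: "char_minus a b = complex_of_real m"
    by (simp_all add: char_plus_def char_minus_def root l_def m_def)
  have lm: "l * m = a\<^sup>2" using ssq by (simp add: l_def m_def power2_eq_square field_simps)
  have m: "m \<le> - b / 2" "m \<ge> - b" using s0 s2 by (auto simp: m_def)
  have l0: "l < 0" using s2 by (simp add: l_def)
  \<comment> \<open>The product of the roots is \<open>a\<^sup>2\<close> and \<open>- m\<close> lies
    between \<open>b / 2\<close> and b, which bounds \<open>- l\<close> from both sides here and in
    \<open>l2\<close>.\<close>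
  have l1: "l \<le> - (a\<^sup>2 / b)"
  proof -
    have "a\<^sup>2 \<le> (- l) * b" unfolding lm[symmetric] using m l0 mult_left_mono_neg[of m "- b" l] mult_left_mono[of "- m" b "- l"] by simp
    then have "a\<^sup>2 / b \<le> - l" using ab by (simp add: divide_le_eq)
    then show ?thesis by simp
  qed
  have l2: "- l \<le> 2 * a\<^sup>2 / b"
  proof -
    have "(- l) * (b / 2) \<le> (- l) * (- m)" using m l0 by (intro mult_left_mono) auto
    then have "(- l) * b \<le> 2 * a\<^sup>2" using lm by simp
    then show ?thesis using ab by (simp add: le_divide_eq)
  qed
  have lb: "- l \<le> b / 4"
  proof -
    have "2 * a\<^sup>2 \<le> b * b / 4" using od by (simp add: power2_eq_square)
    then have "2 * a\<^sup>2 / b \<le> b / 4" using ab by (simp add: divide_le_eq)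
    then show ?thesis using l2 by linarith
  qed
  let ?e = "exp (- (a\<^sup>2 / b) * t)"
  have el: "exp (l * t) \<le> ?e" using mult_right_mono[OF l1 t] by simp
  have em: "exp (m * t) \<le> exp (l * t)" using s0 t by (auto simp: l_def m_def intro!: mult_right_mono)
  have em2: "exp (m * t) \<le> exp (- (b / 2) * t)" using mult_right_mono[OF m(1) t] by simp
  have expl: "exp (complex_of_real l * complex_of_real t) = complex_of_real (exp (l * t))"
    and expm: "exp (complex_of_real m * complex_of_real t) = complex_of_real (exp (m * t))"
    by (simp_all flip: of_real_mult exp_of_real)
  have kern: "norm (kernel a b t) \<le> 3 / (2 * b) * ?e"
  proof -
    have "kernel a b t = complex_of_real ((exp (l * t) - exp (m * t)) / (2 * s))"
      using s0 by (simp add: kernel_def root cp cm expl expm)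
    then have "norm (kernel a b t) = (exp (l * t) - exp (m * t)) / (2 * s)"
      using em s0 by (simp only: norm_of_real) simp
    also have "\<dots> \<le> ?e / (2 * s)" using el s0 by (intro divide_right_mono) (auto intro: order.trans[rotated])
    also have "\<dots> \<le> ?e / (2 * (b / 3))" using s3 ab by (intro divide_left_mono) auto
    finally show ?thesis by (simp add: field_simps)
  qed
  have w: "norm (q - char_plus a b * p) \<le> norm q + b / 4 * norm p"
  proof -
    have "norm (q - char_plus a b * p) \<le> norm q + norm (char_plus a b * p)" by (rule norm_triangle_ineq4)
    also have "norm (char_plus a b * p) = (- l) * norm p" using l0 by (simp add: cp norm_mult)
    also have "\<dots> \<le> b / 4 * norm p" using lb by (intro mult_right_mono) auto
    finally show ?thesis by simp
  qed
  have "norm (damped a b p q t) \<le> norm (exp (char_plus a b * t) * p) + norm ((q - char_plus a b * p) * kernel a b t)"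
    unfolding damped_def by (rule norm_triangle_ineq)
  also have "\<dots> \<le> ?e * norm p + (norm q + b / 4 * norm p) * (3 / (2 * b) * ?e)"
  proof (intro add_mono)
    show "norm (exp (char_plus a b * t) * p) \<le> ?e * norm p"
      unfolding cp expl norm_mult norm_of_real using el by (intro mult_right_mono) auto
    show "norm ((q - char_plus a b * p) * kernel a b t) \<le> (norm q + b / 4 * norm p) * (3 / (2 * b) * ?e)"
      unfolding norm_mult using w kern ab by (intro mult_mono) auto
  qed
  also have "\<dots> = ?e * (11 / 8 * norm p + 3 / 2 * (norm q / b))" using ab by (simp add: field_simps)
  also have "\<dots> \<le> ?e * (2 * (norm p + norm q / b))"
  proof (rule mult_left_mono)
    have "11 / 8 * x + 3 / 2 * y \<le> 2 * (x + y)" if "0 \<le> x" "0 \<le> y" for x y :: real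
      using that by simp
    note * = this
    show "11 / 8 * norm p + 3 / 2 * (norm q / b) \<le> 2 * (norm p + norm q / b)"
      by (rule *) (use ab in auto)
  qed simp
  finally show "norm (damped a b p q t) \<le> 2 * ?e * (norm p + norm q / b)" by (simp only: mult_ac)
  have "norm (damped' a b p q t) \<le> norm (char_plus a b * damped a b p q t)
      + norm ((q - char_plus a b * p) * exp (char_minus a b * t))"
    unfolding damped'_def by (rule norm_triangle_ineq)
  also have "\<dots> \<le> 2 * a\<^sup>2 / b * norm (damped a b p q t) + (norm q + b * norm p) * exp (- (b / 2) * t)"
  proof (intro add_mono)
    show "norm (char_plus a b * damped a b p q t) \<le> 2 * a\<^sup>2 / b * norm (damped a b p q t)"
      unfolding norm_mult cp norm_of_real using l2 l0 by (intro mult_right_mono) auto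
    show "norm ((q - char_plus a b * p) * exp (char_minus a b * t)) \<le> (norm q + b * norm p) * exp (- (b / 2) * t)"
      unfolding norm_mult cm expm norm_of_real
    proof (intro mult_mono)
      show "norm (q - char_plus a b * p) \<le> norm q + b * norm p"
        by (rule order.trans[OF w], intro add_left_mono mult_right_mono) (use ab in auto)
      show "\<bar>exp (m * t)\<bar> \<le> exp (- (b / 2) * t)" using em2 by simp
    qed (use ab in auto)
  qed
  finally show "norm (damped' a b p q t) \<le> 2 * a\<^sup>2 / b * norm (damped a b p q t)
           + (norm q + b * norm p) * exp (- (b / 2) * t)" .
qed

section \<open>Sobolev norms on the Fourier side\<close>

lemma L2_dominated_tendsto:
  fixes h :: "nat \<Rightarrow> 'a::euclidean_space \<Rightarrow> complex" and w :: "'a \<Rightarrow> real"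
  assumes w: "w \<in> L2_space" and h: "\<And>i. h i \<in> borel_measurable borel"
    and le: "\<And>i. AE x in lborel. norm (h i x) \<le> w x"
    and lim: "AE x in lborel. (\<lambda>i. h i x) \<longlonglongrightarrow> 0"
  shows "(\<lambda>i. norm_L2 (h i)) \<longlonglongrightarrow> 0"
proof -
  note [measurable] = h L2_measurable[OF w]
  have "(\<lambda>i. LINT x|lborel. (norm (h i x))\<^sup>2) \<longlonglongrightarrow> (LINT x::'a|lborel. 0)"
  proof (rule integral_dominated_convergence[where w = "\<lambda>x. (w x)\<^sup>2"])
    show "integrable lborel (\<lambda>x. (w x)\<^sup>2)" using w by (simp add: L2_space_def)
    show "AE x in lborel. (\<lambda>i. (norm (h i x))\<^sup>2) \<longlonglongrightarrow> 0"
      using lim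
    proof eventually_elim
      case (elim x)
      have "(\<lambda>i. (norm (h i x))\<^sup>2) \<longlonglongrightarrow> (norm (0::complex))\<^sup>2" by (intro tendsto_intros elim)
      then show ?case by simp
    qed
    show "AE x in lborel. norm ((norm (h i x))\<^sup>2) \<le> (w x)\<^sup>2" for i
      using le[of i] by eventually_elim (auto intro: power_mono)
  qed simp_all
  then have "(\<lambda>i. sqrt (LINT x|lborel. (norm (h i x))\<^sup>2)) \<longlonglongrightarrow> sqrt 0"
    by (intro tendsto_real_sqrt) simp
  then show ?thesis by (simp add: norm_L2_def)
qed

text \<open>The low frequencies are measured by a plain integral and the high ones by a pointwise
  majorant. Both pieces are shown to be square integrable, so the sum is estimated by a true
  triangle inequality.\<close>

lemma L2_split_bound:
  fixes f :: "'a::euclidean_space \<Rightarrow> complex" and g :: "'a \<Rightarrow> real"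
  assumes f: "f \<in> borel_measurable borel" and S: "S \<in> sets borel"
    and low: "(\<integral>\<^sup>+x. ennreal (indicator S x * (norm (f x))\<^sup>2) \<partial>lborel) \<le> ennreal (A\<^sup>2)" and A: "A \<ge> 0"
    and high: "AE x in lborel. x \<notin> S \<longrightarrow> norm (f x) \<le> B * g x" and g: "g \<in> L2_space" and B: "B \<ge> 0"
  shows "norm_L2 f \<le> A + B * norm_L2 g"
proof -
  note [measurable] = f S L2_measurable[OF g]
  let ?l = "\<lambda>x. indicator S x *\<^sub>R f x" and ?h = "\<lambda>x. indicator (- S) x *\<^sub>R f x"
  have "(\<integral>\<^sup>+x. ennreal ((norm (?l x))\<^sup>2) \<partial>lborel) \<le> ennreal (A\<^sup>2)"
    using low by (rule order.trans[rotated]) (intro nn_integral_mono ennreal_leI, simp add: indicator_def)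
  then have l: "?l \<in> L2_space" "norm_L2 ?l \<le> A"
    by (intro norm_L2_leI A; simp)+
  have "AE x in lborel. norm (?h x) \<le> B * norm (g x)"
    using high
  proof eventually_elim
    case (elim x)
    then show ?case using B mult_left_mono[OF abs_ge_self[of "g x"] B] by (auto simp: indicator_def)
  qed
  then have h: "?h \<in> L2_space" "norm_L2 ?h \<le> B * norm_L2 g"
    by (intro L2_dominated[OF _ g _ B]; simp)+
  have "f = (\<lambda>x. ?l x + ?h x)" by (auto simp: fun_eq_iff indicator_def)
  then have "norm_L2 f \<le> norm_L2 ?l + norm_L2 ?h" using L2_add(2)[OF l(1) h(1)] by simp
  then show ?thesis using l(2) h(2) by linarith
qed

section \<open>Sobolev norms through arbitrary representatives, and real functions\<close>

abbreviation is_fourier_real :: "('a::euclidean_space \<Rightarrow> real) \<Rightarrow> ('a \<Rightarrow> complex) \<Rightarrow> bool" where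
  "is_fourier_real f g \<equiv> is_fourier (\<lambda>x. complex_of_real (f x)) g"

lemma of_real_L2_iff: "(\<lambda>x. complex_of_real (f x)) \<in> L2_space \<longleftrightarrow> f \<in> L2_space"
proof -
  have "(\<lambda>x. complex_of_real (f x)) \<in> borel_measurable borel \<longleftrightarrow> f \<in> borel_measurable borel"
    using measurable_compose[of "\<lambda>x. complex_of_real (f x)" borel borel Re borel]
      measurable_compose[of f borel borel complex_of_real borel] by (intro iffI) simp_all
  then show ?thesis by (simp add: L2_space_def)
qed

lemma is_fourier_real_fourier_real: "f \<in> L2_space \<Longrightarrow> is_fourier_real f (fourier_real f)"
  by (simp add: is_fourier_fourier of_real_L2_iff)

lemma norm_L2_of_real: "norm_L2 (\<lambda>x. complex_of_real (f x)) = norm_L2 f"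
  by (simp add: norm_L2_def)

lemma is_fourier_real_norm: "is_fourier_real f g \<Longrightarrow> norm_L2 f = norm_L2 g"
  using is_fourier_norm[of "\<lambda>x. complex_of_real (f x)" g] by (simp add: norm_L2_of_real)

lemma is_fourier_real_AE:
  assumes "is_fourier_real f g"
  shows "AE \<xi> in lborel. fourier_real f \<xi> = g \<xi>"
  using is_fourier_AE_iff[OF is_fourier_fourier[OF is_fourier_L2(1)[OF assms]] assms] by simp

text \<open>The counterpart of \<open>nabla_symbol\<close> for an arbitrary representative of the
  transform in place of the one chosen by \<open>fourier\<close>.\<close>

definition weighted :: "real \<Rightarrow> ('a::euclidean_space \<Rightarrow> complex) \<Rightarrow> 'a \<Rightarrow> complex" where
  "weighted k g \<xi> = complex_of_real (norm \<xi> powr k) * g \<xi>"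

lemma weighted_measurable [measurable]: "g \<in> borel_measurable borel \<Longrightarrow> weighted k g \<in> borel_measurable borel"
  unfolding weighted_def[abs_def] by measurable

lemma norm_weighted: "norm (weighted k g \<xi>) = norm \<xi> powr k * norm (g \<xi>)"
  by (simp add: weighted_def norm_mult)

lemma weighted_diff: "weighted k (\<lambda>x. g x - h x) = (\<lambda>x. weighted k g x - weighted k h x)"
  by (simp add: weighted_def fun_eq_iff right_diff_distrib)

lemma nabla_symbol_AE:
  assumes "is_fourier_real f g"
  shows "AE \<xi> in lborel. nabla_symbol k f \<xi> = weighted k g \<xi>"
  using is_fourier_real_AE[OF assms] by eventually_elim (simp add: nabla_symbol_def weighted_def)

lemma nabla_symbol_measurable:
  assumes "is_fourier_real f g"
  shows "nabla_symbol k f \<in> borel_measurable borel"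
proof -
  have [measurable]: "fourier_real f \<in> borel_measurable borel"
    using is_fourier_L2[OF assms] by (intro L2_measurable is_fourier_L2(2)[OF is_fourier_fourier]) auto
  show ?thesis unfolding nabla_symbol_def[abs_def] by measurable
qed

lemma sobolev_iff:
  assumes "is_fourier_real f g"
  shows "f \<in> sobolev k \<longleftrightarrow> weighted k g \<in> L2_space"
proof -
  have g: "weighted k g \<in> borel_measurable borel"
    using L2_measurable[OF is_fourier_L2(2)[OF assms]] by measurable
  have "nabla_symbol k f \<in> L2_space \<longleftrightarrow> weighted k g \<in> L2_space"
    using L2_cong_AE[OF _ g nabla_symbol_AE[OF assms]]
      L2_cong_AE[OF _ nabla_symbol_measurable[OF assms], of "weighted k g" k] nabla_symbol_AE[OF assms, of k]
    by (auto simp: eq_commute)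
  then show ?thesis
    using is_fourier_L2[OF assms] by (simp add: sobolev_def of_real_L2_iff)
qed

lemma norm_nabla:
  assumes "is_fourier_real f g" "weighted k g \<in> L2_space"
  shows "norm_L2 (nabla k f) = norm_L2 (weighted k g)"
proof -
  have s: "nabla_symbol k f \<in> L2_space"
    using sobolev_iff[OF assms(1), of k] assms(2) by (simp add: sobolev_def)
  have "norm_L2 (nabla k f) = norm_L2 (nabla_symbol k f)"
    unfolding nabla_def by (rule is_fourier_norm[OF is_fourier_inv_fourier[OF s], symmetric])
  also have "\<dots> = norm_L2 (weighted k g)"
    using nabla_symbol_AE[OF assms(1), of k] L2_measurable[OF s] L2_measurable[OF assms(2)]
    by (intro norm_L2_cong_AE) (auto elim: eventually_mono)
  finally show ?thesis .
qed

lemma norm_sobolev_eq: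
  assumes "is_fourier_real f g" "weighted k g \<in> L2_space"
  shows "norm_sobolev k f = sqrt ((norm_L2 g)\<^sup>2 + (norm_L2 (weighted k g))\<^sup>2)"
  unfolding norm_sobolev_def norm_nabla[OF assms] is_fourier_real_norm[OF assms(1)] ..

lemma is_fourier_real_diff:
  "is_fourier_real f g \<Longrightarrow> is_fourier_real f' g' \<Longrightarrow> is_fourier_real (\<lambda>x. f x - f' x) (\<lambda>x. g x - g' x)"
  using is_fourier_diff[of "\<lambda>x. complex_of_real (f x)" g "\<lambda>x. complex_of_real (f' x)" g'] by simp

lemma is_fourier_real_divide:
  "is_fourier_real f g \<Longrightarrow> is_fourier_real (\<lambda>x. f x / c) (\<lambda>x. g x / complex_of_real c)"
  using is_fourier_cmult[of "\<lambda>x. complex_of_real (f x)" g "complex_of_real (1 / c)"] by simp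

text \<open>Dominated convergence on the Fourier side along sequences. The majorants may depend on
  an upper bound B of the times, since the solution bound grows in t and a convergent sequence of
  times is bounded.\<close>

lemma norm_sobolev_tendsto:
  fixes f :: "real \<Rightarrow> 'a::euclidean_space \<Rightarrow> real"
  assumes fg: "\<And>s. s \<in> S \<Longrightarrow> is_fourier_real (f s) (g s)"
    and w: "\<And>B. w B \<in> L2_space" "\<And>B. v B \<in> L2_space"
    and le: "\<And>s B. s \<in> S \<Longrightarrow> s \<le> B \<Longrightarrow> AE \<xi> in lborel. norm (g s \<xi>) \<le> w B \<xi>"
      "\<And>s B. s \<in> S \<Longrightarrow> s \<le> B \<Longrightarrow> AE \<xi> in lborel. norm (weighted k (g s) \<xi>) \<le> v B \<xi>"
    and lim: "AE \<xi> in lborel. ((\<lambda>s. g s \<xi>) \<longlongrightarrow> 0) (at t within S)"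
  shows "((\<lambda>s. norm_sobolev k (f s)) \<longlongrightarrow> 0) (at t within S)"
  unfolding tendsto_at_iff_sequentially comp_def
proof (intro allI impI)
  fix X :: "nat \<Rightarrow> real" assume X: "\<forall>i. X i \<in> S - {t}" "X \<longlonglongrightarrow> t"
  then obtain B where B: "\<And>i. X i \<le> B"
    using convergent_imp_Bseq[OF convergentI[OF X(2)]] by (auto simp: Bseq_def abs_le_iff)
  have XS: "X i \<in> S" for i using X(1) by auto
  have m: "g (X i) \<in> borel_measurable borel" for i by (rule L2_measurable[OF is_fourier_L2(2)[OF fg[OF XS]]])
  have lim0: "AE \<xi> in lborel. (\<lambda>i. g (X i) \<xi>) \<longlonglongrightarrow> 0"
    using lim by eventually_elim (use X in \<open>auto simp: tendsto_at_iff_sequentially comp_def\<close>)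
  have 1: "(\<lambda>i. norm_L2 (g (X i))) \<longlonglongrightarrow> 0"
    by (rule L2_dominated_tendsto[OF w(1)[of B] m le(1)[OF XS B] lim0])
  have 2: "(\<lambda>i. norm_L2 (weighted k (g (X i)))) \<longlonglongrightarrow> 0"
  proof (rule L2_dominated_tendsto[OF w(2)[of B] weighted_measurable[OF m] le(2)[OF XS B]])
    show "AE \<xi> in lborel. (\<lambda>i. weighted k (g (X i)) \<xi>) \<longlonglongrightarrow> 0"
      using lim0
    proof eventually_elim
      case (elim \<xi>)
      show ?case unfolding weighted_def using tendsto_mult_right_zero[OF elim] .
    qed
  qed
  have "weighted k (g (X i)) \<in> L2_space" for i
  proof (rule L2_dominated(1)[OF weighted_measurable[OF m] w(2)[of B]])
    show "AE \<xi> in lborel. norm (weighted k (g (X i)) \<xi>) \<le> 1 * norm (v B \<xi>)"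
      using le(2)[OF XS B, of i] by eventually_elim (auto intro: order.trans)
  qed simp
  then have eq: "norm_sobolev k (f (X i)) = sqrt ((norm_L2 (g (X i)))\<^sup>2 + (norm_L2 (weighted k (g (X i))))\<^sup>2)" for i
    by (intro norm_sobolev_eq fg XS)
  have "(\<lambda>i. norm_sobolev k (f (X i))) \<longlonglongrightarrow> sqrt (0\<^sup>2 + 0\<^sup>2)"
    unfolding eq by (intro tendsto_intros 1 2)
  then show "(\<lambda>i. norm_sobolev k (f (X i))) \<longlonglongrightarrow> 0" by simp
qed

lemma fourier_real_reflect:
  assumes "f \<in> L2_space"
  shows "AE \<xi> in lborel. fourier_real f (- \<xi>) = cnj (fourier_real f \<xi>)"
proof -
  have 1: "is_fourier_real f (fourier_real f)" by (rule is_fourier_real_fourier_real[OF assms])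
  have "AE \<xi> in lborel. cnj (fourier_real f (- \<xi>)) = fourier_real f \<xi>"
    using is_fourier_AE_iff[OF is_fourier_cnj[OF 1] 1] by simp
  then show ?thesis by eventually_elim (metis complex_cnj_cnj)
qed

definition real_inverse :: "('a::euclidean_space \<Rightarrow> complex) \<Rightarrow> 'a \<Rightarrow> real" where
  "real_inverse g x = Re (inv_fourier g x)"

text \<open>Hermitian symmetry makes the inverse transform equal to its conjugate almost everywhere,
  so taking the real part changes it only on a null set.\<close>

lemma is_fourier_real_inverse:
  assumes g: "g \<in> L2_space" and sym: "AE \<xi> in lborel. g (- \<xi>) = cnj (g \<xi>)"
  shows "is_fourier_real (real_inverse g) g"
proof -
  have 1: "is_fourier (inv_fourier g) g" by (rule is_fourier_inv_fourier[OF g])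
  note m = L2_measurable[OF is_fourier_L2(1)[OF 1]] L2_measurable[OF g]
  have "AE \<xi> in lborel. cnj (g (- \<xi>)) = g \<xi>" using sym by eventually_elim simp
  then have "AE x in lborel. cnj (inv_fourier g x) = inv_fourier g x"
    using is_fourier_AE_iff[OF is_fourier_cnj[OF 1] 1] by simp
  then have "AE x in lborel. inv_fourier g x = complex_of_real (real_inverse g x)"
    by eventually_elim (simp add: real_inverse_def complex_eq_iff)
  then show ?thesis
    by (rule is_fourier_cong[OF 1]) (use m in \<open>auto simp: real_inverse_def\<close>)
qed

lemma fourier_real_bounded:
  assumes "f \<in> L2_space" "integrable lborel f"
  shows "\<exists>M>0. AE \<xi> in lborel. norm (fourier_real f \<xi>) \<le> M"
proof -
  have i: "integrable lborel (\<lambda>x. complex_of_real (f x))" using assms(2) by simp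
  have "is_fourier_real f (fourier_integral (\<lambda>x. complex_of_real (f x)))"
    by (rule is_fourier_L1[OF i]) (simp add: of_real_L2_iff assms)
  from is_fourier_real_AE[OF this] norm_fourier_integral_le[OF i]
  show ?thesis
    by (intro exI[of _ "max 1 ((2 * pi) powr (- (real DIM('a) / 2)) * (LINT x|lborel. norm (complex_of_real (f x))))"] conjI)
       (auto elim!: eventually_mono simp: le_max_iff_disj)
qed

lemma at_within_atLeast_neq_bot:
  fixes t :: real
  assumes "t \<ge> 0"
  shows "at t within {0..} \<noteq> bot"
proof -
  have "at_right t \<le> at t within {0..}" using assms by (intro at_le) auto
  then show ?thesis using trivial_limit_at_right_real[of t] by (auto simp: bot_unique)
qed

text \<open>Both candidates are limits of the same difference quotients, and the Sobolev norm
  dominates \<open>norm_L2\<close>. This pins down the arbitrary choice made by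
  \<open>time_deriv\<close>.\<close>

lemma has_time_deriv_unique_AE:
  fixes u :: "real \<Rightarrow> 'a::euclidean_space \<Rightarrow> real"
  assumes t: "t \<ge> 0" and u: "\<And>s. s \<ge> 0 \<Longrightarrow> u s \<in> L2_space"
    and w: "has_time_deriv k u w t" and v: "has_time_deriv k u v t"
  shows "AE x in lborel. w x = v x"
proof -
  have wv: "w \<in> L2_space" "v \<in> L2_space"
    using conjunct1[OF w[unfolded has_time_deriv_def]] conjunct1[OF v[unfolded has_time_deriv_def]]
    by (simp_all add: sobolev_def)
  let ?D = "\<lambda>s x. (u s x - u t x) / (s - t)"
  have D: "?D s \<in> L2_space" if "s \<ge> 0" for s
  proof -
    have "is_fourier_real (?D s) (\<lambda>x. (fourier_real (u s) x - fourier_real (u t) x) / complex_of_real (s - t))"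
      by (rule is_fourier_real_divide[OF is_fourier_real_diff
            [OF is_fourier_real_fourier_real[OF u[OF that]] is_fourier_real_fourier_real[OF u[OF t]]]])
    then show ?thesis using is_fourier_L2(1) of_real_L2_iff by blast
  qed
  have le: "norm_L2 f \<le> norm_sobolev k f" for f :: "'a \<Rightarrow> real"
    unfolding norm_sobolev_def by (rule real_le_rsqrt) simp
  have lim: "((\<lambda>s. norm_sobolev k (\<lambda>x. ?D s x - w x) + norm_sobolev k (\<lambda>x. ?D s x - v x)) \<longlongrightarrow> 0 + 0) (at t within {0..})"
    by (rule tendsto_add[OF conjunct2[OF w[unfolded has_time_deriv_def]] conjunct2[OF v[unfolded has_time_deriv_def]]])
  have "norm_L2 (\<lambda>x. w x - v x) \<le> 0 + 0"
  proof (rule tendsto_lowerbound[OF lim])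
    have "\<forall>\<^sub>F s in at t within {0..}. s \<in> {0..}" by (simp add: eventually_at_filter)
    then show "\<forall>\<^sub>F s in at t within {0..}. norm_L2 (\<lambda>x. w x - v x)
       \<le> norm_sobolev k (\<lambda>x. ?D s x - w x) + norm_sobolev k (\<lambda>x. ?D s x - v x)"
    proof eventually_elim
      case (elim s)
      then have "norm_L2 (\<lambda>x. w x - v x) \<le> norm_L2 (\<lambda>x. w x - ?D s x) + norm_L2 (\<lambda>x. ?D s x - v x)"
        by (intro L2_diff_triangle wv D) simp
      then show ?case using le[of "\<lambda>x. ?D s x - w x"] le[of "\<lambda>x. ?D s x - v x"]
        by (simp add: norm_L2_minus_commute[of w])
    qed
    show "at t within {0..} \<noteq> bot" by (rule at_within_atLeast_neq_bot[OF t])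
  qed
  then have "norm_L2 (\<lambda>x. w x - v x) = 0" using norm_L2_nonneg[of "\<lambda>x. w x - v x"] by linarith
  then show ?thesis using norm_L2_eq_0_AE[OF L2_diff(1)[OF wv]] by auto
qed

section \<open>Decay of the solution\<close>

lemma powr_comparable:
  fixes x y q :: real
  assumes "y > 0" "y / 2 \<le> x" "x \<le> 2 * y"
  shows "x powr q \<le> 2 powr \<bar>q\<bar> * y powr q"
proof (cases "q \<ge> 0")
  case True
  then have "x powr q \<le> (2 * y) powr q" using assms by (intro powr_mono2) auto
  then show ?thesis using True assms by (simp add: powr_mult)
next
  case False
  then have "x powr q \<le> (y / 2) powr q" using assms by (intro powr_mono2') auto
  also have "\<dots> = 2 powr (- q) * y powr q" using assms by (simp add: powr_divide powr_minus field_simps)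
  finally show ?thesis using False by simp
qed

text \<open>On a shell of radius about \<open>\<beta> ^ j\<close> the power is comparable to a
  constant, and the ball containing the shell has volume of order \<open>\<beta> ^ (j * n)\<close>,
  so a geometric series of ratio \<open>\<beta> powr (q + n)\<close> dominates. The choices 1/2 and
  2 of \<beta> treat the origin and infinity.\<close>

lemma dyadic_integral_finite:
  fixes S :: "'a::euclidean_space set"
  assumes \<beta>: "\<beta> > 0" "\<beta> powr (q + real DIM('a)) < 1"
    and cover: "\<And>x. x \<in> S \<Longrightarrow> x \<noteq> 0 \<Longrightarrow> \<exists>j::nat. \<beta> ^ j / 2 \<le> norm x \<and> norm x \<le> 2 * \<beta> ^ j"
  shows "(\<integral>\<^sup>+x. ennreal (indicator S x * norm x powr q) \<partial>(lborel :: 'a measure)) < \<infinity>"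
proof -
  let ?n = "real DIM('a)" and ?V = "unit_ball_vol (real DIM('a))"
  let ?c = "\<lambda>j::nat. 2 powr \<bar>q\<bar> * (\<beta> ^ j) powr q"
  let ?K = "2 powr \<bar>q\<bar> * (?V * 2 ^ DIM('a))"
  have pw: "ennreal (indicator S x * norm x powr q)
     \<le> (\<Sum>j. ennreal (?c j) * indicator (cball 0 (2 * \<beta> ^ j)) x)" (is "_ \<le> (\<Sum>j. ?f j x)") for x :: 'a
  proof (cases "x \<in> S \<and> x \<noteq> 0")
    case True
    then obtain j where j: "\<beta> ^ j / 2 \<le> norm x" "norm x \<le> 2 * \<beta> ^ j" using cover by blast
    have "ennreal (indicator S x * norm x powr q) \<le> ?f j x"
      using True j \<beta> powr_comparable[of "\<beta> ^ j" "norm x" q] by (auto intro!: ennreal_leI)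
    also have "\<dots> = (\<Sum>i\<in>{j}. ?f i x)"
    proof -
      have "h j = sum h {j}" for h :: "nat \<Rightarrow> ennreal" by simp
      then show ?thesis .
    qed
    also have "\<dots> \<le> (\<Sum>j. ?f j x)" by (rule sum_le_suminf) auto
    finally show ?thesis .
  next
    case False
    then have "indicator S x * norm x powr q = 0" by auto
    then show ?thesis by (simp only: ennreal_0 zero_le)
  qed
  have "(\<integral>\<^sup>+x. ennreal (indicator S x * norm x powr q) \<partial>(lborel :: 'a measure))
     \<le> (\<integral>\<^sup>+x. (\<Sum>j. ?f j x) \<partial>(lborel :: 'a measure))"
    by (rule nn_integral_mono) (rule pw)
  also have "\<dots> = (\<Sum>j. \<integral>\<^sup>+x. ?f j x \<partial>(lborel :: 'a measure))"
  proof (rule nn_integral_suminf)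
    fix j
    have "cball (0::'a) (2 * \<beta> ^ j) \<in> sets lborel" by simp
    then show "?f j \<in> borel_measurable lborel"
      by (intro borel_measurable_times_ennreal borel_measurable_const borel_measurable_indicator)
  qed
  also have "\<dots> = (\<Sum>j. ennreal (?K * (\<beta> powr (q + ?n)) ^ j))"
  proof (rule suminf_cong)
    fix j
    have "(\<integral>\<^sup>+x. ?f j x \<partial>(lborel :: 'a measure)) = ennreal (?c j) * ennreal (?V * (2 * \<beta> ^ j) ^ DIM('a))"
    proof -
      have "cball (0::'a) (2 * \<beta> ^ j) \<in> sets lborel" by simp
      then have "(\<integral>\<^sup>+x. ?f j x \<partial>(lborel :: 'a measure)) = ennreal (?c j) * emeasure lborel (cball (0::'a) (2 * \<beta> ^ j))"
        by (rule nn_integral_cmult_indicator)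
      also have "emeasure lborel (cball (0::'a) (2 * \<beta> ^ j)) = ennreal (?V * (2 * \<beta> ^ j) ^ DIM('a))"
        using \<beta>(1) by (intro emeasure_cball) simp
      finally show ?thesis .
    qed
    also have "\<dots> = ennreal (?c j * (?V * (2 * \<beta> ^ j) ^ DIM('a)))"
      by (simp add: ennreal_mult')
    also have "?c j * (?V * (2 * \<beta> ^ j) ^ DIM('a)) = ?K * ((\<beta> ^ j) powr q * (\<beta> ^ j) ^ DIM('a))"
      by (simp add: power_mult_distrib)
    also have "(\<beta> ^ j) powr q * (\<beta> ^ j) ^ DIM('a) = (\<beta> powr (q + ?n)) ^ j"
      using \<beta> by (simp add: powr_realpow[symmetric] powr_powr powr_add[symmetric] algebra_simps)
    finally show "(\<integral>\<^sup>+x. ?f j x \<partial>(lborel :: 'a measure)) = ennreal (?K * (\<beta> powr (q + ?n)) ^ j)" .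
  qed
  also have "\<dots> = ennreal (\<Sum>j. ?K * (\<beta> powr (q + ?n)) ^ j)"
    using \<beta> by (intro suminf_ennreal2 summable_mult summable_geometric) auto
  also have "\<dots> < \<infinity>" by simp
  finally show ?thesis .
qed

lemma nn_integral_powr_near_0:
  assumes "q + real DIM('a) > 0"
  shows "(\<integral>\<^sup>+x. ennreal (indicator (cball 0 1) x * norm x powr q) \<partial>(lborel :: 'a::euclidean_space measure)) < \<infinity>"
proof (rule dyadic_integral_finite[where \<beta> = "1/2"])
  show "(1 / 2 :: real) powr (q + real DIM('a)) < 1"
    using assms by (simp add: powr_divide powr_minus)
  fix x :: 'a assume x: "x \<in> cball 0 1" "x \<noteq> 0"
  then have "\<exists>j::nat. (1/2::real) ^ j \<le> 2 * norm x"
    using real_arch_pow_inv[of "2 * norm x" "1/2"] by (auto intro: less_imp_le)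
  \<comment> \<open>The least such j: its minimality supplies the upper bound on the norm.\<close>
  then obtain j where j: "(1/2::real) ^ j \<le> 2 * norm x" "\<And>i. i < j \<Longrightarrow> \<not> (1/2::real) ^ i \<le> 2 * norm x"
    using exists_least_iff[of "\<lambda>j. (1/2::real) ^ j \<le> 2 * norm x"] by blast
  have "norm x \<le> 2 * (1/2) ^ j"
  proof (cases j)
    case 0
    then show ?thesis using x by simp
  next
    case (Suc i)
    then have "2 * norm x < (1/2) ^ i" using j(2)[of i] by (simp add: not_le)
    then have "norm x \<le> (1/2) ^ i" using norm_ge_zero[of x] by linarith
    then show ?thesis using Suc by simp
  qed
  then show "\<exists>j::nat. (1/2) ^ j / 2 \<le> norm x \<and> norm x \<le> 2 * (1/2) ^ j" using j(1) by (intro exI[of _ j]) simp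
qed simp

lemma nn_integral_powr_near_infinity:
  assumes "q + real DIM('a) < 0"
  shows "(\<integral>\<^sup>+x. ennreal (indicator {x. 1 \<le> norm x} x * norm x powr q) \<partial>(lborel :: 'a::euclidean_space measure)) < \<infinity>"
proof (rule dyadic_integral_finite[where \<beta> = 2])
  show "(2 :: real) powr (q + real DIM('a)) < 1" using assms by (simp add: powr_less_one)
  fix x :: 'a assume x: "x \<in> {x. 1 \<le> norm x}" "x \<noteq> 0"
  obtain i :: nat where "norm x < 2 ^ i" using real_arch_pow[of 2 "norm x"] by auto
  then have "norm x \<le> 2 * 2 ^ i" by (rule order.trans[OF less_imp_le]) simp
  then obtain j where j: "norm x \<le> 2 * 2 ^ j" "\<And>i::nat. i < j \<Longrightarrow> \<not> norm x \<le> 2 * 2 ^ i"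
    using exists_least_iff[of "\<lambda>j. norm x \<le> 2 * 2 ^ j"] by blast
  have "2 ^ j / 2 \<le> norm x"
  proof (cases j)
    case 0
    then show ?thesis using x by simp
  next
    case (Suc i)
    then have "2 * 2 ^ i < norm x" using j(2)[of i] by (simp add: not_le)
    then have "2 ^ i \<le> norm x" using zero_le_power[of "2::real" i] by linarith
    then show ?thesis using Suc by simp
  qed
  then show "\<exists>j::nat. 2 ^ j / 2 \<le> norm x \<and> norm x \<le> 2 * 2 ^ j" using j(1) by (intro exI[of _ j]) simp
qed simp

text \<open>The m-th power of \<open>1 + y \<le> exp y\<close> at
  \<open>y = c * x / m\<close>.\<close>

lemma exp_minus_le_powr:
  assumes "c > 0"
  shows "\<exists>K>0. \<forall>x>0. exp (- c * x) \<le> K * x powr (- real m)"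
proof (cases "m = 0")
  case True
  then show ?thesis using assms by (intro exI[of _ 1]) auto
next
  case False
  have "exp (- c * x) \<le> (real m / c) ^ m * x powr (- real m)" if x: "x > 0" for x
  proof -
    have "c * x / real m \<le> exp (c * x / real m)"
      using exp_ge_add_one_self[of "c * x / real m"] by linarith
    then have "(c * x / real m) ^ m \<le> exp (c * x / real m) ^ m"
      using assms x by (intro power_mono) auto
    also have "\<dots> = exp (c * x)" using False by (simp add: exp_of_nat_mult[symmetric])
    finally have "(c * x / real m) ^ m \<le> exp (c * x)" .
    moreover have "(c * x / real m) ^ m > 0" using assms x False by simp
    ultimately have "inverse (exp (c * x)) \<le> inverse ((c * x / real m) ^ m)" by (rule le_imp_inverse_le)
    also have "inverse ((c * x / real m) ^ m) = (real m / c) ^ m * x powr (- real m)"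
      using x by (simp add: powr_minus powr_realpow power_mult_distrib power_divide field_simps)
    finally show ?thesis by (simp add: exp_minus)
  qed
  then show ?thesis using assms False by (intro exI[of _ "(real m / c) ^ m"]) auto
qed

text \<open>One constant for all exponents below a bound, because the decay exponent varies with the
  order k.\<close>

lemma exp_minus_le_powr_1_plus:
  fixes c X :: real
  assumes "c > 0"
  shows "\<exists>K>0. \<forall>t\<ge>0. \<forall>g\<le>X. exp (- c * t) \<le> K * (1 + t) powr (- g)"
proof -
  obtain m :: nat where m: "X \<le> real m" using real_arch_simple by blast
  obtain K where K: "K > 0" "\<And>x. x > 0 \<Longrightarrow> exp (- c * x) \<le> K * x powr (- real m)"
    using exp_minus_le_powr[OF assms, of m] by blast
  have "exp (- c * t) \<le> exp c * K * (1 + t) powr (- g)" if t: "t \<ge> 0" and g: "g \<le> X" for t g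
  proof -
    have "exp (- c * t) = exp c * exp (- c * (1 + t))" by (simp add: exp_add[symmetric] algebra_simps)
    also have "\<dots> \<le> exp c * (K * (1 + t) powr (- real m))" using K(2)[of "1 + t"] t by simp
    also have "\<dots> \<le> exp c * (K * (1 + t) powr (- g))"
      using K(1) t g m by (intro mult_left_mono powr_mono) auto
    finally show ?thesis by (simp add: mult_ac)
  qed
  then show ?thesis using K(1) by (intro exI[of _ "exp c * K"]) auto
qed

lemma nn_integral_powr_exp_finite:
  assumes q: "q + real DIM('a) > 0" and p: "p > 0" and c: "c > 0"
  shows "(\<integral>\<^sup>+x. ennreal (norm x powr q * exp (- c * norm x powr p)) \<partial>(lborel :: 'a::euclidean_space measure)) < \<infinity>"
proof -
  \<comment> \<open>Chosen so that the power at infinity drops to \<open>- n - 1\<close>, which is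
    integrable there.\<close>
  obtain m :: nat where m: "(q + real DIM('a) + 1) / p \<le> real m" using real_arch_simple by blast
  obtain K where K: "K > 0" "\<And>x. x > 0 \<Longrightarrow> exp (- c * x) \<le> K * x powr (- real m)"
    using exp_minus_le_powr[OF c, of m] by blast
  let ?q = "- real DIM('a) - 1"
  let ?A = "\<lambda>x::'a. indicator (cball 0 1) x * norm x powr q"
  let ?B = "\<lambda>x::'a. indicator {x. 1 \<le> norm x} x * norm x powr ?q"
  have pw: "ennreal (norm x powr q * exp (- c * norm x powr p)) \<le> ennreal (?A x) + ennreal K * ennreal (?B x)" for x :: 'a
  proof (cases "norm x \<le> 1")
    case True
    have "norm x powr q * exp (- c * norm x powr p) \<le> ?A x"
      using True c by (simp add: mult_left_le)
    then have "ennreal (norm x powr q * exp (- c * norm x powr p)) \<le> ennreal (?A x)" by (rule ennreal_leI)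
    then show ?thesis by (rule order.trans) (rule add_increasing2, auto)
  next
    case False
    then have x: "norm x > 1" and x0: "norm x > 0" by linarith+
    have "exp (- c * norm x powr p) \<le> K * (norm x powr p) powr (- real m)"
      using x0 by (intro K(2)) simp
    then have "norm x powr q * exp (- c * norm x powr p) \<le> norm x powr q * (K * norm x powr (- (p * real m)))"
      by (intro mult_left_mono) (auto simp: powr_powr)
    also have "\<dots> = K * norm x powr (q - p * real m)" using x by (simp add: powr_diff powr_minus field_simps)
    also have "\<dots> \<le> K * norm x powr ?q"
    proof (intro mult_left_mono powr_mono)
      have "q + real DIM('a) + 1 \<le> p * real m" using m p by (simp add: divide_le_eq mult.commute)
      then show "q - p * real m \<le> ?q" by linarith
    qed (use x K in auto)
    finally have "ennreal (norm x powr q * exp (- c * norm x powr p)) \<le> ennreal (K * ?B x)"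
      using x by (intro ennreal_leI) simp
    also have "\<dots> = ennreal K * ennreal (?B x)" using K(1) by (simp add: ennreal_mult')
    finally show ?thesis by (rule order.trans) (rule add_increasing, auto)
  qed
  have "(\<integral>\<^sup>+x. ennreal (norm x powr q * exp (- c * norm x powr p)) \<partial>(lborel :: 'a measure))
     \<le> (\<integral>\<^sup>+x. ennreal (?A x) + ennreal K * ennreal (?B x) \<partial>(lborel :: 'a measure))"
    by (rule nn_integral_mono) (rule pw)
  also have "\<dots> = (\<integral>\<^sup>+x. ennreal (?A x) \<partial>lborel) + ennreal K * (\<integral>\<^sup>+x. ennreal (?B x) \<partial>lborel)"
  proof -
    have [measurable]: "cball (0::'a) 1 \<in> sets borel" "{x::'a. 1 \<le> norm x} \<in> sets borel" by measurable
    have "(\<lambda>x. ennreal (?A x)) \<in> borel_measurable lborel" "(\<lambda>x. ennreal (?B x)) \<in> borel_measurable lborel"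
      by measurable
    then show ?thesis by (simp add: nn_integral_add nn_integral_cmult)
  qed
  also have "\<dots> < \<infinity>"
    using nn_integral_powr_near_0[OF q] nn_integral_powr_near_infinity[where 'a='a, of ?q]
    by (auto simp: ennreal_mult_less_top)
  finally show ?thesis .
qed

text \<open>On the unit ball t may be replaced by 1 + t at the cost of \<open>exp c\<close>, and
  dilation then extracts the power of 1 + t. Uniformity in q comes from bounding a power by the sum
  of the two extreme powers.\<close>

lemma low_frequency_integral:
  assumes q0: "q0 + real DIM('a) > 0" and p: "p > 0" and c: "c > 0"
  shows "\<exists>C\<ge>0. \<forall>q\<in>{q0..q1}. \<forall>t\<ge>0.
    (\<integral>\<^sup>+x. ennreal (indicator (cball 0 1) x * (norm x powr q * exp (- c * norm x powr p * t))) \<partial>(lborel :: 'a::euclidean_space measure))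
      \<le> ennreal (C * (1 + t) powr (- (q + real DIM('a)) / p))"
proof (cases "q0 \<le> q1")
  case False
  then show ?thesis by (intro exI[of _ 0]) auto
next
  case q01: True
  let ?n = "real DIM('a)"
  define I where "I q = (\<integral>\<^sup>+x. ennreal (norm x powr q * exp (- c * norm x powr p)) \<partial>(lborel :: 'a measure))" for q
  have Ifin: "I q0 + I q1 < \<infinity>"
    using nn_integral_powr_exp_finite[where 'a='a, of q0 p c] nn_integral_powr_exp_finite[where 'a='a, of q1 p c] q0 p c q01
    by (simp add: I_def)
  define D where "D = enn2real (I q0 + I q1)"
  have D: "I q0 + I q1 = ennreal D" using Ifin by (simp add: D_def less_top)
  have Iq: "I q \<le> ennreal D" if q: "q \<in> {q0..q1}" for q
  proof -
    have "norm x powr q \<le> norm x powr q0 + norm x powr q1" for x :: 'a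
    proof (cases "norm x \<le> 1")
      case True
      then have "norm x powr q \<le> norm x powr q0" using q by (cases "x = 0") (auto intro: powr_mono')
      then show ?thesis by (simp add: add_increasing2)
    next
      case False
      then have "norm x powr q \<le> norm x powr q1" using q by (intro powr_mono) auto
      then show ?thesis by (simp add: add_increasing)
    qed
    then have "I q \<le> (\<integral>\<^sup>+x. ennreal (norm x powr q0 * exp (- c * norm x powr p))
        + ennreal (norm x powr q1 * exp (- c * norm x powr p)) \<partial>(lborel :: 'a measure))"
      unfolding I_def by (intro nn_integral_mono)
       (auto simp: distrib_right[symmetric] simp flip: ennreal_plus intro!: ennreal_leI mult_right_mono)
    also have "\<dots> = I q0 + I q1" unfolding I_def by (rule nn_integral_add) auto
    finally show ?thesis using D by simp
  qed
  have "(\<integral>\<^sup>+x. ennreal (indicator (cball 0 1) x * (norm x powr q * exp (- c * norm x powr p * t))) \<partial>(lborel :: 'a measure))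
      \<le> ennreal (exp c * D * (1 + t) powr (- (q + ?n) / p))" if q: "q \<in> {q0..q1}" and t: "t \<ge> 0" for q t
  proof -
    \<comment> \<open>The dilation for which \<open>s powr p * (1 + t) = 1\<close>, so that the time
      disappears from the exponential.\<close>
    define s where "s = (1 + t) powr (- 1 / p)"
    have s: "s > 0" using t by (simp add: s_def)
    have "s powr p = (1 + t) powr - 1" unfolding s_def powr_powr using p by simp
    then have sp: "s powr p * (1 + t) = 1" using t by (simp add: powr_minus)
    have "(\<integral>\<^sup>+x. ennreal (indicator (cball 0 1) x * (norm x powr q * exp (- c * norm x powr p * t))) \<partial>(lborel :: 'a measure))
      \<le> (\<integral>\<^sup>+x. ennreal (exp c) * ennreal (norm x powr q * exp (- c * norm x powr p * (1 + t))) \<partial>(lborel :: 'a measure))"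
    proof (intro nn_integral_mono)
      fix x :: 'a
      show "ennreal (indicator (cball 0 1) x * (norm x powr q * exp (- c * norm x powr p * t)))
        \<le> ennreal (exp c) * ennreal (norm x powr q * exp (- c * norm x powr p * (1 + t)))"
      proof (cases "norm x \<le> 1")
        case True
        then have "norm x powr p \<le> 1" using p powr_mono2[of p "norm x" 1] by simp
        then have "c * norm x powr p \<le> c" using c by (simp add: mult_left_le)
        then have "exp (- c * norm x powr p * t) \<le> exp c * exp (- c * norm x powr p * (1 + t))"
          by (simp add: exp_add[symmetric] algebra_simps)
        then have "norm x powr q * exp (- c * norm x powr p * t)
            \<le> norm x powr q * (exp c * exp (- c * norm x powr p * (1 + t)))" by (intro mult_left_mono) auto
        also have "\<dots> = exp c * (norm x powr q * exp (- c * norm x powr p * (1 + t)))" by (simp only: mult_ac)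
        finally show ?thesis using True
          by (simp flip: ennreal_mult add: ennreal_leI)
      qed simp
    qed
    also have "\<dots> = ennreal (exp c) * (\<integral>\<^sup>+x. ennreal (norm x powr q * exp (- c * norm x powr p * (1 + t))) \<partial>(lborel :: 'a measure))"
      by (rule nn_integral_cmult) simp
    also have "(\<integral>\<^sup>+x. ennreal (norm x powr q * exp (- c * norm x powr p * (1 + t))) \<partial>(lborel :: 'a measure))
      = ennreal (s ^ DIM('a)) * (\<integral>\<^sup>+x. ennreal (norm (s *\<^sub>R x) powr q * exp (- c * norm (s *\<^sub>R x) powr p * (1 + t))) \<partial>(lborel :: 'a measure))"
      using nn_integral_affine_euclidean[of "\<lambda>x::'a. ennreal (norm x powr q * exp (- c * norm x powr p * (1 + t)))" s 0] s
      by simp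
    also have "(\<lambda>x::'a. ennreal (norm (s *\<^sub>R x) powr q * exp (- c * norm (s *\<^sub>R x) powr p * (1 + t))))
      = (\<lambda>x::'a. ennreal (s powr q) * ennreal (norm x powr q * exp (- c * norm x powr p)))"
    proof
      fix x :: 'a
      have "- c * norm (s *\<^sub>R x) powr p * (1 + t) = - c * norm x powr p * (s powr p * (1 + t))"
        using s by (simp add: powr_mult)
      then have "- c * norm (s *\<^sub>R x) powr p * (1 + t) = - c * norm x powr p" by (simp add: sp)
      then show "ennreal (norm (s *\<^sub>R x) powr q * exp (- c * norm (s *\<^sub>R x) powr p * (1 + t)))
        = ennreal (s powr q) * ennreal (norm x powr q * exp (- c * norm x powr p))"
        using s by (simp add: powr_mult ennreal_mult'[symmetric] mult_ac)
    qed
    also have "(\<integral>\<^sup>+x. ennreal (s powr q) * ennreal (norm x powr q * exp (- c * norm x powr p)) \<partial>(lborel :: 'a measure))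
      = ennreal (s powr q) * I q"
      unfolding I_def by (rule nn_integral_cmult) simp
    also have "ennreal (exp c) * (ennreal (s ^ DIM('a)) * (ennreal (s powr q) * I q))
      \<le> ennreal (exp c) * (ennreal (s ^ DIM('a)) * (ennreal (s powr q) * ennreal D))"
      by (intro mult_left_mono Iq q) auto
    also have "\<dots> = ennreal (exp c * (s ^ DIM('a) * (s powr q * D)))"
      using s by (simp add: ennreal_mult' D_def)
    also have "exp c * (s ^ DIM('a) * (s powr q * D)) = exp c * D * s powr (q + ?n)"
      using s by (simp add: powr_add powr_realpow)
    also have "s powr (q + ?n) = (1 + t) powr (- (q + ?n) / p)"
      unfolding s_def powr_powr by (rule arg_cong[where f = "(powr) (1 + t)"]) (use p in \<open>simp add: field_simps\<close>)
    finally show ?thesis .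
  qed
  moreover have "exp c * D \<ge> 0" by (simp add: D_def)
  ultimately show ?thesis by blast
qed

section \<open>Exponential decay at high frequencies\<close>

text \<open>For \<sigma> \<le> 1/2 the quotient \<open>b / a\<close> is bounded for
  \<open>a \<ge> r\<close>, and the rate is comparable to b. For \<sigma> > 1/2 the inverse quotient
  is bounded and the rate is comparable to \<open>a\<^sup>2 / b\<close>, a multiple of
  \<open>a powr (2 - 2 * \<sigma>)\<close>; it stays away from 0 because \<sigma> \<le> 1.\<close>

lemma high_frequency_rate:
  assumes "\<nu> > 0" "0 < \<sigma>" "\<sigma> \<le> 1" "0 < r"
  shows "\<exists>c>0. \<forall>a\<ge>r. c \<le> damping_rate a (\<nu> * a powr (2 * \<sigma>))"
proof (cases "\<sigma> \<le> 1 / 2")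
  case True
  define \<beta> where "\<beta> = \<nu> * r powr (2 * \<sigma> - 1)"
  have "\<nu> * r powr (2 * \<sigma>) / (1 + \<beta>\<^sup>2) \<le> damping_rate a (\<nu> * a powr (2 * \<sigma>))" if a: "a \<ge> r" for a
  proof -
    let ?b = "\<nu> * a powr (2 * \<sigma>)"
    have a0: "a > 0" and b0: "?b > 0" using a assms by auto
    note rate = damping_rate_bounds[OF a0 b0]
    have "?b / a = \<nu> * a powr (2 * \<sigma> - 1)" using a0 by (simp add: powr_diff)
    also have "\<dots> \<le> \<beta>"
      unfolding \<beta>_def using assms a True by (intro mult_left_mono powr_mono2') auto
    finally have "(?b / a)\<^sup>2 \<le> \<beta>\<^sup>2" using a0 b0 by (intro power_mono) auto
    then have "?b \<le> damping_rate a ?b * (1 + \<beta>\<^sup>2)"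
      using rate(1) by (subst rate(3)[symmetric]) (intro mult_left_mono, auto)
    moreover have "\<nu> * r powr (2 * \<sigma>) \<le> ?b" using assms a by (intro mult_left_mono powr_mono2) auto
    ultimately show ?thesis by (subst pos_divide_le_eq) (auto simp: add_pos_nonneg)
  qed
  moreover have "1 + \<beta>\<^sup>2 > 0" by (simp add: add_pos_nonneg)
  ultimately show ?thesis using assms
    by (intro exI[of _ "\<nu> * r powr (2 * \<sigma>) / (1 + \<beta>\<^sup>2)"]) (auto intro!: divide_pos_pos mult_pos_pos)
next
  case False
  define \<beta> where "\<beta> = r powr (1 - 2 * \<sigma>) / \<nu>"
  have "r powr (2 - 2 * \<sigma>) / \<nu> / (1 + \<beta>\<^sup>2) \<le> damping_rate a (\<nu> * a powr (2 * \<sigma>))" if a: "a \<ge> r" for a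
  proof -
    let ?b = "\<nu> * a powr (2 * \<sigma>)"
    have a0: "a > 0" and b0: "?b > 0" using a assms by auto
    note rate = damping_rate_bounds[OF a0 b0]
    have "a / ?b = a powr (1 - 2 * \<sigma>) / \<nu>" using a0 by (simp add: powr_diff)
    also have "\<dots> \<le> \<beta>"
      unfolding \<beta>_def using assms a False by (intro divide_right_mono powr_mono2') auto
    finally have "(a / ?b)\<^sup>2 \<le> \<beta>\<^sup>2" using a0 b0 by (intro power_mono) auto
    moreover have "damping_rate a ?b * (1 + (a / ?b)\<^sup>2) = a\<^sup>2 / ?b"
    proof -
      have "1 + (a / b)\<^sup>2 = (1 + (b / a)\<^sup>2) * (a / b)\<^sup>2" if "b > 0" for b
        using that a0 by (simp add: field_simps)
      then have "damping_rate a ?b * (1 + (a / ?b)\<^sup>2) = (damping_rate a ?b * (1 + (?b / a)\<^sup>2)) * (a / ?b)\<^sup>2"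
        using b0 by (simp only: mult.assoc)
      also have "\<dots> = ?b * (a / ?b)\<^sup>2" by (simp only: rate(3))
      also have "\<dots> = a\<^sup>2 / ?b" using b0 by (simp add: power2_eq_square)
      finally show ?thesis .
    qed
    ultimately have "a\<^sup>2 / ?b \<le> damping_rate a ?b * (1 + \<beta>\<^sup>2)"
      using rate(1) by (metis add_left_mono less_imp_le mult_left_mono)
    moreover have "a\<^sup>2 / ?b = a powr (2 - 2 * \<sigma>) / \<nu>" using a0 by (simp add: powr_diff)
    moreover have "r powr (2 - 2 * \<sigma>) / \<nu> \<le> a powr (2 - 2 * \<sigma>) / \<nu>"
      using assms a by (intro divide_right_mono powr_mono2) auto
    ultimately show ?thesis by (subst pos_divide_le_eq) (auto simp: add_pos_nonneg)
  qed
  moreover have "1 + \<beta>\<^sup>2 > 0" by (simp add: add_pos_nonneg)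
  ultimately show ?thesis using assms
    by (intro exI[of _ "r powr (2 - 2 * \<sigma>) / \<nu> / (1 + \<beta>\<^sup>2)"]) (auto intro!: divide_pos_pos mult_pos_pos)
qed

text \<open>The energy gives one more power of a for the solution than for its derivative, which
  matches the orders k0 + 1 and k0.\<close>

lemma high_frequency_bound:
  assumes \<nu>: "\<nu> > 0" and \<sigma>: "0 < \<sigma>" "\<sigma> \<le> 1" and r: "0 < r" "r \<le> 1" and k0: "k0 \<ge> 0"
  shows "\<exists>c>0. \<exists>K>0. \<forall>a\<ge>r. \<forall>t\<ge>0. \<forall>p q. \<forall>k\<ge>0.
     (k \<le> k0 + 1 \<longrightarrow> a powr k * norm (damped a (\<nu> * a powr (2 * \<sigma>)) p q t)
         \<le> K * exp (- c * t) * (a powr k0 * norm q + a powr (k0 + 1) * norm p)) \<and>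
     (k \<le> k0 \<longrightarrow> a powr k * norm (damped' a (\<nu> * a powr (2 * \<sigma>)) p q t)
         \<le> K * exp (- c * t) * (a powr k0 * norm q + a powr (k0 + 1) * norm p))"
proof -
  obtain c where c: "c > 0" "\<And>a. a \<ge> r \<Longrightarrow> c \<le> damping_rate a (\<nu> * a powr (2 * \<sigma>))"
    using high_frequency_rate[OF \<nu> \<sigma> r(1)] by blast
  define L where "L = r powr (- (k0 + 1))"
  have L0: "L > 0" using r by (simp add: L_def)
  have main: "a powr k * norm (damped a (\<nu> * a powr (2 * \<sigma>)) p q t)
         \<le> 2 * L * exp (- (c / 5) * t) * (a powr k0 * norm q + a powr (k0 + 1) * norm p)" (is ?bound)
     "k \<le> k0 \<Longrightarrow> a powr k * norm (damped' a (\<nu> * a powr (2 * \<sigma>)) p q t)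
         \<le> 2 * L * exp (- (c / 5) * t) * (a powr k0 * norm q + a powr (k0 + 1) * norm p)" (is "_ \<Longrightarrow> ?bound'")
    if a: "a \<ge> r" and t: "t \<ge> 0" and k: "k \<ge> 0" "k \<le> k0 + 1" for a t p q k
  proof -
    let ?R = "2 * L * exp (- (c / 5) * t) * (a powr k0 * norm q + a powr (k0 + 1) * norm p)"
    let ?b = "\<nu> * a powr (2 * \<sigma>)" and ?E = "exp (- (c / 5) * t)"
    have a0: "a > 0" and b0: "?b > 0" using a r \<nu> by auto
    have L: "a powr s \<le> L" if s: "- (k0 + 1) \<le> s" "s \<le> 0" for s
    proof -
      have "a powr s \<le> r powr s" using a r s by (intro powr_mono2') auto
      also have "\<dots> \<le> L" unfolding L_def using r s by (intro powr_mono') auto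
      finally show ?thesis .
    qed
    have "exp (- (1 / 5) * damping_rate a ?b * t) \<le> ?E"
      using mult_right_mono[OF c(2)[OF a] t] by simp
    then have E: "2 * exp (- (1 / 5) * damping_rate a ?b * t) * (norm q + a * norm p) \<le> 2 * ?E * (norm q + a * norm p)"
      using a0 by (intro mult_right_mono mult_left_mono) auto
    have split: "a powr k0 * (norm q + a * norm p) = a powr k0 * norm q + a powr (k0 + 1) * norm p"
      using a0 by (simp add: powr_add distrib_left)
    \<comment> \<open>The exponent s is k - 1 for the solution and k for its derivative. Lower
      powers are absorbed into \<open>a powr k0\<close> through \<open>L\<close>, as a is bounded
      below by r.\<close>
    have final: "a powr s * (2 * ?E * (norm q + a * norm p)) \<le> ?R" if s: "- 1 \<le> s" "s \<le> k0" for s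
    proof -
      have "a powr s = a powr (s - k0) * a powr k0" using a0 by (simp add: powr_add[symmetric])
      also have "\<dots> \<le> L * a powr k0" using s k0 by (intro mult_right_mono L) auto
      finally have "a powr s * (2 * ?E * (norm q + a * norm p)) \<le> L * a powr k0 * (2 * ?E * (norm q + a * norm p))"
        using a0 by (intro mult_right_mono) auto
      also have "\<dots> = 2 * L * ?E * (a powr k0 * (norm q + a * norm p))" by simp
      finally show ?thesis unfolding split .
    qed
    have "a powr k * norm (damped a ?b p q t) = a powr (k - 1) * (a * norm (damped a ?b p q t))"
      using a0 by (simp add: powr_diff)
    also have "\<dots> \<le> a powr (k - 1) * (2 * ?E * (norm q + a * norm p))"
      using damped_energy(2)[OF a0 b0 t, of p q] E by (intro mult_left_mono) auto
    also have "\<dots> \<le> ?R" using k by (intro final) auto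
    finally show ?bound .
    assume "k \<le> k0"
    have "a powr k * norm (damped' a ?b p q t) \<le> a powr k * (2 * ?E * (norm q + a * norm p))"
      using damped_energy(1)[OF a0 b0 t, of p q] E by (intro mult_left_mono) auto
    also have "\<dots> \<le> ?R" using k \<open>k \<le> k0\<close> by (intro final) auto
    finally show ?bound' .
  qed
  show ?thesis
  proof (rule exI[of _ "c / 5"], rule conjI, goal_cases)
    case 2
    show ?case
      by (rule exI[of _ "2 * L"]) (use main L0 k0 in auto)
  qed (use c in simp)
qed

text \<open>The uniform shape of the low frequency bounds for \<open>F = damped\<close> and \<open>F = damped'\<close>, where \<open>\<gamma> k\<close> is the
  resulting decay rate of the derivative of order \<open>k\<close>. The second summand is only needed for the
  time derivative in the case \<open>\<sigma> < 1 / 2\<close>.\<close>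

definition low_frequency_decay ::
    "real \<Rightarrow> real \<Rightarrow> real \<Rightarrow> (real \<Rightarrow> real) \<Rightarrow> (real \<Rightarrow> complex \<Rightarrow> complex \<Rightarrow> real \<Rightarrow> complex) \<Rightarrow> bool" where
  "low_frequency_decay n \<sigma> M \<gamma> F \<longleftrightarrow> (\<exists>r D c P e m D' c'. 0 < r \<and> r \<le> 1 \<and> 0 \<le> D \<and> 0 < c \<and> 0 < P \<and> 0 \<le> D' \<and> 0 < c' \<and>
     0 < 2 * m + n \<and>
     (\<forall>k\<ge>0. \<gamma> k \<le> (2 * (k + m) + n) / (2 * P) - e \<and> \<gamma> k \<le> (2 * k + n) / (4 * \<sigma>)) \<and>
     (\<forall>a t p q. 0 < a \<longrightarrow> a \<le> r \<longrightarrow> 0 \<le> t \<longrightarrow> norm p \<le> M \<longrightarrow> norm q \<le> M \<longrightarrow>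
        norm (F a p q t) \<le> D * (1 + t) powr e * (a powr m * exp (- c * a powr P * t)) + D' * exp (- c' * a powr (2 * \<sigma>) * t)))"

section \<open>Low frequencies in the three ranges of the damping exponent\<close>

text \<open>For \<sigma> \<ge> 1/2 and \<open>a \<le> 1\<close> one has
  \<open>b / a \<le> \<nu>\<close>, so the damping rate is at least
  \<open>b / (1 + \<nu>\<^sup>2)\<close>; the 5 in the constant is the 1/5 of the energy
  bound.\<close>

lemma low_frequency_energy:
  assumes \<nu>: "\<nu> > 0" and \<sigma>: "1 / 2 \<le> \<sigma>" and a: "0 < a" "a \<le> 1" and t: "t \<ge> 0"
    and M: "norm p \<le> M" "norm q \<le> M"
  shows "norm (damped' a (\<nu> * a powr (2 * \<sigma>)) p q t) \<le> 4 * M * exp (- (\<nu> / (5 * (1 + \<nu>\<^sup>2))) * a powr (2 * \<sigma>) * t)"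
    and "a * norm (damped a (\<nu> * a powr (2 * \<sigma>)) p q t) \<le> 4 * M * exp (- (\<nu> / (5 * (1 + \<nu>\<^sup>2))) * a powr (2 * \<sigma>) * t)"
proof -
  let ?b = "\<nu> * a powr (2 * \<sigma>)"
  have b0: "?b > 0" using a \<nu> by simp
  note rate = damping_rate_bounds[OF a(1) b0]
  have n0: "1 + \<nu>\<^sup>2 > 0" by (simp add: add_pos_nonneg)
  have "?b / a = \<nu> * a powr (2 * \<sigma> - 1)" using a by (simp add: powr_diff)
  also have "\<dots> \<le> \<nu> * 1" using \<nu> a \<sigma> powr_mono2[of "2 * \<sigma> - 1" a 1] by (intro mult_left_mono) auto
  finally have "(?b / a)\<^sup>2 \<le> \<nu>\<^sup>2" using a b0 by (intro power_mono) auto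
  then have "?b \<le> damping_rate a ?b * (1 + \<nu>\<^sup>2)"
    using rate(1) by (subst rate(3)[symmetric]) (intro mult_left_mono, auto)
  then have "?b / (1 + \<nu>\<^sup>2) \<le> damping_rate a ?b" using n0 by (simp add: pos_divide_le_eq)
  from mult_right_mono[OF this t]
  have "\<nu> / (5 * (1 + \<nu>\<^sup>2)) * a powr (2 * \<sigma>) * t \<le> 1 / 5 * (damping_rate a ?b * t)"
  proof -
    have "\<nu> / (5 * (1 + \<nu>\<^sup>2)) * a powr (2 * \<sigma>) * t = 1 / 5 * (?b / (1 + \<nu>\<^sup>2) * t)"
      by (simp add: field_simps)
    then show ?thesis using mult_right_mono[OF \<open>?b / (1 + \<nu>\<^sup>2) \<le> damping_rate a ?b\<close> t] by linarith
  qed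
  then have "exp (- (1 / 5) * damping_rate a ?b * t) \<le> exp (- (\<nu> / (5 * (1 + \<nu>\<^sup>2))) * a powr (2 * \<sigma>) * t)"
    by simp
  moreover have "norm q + a * norm p \<le> M + 1 * M" using M a by (intro add_mono mult_mono) auto
  ultimately have "2 * exp (- (1 / 5) * damping_rate a ?b * t) * (norm q + a * norm p)
     \<le> 2 * exp (- (\<nu> / (5 * (1 + \<nu>\<^sup>2))) * a powr (2 * \<sigma>) * t) * (2 * M)"
    using a by (intro mult_mono) auto
  then have "2 * exp (- (1 / 5) * damping_rate a ?b * t) * (norm q + a * norm p)
     \<le> 4 * M * exp (- (\<nu> / (5 * (1 + \<nu>\<^sup>2))) * a powr (2 * \<sigma>) * t)" by (simp only: mult_ac)
  then show "norm (damped' a ?b p q t) \<le> 4 * M * exp (- (\<nu> / (5 * (1 + \<nu>\<^sup>2))) * a powr (2 * \<sigma>) * t)"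
    and "a * norm (damped a ?b p q t) \<le> 4 * M * exp (- (\<nu> / (5 * (1 + \<nu>\<^sup>2))) * a powr (2 * \<sigma>) * t)"
    using damped_energy[OF a(1) b0 t, of p q] by linarith+
qed

text \<open>Dividing the energy bound by a gives \<open>m = - 1\<close>, and
  \<open>2 * m + n > 0\<close> is the condition n \<ge> 3. The derivative has no such factor, so
  \<open>m = 0\<close> and its rate is larger by \<open>1 / (2 * \<sigma>)\<close>.\<close>

lemma low_frequency_decay_gt:
  assumes \<nu>: "\<nu> > 0" and \<sigma>: "1 / 2 < \<sigma>" and n: "n \<ge> 3" and M: "M \<ge> 0"
  shows "low_frequency_decay (real n) \<sigma> M (decay_exponent n \<sigma>) (\<lambda>a. damped a (\<nu> * a powr (2 * \<sigma>)))"
    and "low_frequency_decay (real n) \<sigma> M (\<lambda>k. decay_exponent n \<sigma> k + 1 / (2 * \<sigma>)) (\<lambda>a. damped' a (\<nu> * a powr (2 * \<sigma>)))"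
proof -
  define c where "c = \<nu> / (5 * (1 + \<nu>\<^sup>2))"
  have c: "c > 0" unfolding c_def using \<nu> by (intro divide_pos_pos) (auto simp: add_pos_nonneg)
  have \<gamma>: "decay_exponent n \<sigma> k = (2 * (k - 1) + real n) / (4 * \<sigma>)" for k
    using \<sigma> by (simp add: decay_exponent_def field_simps)
  have \<gamma>': "decay_exponent n \<sigma> k + 1 / (2 * \<sigma>) = (2 * k + real n) / (4 * \<sigma>)" for k
    using \<sigma> by (simp add: decay_exponent_def field_simps)
  show "low_frequency_decay (real n) \<sigma> M (decay_exponent n \<sigma>) (\<lambda>a. damped a (\<nu> * a powr (2 * \<sigma>)))"
    unfolding low_frequency_decay_def
  proof (rule exI[of _ 1], rule exI[of _ "4 * M"], rule exI[of _ c], rule exI[of _ "2 * \<sigma>"], rule exI[of _ 0],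
      rule exI[of _ "- 1"], rule exI[of _ 0], rule exI[of _ 1], intro conjI allI impI)
    fix a t :: real and p q :: complex
    assume a: "0 < a" "a \<le> 1" "0 \<le> t" "norm p \<le> M" "norm q \<le> M"
    have "a * norm (damped a (\<nu> * a powr (2 * \<sigma>)) p q t) \<le> 4 * M * exp (- c * a powr (2 * \<sigma>) * t)"
      unfolding c_def using low_frequency_energy(2)[OF \<nu> _ a] \<sigma> by simp
    then have "norm (damped a (\<nu> * a powr (2 * \<sigma>)) p q t) \<le> 4 * M * exp (- c * a powr (2 * \<sigma>) * t) / a"
      using a by (simp add: pos_le_divide_eq mult.commute)
    then show "norm (damped a (\<nu> * a powr (2 * \<sigma>)) p q t)
       \<le> 4 * M * (1 + t) powr 0 * (a powr - 1 * exp (- c * a powr (2 * \<sigma>) * t)) + 0 * exp (- 1 * a powr (2 * \<sigma>) * t)"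
      using a by (simp add: powr_minus field_simps)
  next
    fix k :: real
    show "decay_exponent n \<sigma> k \<le> (2 * (k + - 1) + real n) / (2 * (2 * \<sigma>)) - 0"
      "decay_exponent n \<sigma> k \<le> (2 * k + real n) / (4 * \<sigma>)"
      unfolding \<gamma> using \<sigma> by (auto intro!: divide_right_mono)
  qed (use \<sigma> n c M in auto)
  show "low_frequency_decay (real n) \<sigma> M (\<lambda>k. decay_exponent n \<sigma> k + 1 / (2 * \<sigma>)) (\<lambda>a. damped' a (\<nu> * a powr (2 * \<sigma>)))"
    unfolding low_frequency_decay_def
  proof (rule exI[of _ 1], rule exI[of _ "4 * M"], rule exI[of _ c], rule exI[of _ "2 * \<sigma>"], rule exI[of _ 0],
      rule exI[of _ 0], rule exI[of _ 0], rule exI[of _ 1], intro conjI allI impI)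
    fix a t :: real and p q :: complex
    assume a: "0 < a" "a \<le> 1" "0 \<le> t" "norm p \<le> M" "norm q \<le> M"
    show "norm (damped' a (\<nu> * a powr (2 * \<sigma>)) p q t)
       \<le> 4 * M * (1 + t) powr 0 * (a powr 0 * exp (- c * a powr (2 * \<sigma>) * t)) + 0 * exp (- 1 * a powr (2 * \<sigma>) * t)"
      unfolding c_def using low_frequency_energy(1)[OF \<nu> _ a] \<sigma> a by simp
  next
    fix k :: real
    show "decay_exponent n \<sigma> k + 1 / (2 * \<sigma>) \<le> (2 * (k + 0) + real n) / (2 * (2 * \<sigma>)) - 0"
      "decay_exponent n \<sigma> k + 1 / (2 * \<sigma>) \<le> (2 * k + real n) / (4 * \<sigma>)"
      unfolding \<gamma>' by auto
  qed (use \<sigma> n c M in auto)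
qed

text \<open>The factor \<open>1 / a\<close> is replaced by 1 + t: for \<open>a * t \<le> 1\<close>
  the linear bound applies and the exponential is bounded below by \<open>exp (- c)\<close>,
  otherwise \<open>1 / a \<le> t\<close>. Thus \<open>e = 1\<close> and \<open>m = 0\<close>, which
  leaves the integrals finite in every dimension.\<close>

lemma low_frequency_decay_half:
  assumes \<nu>: "\<nu> > 0" and \<sigma>: "\<sigma> = 1 / 2" and n: "n \<ge> 1" and M: "M \<ge> 0"
  shows "low_frequency_decay (real n) \<sigma> M (decay_exponent n \<sigma>) (\<lambda>a. damped a (\<nu> * a powr (2 * \<sigma>)))"
    and "low_frequency_decay (real n) \<sigma> M (\<lambda>k. decay_exponent n \<sigma> k + 1) (\<lambda>a. damped' a (\<nu> * a powr (2 * \<sigma>)))"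
proof -
  define c where "c = \<nu> / (5 * (1 + \<nu>\<^sup>2))"
  have c: "c > 0" unfolding c_def using \<nu> by (intro divide_pos_pos) (auto simp: add_pos_nonneg)
  have \<gamma>: "decay_exponent n \<sigma> k = (2 * k + real n) / 2 - 1" for k
    using \<sigma> by (simp add: decay_exponent_def field_simps)
  show "low_frequency_decay (real n) \<sigma> M (decay_exponent n \<sigma>) (\<lambda>a. damped a (\<nu> * a powr (2 * \<sigma>)))"
    unfolding low_frequency_decay_def
  proof (rule exI[of _ 1], rule exI[of _ "5 * exp c * M"], rule exI[of _ c], rule exI[of _ 1], rule exI[of _ 1],
      rule exI[of _ 0], rule exI[of _ 0], rule exI[of _ 1], intro conjI allI impI)
    fix a t :: real and p q :: complex
    assume a: "0 < a" "a \<le> 1" "0 \<le> t" "norm p \<le> M" "norm q \<le> M"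
    let ?d = "norm (damped a (\<nu> * a powr (2 * \<sigma>)) p q t)"
    have b0: "\<nu> * a powr (2 * \<sigma>) > 0" using a \<nu> by simp
    have "?d \<le> 5 * exp c * M * (1 + t) * exp (- c * a * t)"
    proof (cases "a * t \<le> 1")
      case True
      have "?d \<le> norm p + 2 * t * (norm q + a * norm p)"
        by (rule damped_linear_bound[OF a(1) b0 a(3)])
      also have "\<dots> \<le> M + 2 * t * (M + 1 * M)" using a by (intro add_mono mult_mono) auto
      also have "\<dots> \<le> 5 * M * (1 + t) * 1" using a M by (simp add: algebra_simps)
      also have "\<dots> \<le> 5 * M * (1 + t) * (exp c * exp (- c * a * t))"
      proof (intro mult_left_mono)
        have "c * (a * t) \<le> c" using True c by (simp add: mult_left_le)
        then have "0 \<le> c + (- c * a * t)" by simp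
        then show "1 \<le> exp c * exp (- c * a * t)" unfolding exp_add[symmetric] by simp
      qed (use a M in auto)
      finally show ?thesis by (simp only: mult_ac)
    next
      case False
      then have "1 / a \<le> t" using a by (simp add: divide_le_eq mult.commute)
      have "a * ?d \<le> 4 * M * exp (- c * a * t)"
        using low_frequency_energy(2)[OF \<nu> order.refl a] a by (simp add: c_def \<sigma>)
      then have "?d \<le> (1 / a) * (4 * M * exp (- c * a * t))"
        using a by (simp add: pos_le_divide_eq mult.commute)
      also have "\<dots> \<le> (1 + t) * (5 * exp c * M * exp (- c * a * t))"
      proof (intro mult_mono mult_right_mono)
        have "1 \<le> exp c" using c by simp
        then have "4 * 1 \<le> 5 * exp c" by linarith
        then show "4 \<le> 5 * exp c" by simp
      qed (use \<open>1 / a \<le> t\<close> a M in auto)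
      finally show ?thesis by (simp only: mult_ac)
    qed
    then show "?d \<le> 5 * exp c * M * (1 + t) powr 1 * (a powr 0 * exp (- c * a powr 1 * t)) + 0 * exp (- 1 * a powr (2 * \<sigma>) * t)"
      using a by (simp add: mult_ac)
  next
    fix k :: real
    show "decay_exponent n \<sigma> k \<le> (2 * (k + 0) + real n) / (2 * 1) - 1"
      "decay_exponent n \<sigma> k \<le> (2 * k + real n) / (4 * \<sigma>)"
      unfolding \<gamma> by (simp_all add: \<sigma> field_simps)
  qed (use \<sigma> n c M in auto)
  show "low_frequency_decay (real n) \<sigma> M (\<lambda>k. decay_exponent n \<sigma> k + 1) (\<lambda>a. damped' a (\<nu> * a powr (2 * \<sigma>)))"
    unfolding low_frequency_decay_def
  proof (rule exI[of _ 1], rule exI[of _ "4 * M"], rule exI[of _ c], rule exI[of _ 1], rule exI[of _ 0],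
      rule exI[of _ 0], rule exI[of _ 0], rule exI[of _ 1], intro conjI allI impI)
    fix a t :: real and p q :: complex
    assume a: "0 < a" "a \<le> 1" "0 \<le> t" "norm p \<le> M" "norm q \<le> M"
    show "norm (damped' a (\<nu> * a powr (2 * \<sigma>)) p q t)
       \<le> 4 * M * (1 + t) powr 0 * (a powr 0 * exp (- c * a powr 1 * t)) + 0 * exp (- 1 * a powr (2 * \<sigma>) * t)"
      using low_frequency_energy(1)[OF \<nu> order.refl a] a by (simp add: c_def \<sigma>)
  next
    fix k :: real
    show "decay_exponent n \<sigma> k + 1 \<le> (2 * (k + 0) + real n) / (2 * 1) - 0"
      "decay_exponent n \<sigma> k + 1 \<le> (2 * k + real n) / (4 * \<sigma>)"
      unfolding \<gamma> by (simp_all add: \<sigma> field_simps)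
  qed (use \<sigma> n c M in auto)
qed

text \<open>The slow root gives \<open>P = 2 - 2 * \<sigma>\<close>. The quotient
  \<open>q / b\<close> gives \<open>m = - 2 * \<sigma>\<close> for the solution; for the derivative
  the extra factor \<open>a\<^sup>2 / b\<close> raises m to \<open>2 - 4 * \<sigma>\<close>, which
  is exactly one more power of decay. The fast mode fills the second summand of the shape.\<close>

lemma low_frequency_decay_lt:
  assumes \<nu>: "\<nu> > 0" and \<sigma>: "0 < \<sigma>" "\<sigma> < 1 / 2" and n: "n \<ge> 2" and M: "M \<ge> 0"
  shows "low_frequency_decay (real n) \<sigma> M (decay_exponent n \<sigma>) (\<lambda>a. damped a (\<nu> * a powr (2 * \<sigma>)))"
    and "low_frequency_decay (real n) \<sigma> M (\<lambda>k. decay_exponent n \<sigma> k + 1) (\<lambda>a. damped' a (\<nu> * a powr (2 * \<sigma>)))"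
proof -
  \<comment> \<open>Below this radius
    \<open>8 * a powr (2 - 4 * \<sigma>) \<le> \<nu>\<^sup>2\<close>, which is the overdamping
    condition \<open>8 * a\<^sup>2 \<le> b\<^sup>2\<close>.\<close>
  define r where "r = min 1 ((\<nu>\<^sup>2 / 8) powr (1 / (2 - 4 * \<sigma>)))"
  have r: "0 < r" "r \<le> 1" using \<nu> by (auto simp: r_def)
  define D where "D = 2 * M * (1 + 1 / \<nu>)"
  have D: "D \<ge> 0" using M \<nu> by (simp add: D_def)
  have n': "real n \<ge> 2" using n by simp
  define s where "s = 1 - \<sigma>"
  have s: "s > 0" "2 * (2 - 2 * \<sigma>) = 4 * s" using \<sigma> by (auto simp: s_def)
  have \<gamma>: "decay_exponent n \<sigma> k = (2 * (k + - 2 * \<sigma>) + real n) / (2 * (2 - 2 * \<sigma>))" for k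
  proof -
    have "decay_exponent n \<sigma> k = real n / (4 * s) - \<sigma> / s + k / (2 * s)"
      using \<sigma> by (simp add: decay_exponent_def s_def)
    also have "\<dots> = (2 * (k + - 2 * \<sigma>) + real n) / (4 * s)" using s(1) by (simp add: field_simps)
    finally show ?thesis unfolding s(2) .
  qed
  have \<gamma>1: "decay_exponent n \<sigma> k + 1 = (2 * (k + (2 - 4 * \<sigma>)) + real n) / (2 * (2 - 2 * \<sigma>))" for k
  proof -
    have "2 * (k + (2 - 4 * \<sigma>)) + real n = (2 * (k + - 2 * \<sigma>) + real n) + 4 * s" by (simp add: s_def)
    moreover have "(X + 4 * s) / (4 * s) = X / (4 * s) + 1" for X
      using s(1) by (simp add: add_divide_distrib)
    ultimately show ?thesis unfolding \<gamma> s(2) by (simp only:)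
  qed
  \<comment> \<open>The fast mode decays no slower than the slow one. Cleared of denominators this
    is the nonnegativity of \<open>(1 - 2 * \<sigma>) * (2 * k + n - 4 * \<sigma>)\<close>, where n
    \<ge> 2 is used.\<close>
  have \<gamma>2: "decay_exponent n \<sigma> k + 1 \<le> (2 * k + real n) / (4 * \<sigma>)" if "k \<ge> 0" for k
  proof -
    have "0 \<le> (1 - 2 * \<sigma>) * (2 * k + real n - 4 * \<sigma>)" using that \<sigma> n' by (intro mult_nonneg_nonneg) auto
    then have "(2 * (k + (2 - 4 * \<sigma>)) + real n) * (4 * \<sigma>) \<le> (2 * k + real n) * (2 * (2 - 2 * \<sigma>))"
      by (simp add: algebra_simps)
    then show ?thesis unfolding \<gamma>1 using \<sigma> by (subst frac_le_eq) (auto simp: field_simps)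
  qed
  have over: "norm (damped a (\<nu> * a powr (2 * \<sigma>)) p q t)
          \<le> D * (a powr (- 2 * \<sigma>) * exp (- (1 / \<nu>) * a powr (2 - 2 * \<sigma>) * t))"
     "norm (damped' a (\<nu> * a powr (2 * \<sigma>)) p q t)
          \<le> 2 / \<nu> * D * (a powr (2 - 4 * \<sigma>) * exp (- (1 / \<nu>) * a powr (2 - 2 * \<sigma>) * t))
            + (1 + \<nu>) * M * exp (- (\<nu> / 2) * a powr (2 * \<sigma>) * t)"
    if a: "0 < a" "a \<le> r" "0 \<le> t" "norm p \<le> M" "norm q \<le> M" for a t p q
  proof -
    let ?b = "\<nu> * a powr (2 * \<sigma>)"
    have b0: "?b > 0" using a \<nu> by simp
    have a1: "a \<le> 1" using a r by simp
    have "a powr (2 - 4 * \<sigma>) \<le> ((\<nu>\<^sup>2 / 8) powr (1 / (2 - 4 * \<sigma>))) powr (2 - 4 * \<sigma>)"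
      using a \<sigma> by (intro powr_mono2) (auto simp: r_def)
    also have "\<dots> = \<nu>\<^sup>2 / 8" using \<sigma> \<nu> by (simp add: powr_powr)
    finally have 1: "8 * a powr (2 - 4 * \<sigma>) \<le> \<nu>\<^sup>2" by simp
    have "8 * a\<^sup>2 = 8 * a powr (2 - 4 * \<sigma>) * (a powr (2 * \<sigma>))\<^sup>2"
    proof -
      have "a powr (2 - 4 * \<sigma>) * (a powr (2 * \<sigma>))\<^sup>2 = a powr 2"
        by (simp add: power2_eq_square powr_add[symmetric])
      also have "\<dots> = a\<^sup>2" using a by simp
      finally show ?thesis by simp
    qed
    also have "\<dots> \<le> \<nu>\<^sup>2 * (a powr (2 * \<sigma>))\<^sup>2" using 1 by (intro mult_right_mono) auto
    finally have od: "8 * a\<^sup>2 \<le> ?b\<^sup>2" by (simp add: power_mult_distrib)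
    have e: "a\<^sup>2 / ?b = 1 / \<nu> * a powr (2 - 2 * \<sigma>)" using a by (simp add: powr_diff)
    let ?e = "exp (- (1 / \<nu>) * a powr (2 - 2 * \<sigma>) * t)"
    have ee: "exp (- (a\<^sup>2 / ?b) * t) = ?e" unfolding e by simp
    have am: "1 \<le> a powr (- 2 * \<sigma>)"
      using a a1 \<sigma> powr_mono2'[of "- 2 * \<sigma>" a 1] by simp
    have "norm p + norm q / ?b \<le> M * a powr (- 2 * \<sigma>) + M * (a powr (- 2 * \<sigma>) / \<nu>)"
    proof (intro add_mono)
      show "norm p \<le> M * a powr (- 2 * \<sigma>)"
        using mult_mono[OF a(4) am M] by simp
      have "norm q / ?b \<le> M / ?b" using a b0 by (intro divide_right_mono) auto
      also have "\<dots> = M * (a powr (- 2 * \<sigma>) / \<nu>)" by (simp add: powr_minus field_simps)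
      finally show "norm q / ?b \<le> M * (a powr (- 2 * \<sigma>) / \<nu>)" .
    qed
    then have "2 * ?e * (norm p + norm q / ?b) \<le> 2 * ?e * (M * a powr (- 2 * \<sigma>) + M * (a powr (- 2 * \<sigma>) / \<nu>))"
      by (intro mult_left_mono) auto
    also have "\<dots> = D * (a powr (- 2 * \<sigma>) * ?e)"
      unfolding D_def using \<nu> by (simp add: field_simps)
    finally show d: "norm (damped a ?b p q t) \<le> D * (a powr (- 2 * \<sigma>) * ?e)"
      using damped_overdamped(1)[OF a(1) b0 od a(3), of p q] unfolding ee by linarith
    have "2 * a\<^sup>2 / ?b * norm (damped a ?b p q t) \<le> (2 / \<nu> * a powr (2 - 2 * \<sigma>)) * (D * (a powr (- 2 * \<sigma>) * ?e))"
    proof (rule mult_mono[OF _ d])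
      show "2 * a\<^sup>2 / ?b \<le> 2 / \<nu> * a powr (2 - 2 * \<sigma>)" using e by simp
    qed (use \<nu> in auto)
    also have "\<dots> = 2 / \<nu> * D * ((a powr (2 - 2 * \<sigma>) * a powr (- 2 * \<sigma>)) * ?e)" by (simp only: mult_ac)
    also have "a powr (2 - 2 * \<sigma>) * a powr (- 2 * \<sigma>) = a powr (2 - 4 * \<sigma>)"
      by (simp add: powr_add[symmetric])
    finally have s1: "2 * a\<^sup>2 / ?b * norm (damped a ?b p q t) \<le> 2 / \<nu> * D * (a powr (2 - 4 * \<sigma>) * ?e)" .
    have b\<nu>: "?b \<le> \<nu>" using \<nu> a1 a \<sigma> powr_mono2[of "2 * \<sigma>" a 1] by (simp add: mult_left_le)
    have "norm q + ?b * norm p \<le> M + \<nu> * M" using a b\<nu> \<nu> by (intro add_mono mult_mono) auto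
    then have "(norm q + ?b * norm p) * exp (- (?b / 2) * t) \<le> (1 + \<nu>) * M * exp (- (\<nu> / 2) * a powr (2 * \<sigma>) * t)"
      by (intro mult_mono) (use M \<nu> in \<open>auto simp: distrib_right\<close>)
    then show "norm (damped' a ?b p q t) \<le> 2 / \<nu> * D * (a powr (2 - 4 * \<sigma>) * ?e)
            + (1 + \<nu>) * M * exp (- (\<nu> / 2) * a powr (2 * \<sigma>) * t)"
      using s1 damped_overdamped(2)[OF a(1) b0 od a(3), of p q] by linarith
  qed
  show "low_frequency_decay (real n) \<sigma> M (decay_exponent n \<sigma>) (\<lambda>a. damped a (\<nu> * a powr (2 * \<sigma>)))"
    unfolding low_frequency_decay_def
  proof (rule exI[of _ r], rule exI[of _ D], rule exI[of _ "1 / \<nu>"], rule exI[of _ "2 - 2 * \<sigma>"], rule exI[of _ 0],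
      rule exI[of _ "- 2 * \<sigma>"], rule exI[of _ 0], rule exI[of _ 1], intro conjI allI impI)
    fix a t :: real and p q :: complex
    assume a: "0 < a" "a \<le> r" "0 \<le> t" "norm p \<le> M" "norm q \<le> M"
    show "norm (damped a (\<nu> * a powr (2 * \<sigma>)) p q t) \<le> D * (1 + t) powr 0 * (a powr (- 2 * \<sigma>) * exp (- (1 / \<nu>) * a powr (2 - 2 * \<sigma>) * t))
       + 0 * exp (- 1 * a powr (2 * \<sigma>) * t)"
      using over(1)[OF a] a by simp
  next
    fix k :: real assume k: "0 \<le> k"
    show "decay_exponent n \<sigma> k \<le> (2 * (k + - 2 * \<sigma>) + real n) / (2 * (2 - 2 * \<sigma>)) - 0" unfolding \<gamma> by simp
    show "decay_exponent n \<sigma> k \<le> (2 * k + real n) / (4 * \<sigma>)" using \<gamma>2[OF k] by linarith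
  qed (use \<sigma> n' r D \<nu> in auto)
  show "low_frequency_decay (real n) \<sigma> M (\<lambda>k. decay_exponent n \<sigma> k + 1) (\<lambda>a. damped' a (\<nu> * a powr (2 * \<sigma>)))"
    unfolding low_frequency_decay_def
  proof (rule exI[of _ r], rule exI[of _ "2 / \<nu> * D"], rule exI[of _ "1 / \<nu>"], rule exI[of _ "2 - 2 * \<sigma>"], rule exI[of _ 0],
      rule exI[of _ "2 - 4 * \<sigma>"], rule exI[of _ "(1 + \<nu>) * M"], rule exI[of _ "\<nu> / 2"], intro conjI allI impI)
    fix a t :: real and p q :: complex
    assume a: "0 < a" "a \<le> r" "0 \<le> t" "norm p \<le> M" "norm q \<le> M"
    show "norm (damped' a (\<nu> * a powr (2 * \<sigma>)) p q t) \<le> 2 / \<nu> * D * (1 + t) powr 0 * (a powr (2 - 4 * \<sigma>) * exp (- (1 / \<nu>) * a powr (2 - 2 * \<sigma>) * t))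
       + (1 + \<nu>) * M * exp (- (\<nu> / 2) * a powr (2 * \<sigma>) * t)"
      using over(2)[OF a] a by simp
  next
    fix k :: real assume k: "0 \<le> k"
    show "decay_exponent n \<sigma> k + 1 \<le> (2 * (k + (2 - 4 * \<sigma>)) + real n) / (2 * (2 - 2 * \<sigma>)) - 0" unfolding \<gamma>1 by simp
    show "decay_exponent n \<sigma> k + 1 \<le> (2 * k + real n) / (4 * \<sigma>)" using \<gamma>2[OF k] .
  qed (use \<sigma> n' r D \<nu> M in auto)
qed

text \<open>Inside the ball of radius r the pointwise shape is squared and integrated, outside it
  the exponential bound is used. The constants are fixed before k, so C serves every order up to
  k1.\<close>

lemma L2_decay:
  fixes p q :: "'a::euclidean_space \<Rightarrow> complex" and g :: "'a \<Rightarrow> real"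
  assumes low: "low_frequency_decay (real DIM('a)) \<sigma> M \<gamma> F" and \<sigma>: "\<sigma> > 0"
    and M: "AE \<xi> in lborel. norm (p \<xi>) \<le> M" "AE \<xi> in lborel. norm (q \<xi>) \<le> M"
    and meas: "\<And>t. (\<lambda>\<xi>. F (norm \<xi>) (p \<xi>) (q \<xi>) t) \<in> borel_measurable borel"
    and high: "\<And>r. 0 < r \<Longrightarrow> r \<le> 1 \<Longrightarrow> \<exists>c>0. \<exists>K>0. \<forall>\<xi> t k. norm \<xi> \<ge> r \<longrightarrow> t \<ge> 0 \<longrightarrow> 0 \<le> k \<longrightarrow> k \<le> k1 \<longrightarrow>
       norm \<xi> powr k * norm (F (norm \<xi>) (p \<xi>) (q \<xi>) t) \<le> K * exp (- c * t) * g \<xi>"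
    and g: "g \<in> L2_space"
  shows "\<exists>C>0. \<forall>t\<ge>0. \<forall>k. 0 \<le> k \<longrightarrow> k \<le> k1 \<longrightarrow>
     norm_L2 (weighted k (\<lambda>\<xi>. F (norm \<xi>) (p \<xi>) (q \<xi>) t)) \<le> C * (1 + t) powr (- \<gamma> k)"
proof -
  let ?n = "real DIM('a)"
  obtain r D c P e m D' c' where r: "0 < r" "r \<le> 1" and D: "0 \<le> D" "0 \<le> D'" and c: "0 < c" "0 < c'" and P: "0 < P"
    and m: "0 < 2 * m + ?n"
    and \<gamma>: "\<And>k. k \<ge> 0 \<Longrightarrow> \<gamma> k \<le> (2 * (k + m) + ?n) / (2 * P) - e" "\<And>k. k \<ge> 0 \<Longrightarrow> \<gamma> k \<le> (2 * k + ?n) / (4 * \<sigma>)"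
    and F: "\<And>a t p q. 0 < a \<Longrightarrow> a \<le> r \<Longrightarrow> 0 \<le> t \<Longrightarrow> norm p \<le> M \<Longrightarrow> norm q \<le> M \<Longrightarrow>
        norm (F a p q t) \<le> D * (1 + t) powr e * (a powr m * exp (- c * a powr P * t)) + D' * exp (- c' * a powr (2 * \<sigma>) * t)"
  proof -
    from low show thesis
      unfolding low_frequency_decay_def by (elim exE conjE) (rule that; blast)
  qed
  obtain C1 where C1: "C1 \<ge> 0" "\<And>q t. q \<in> {2 * m..2 * (k1 + m)} \<Longrightarrow> t \<ge> 0 \<Longrightarrow>
    (\<integral>\<^sup>+x. ennreal (indicator (cball 0 1) x * (norm x powr q * exp (- (2 * c) * norm x powr P * t))) \<partial>(lborel :: 'a measure))
      \<le> ennreal (C1 * (1 + t) powr (- (q + ?n) / P))"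
    using low_frequency_integral[where 'a='a, of "2 * m" P "2 * c" "2 * (k1 + m)"] m P c by auto
  obtain C2 where C2: "C2 \<ge> 0" "\<And>q t. q \<in> {0..2 * k1} \<Longrightarrow> t \<ge> 0 \<Longrightarrow>
    (\<integral>\<^sup>+x. ennreal (indicator (cball 0 1) x * (norm x powr q * exp (- (2 * c') * norm x powr (2 * \<sigma>) * t))) \<partial>(lborel :: 'a measure))
      \<le> ennreal (C2 * (1 + t) powr (- (q + ?n) / (2 * \<sigma>)))"
    using low_frequency_integral[where 'a='a, of 0 "2 * \<sigma>" "2 * c'" "2 * k1"] \<sigma> c by auto
  obtain c3 K where K: "c3 > 0" "K > 0" "\<And>\<xi> t k. norm \<xi> \<ge> r \<Longrightarrow> t \<ge> 0 \<Longrightarrow> 0 \<le> k \<Longrightarrow> k \<le> k1 \<Longrightarrow>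
       norm \<xi> powr k * norm (F (norm \<xi>) (p \<xi>) (q \<xi>) t) \<le> K * exp (- c3 * t) * g \<xi>"
    using high[OF r] by blast
  \<comment> \<open>The clause \<open>\<gamma> k \<le> (2 * k + n) / (4 * \<sigma>)\<close> serves
    twice: it controls the second summand at low frequencies, and it bounds all the rates so that
    the exponential decay at high frequencies dominates them.\<close>
  obtain K' where K': "K' > 0" "\<And>t x. t \<ge> 0 \<Longrightarrow> x \<le> (2 * k1 + ?n) / (4 * \<sigma>) \<Longrightarrow> exp (- c3 * t) \<le> K' * (1 + t) powr (- x)"
    using exp_minus_le_powr_1_plus[OF K(1), of "(2 * k1 + ?n) / (4 * \<sigma>)"] by blast
  define A where "A = sqrt (2 * D\<^sup>2 * C1 + 2 * D'\<^sup>2 * C2)"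
  have A: "A \<ge> 0" "A\<^sup>2 = 2 * D\<^sup>2 * C1 + 2 * D'\<^sup>2 * C2" using C1(1) C2(1) by (auto simp: A_def)
  define C where "C = A + K * K' * norm_L2 g + 1"
  have C: "C > 0"
    unfolding C_def using A(1) K(2) K'(1)
    by (intro add_nonneg_pos add_nonneg_nonneg mult_nonneg_nonneg norm_L2_nonneg) auto
  have "norm_L2 (weighted k (\<lambda>\<xi>. F (norm \<xi>) (p \<xi>) (q \<xi>) t)) \<le> C * (1 + t) powr (- \<gamma> k)"
    if t: "t \<ge> 0" and k: "0 \<le> k" "k \<le> k1" for t k
  proof -
    let ?Z = "weighted k (\<lambda>\<xi>. F (norm \<xi>) (p \<xi>) (q \<xi>) t)"
    let ?G = "(1 + t) powr (- \<gamma> k)"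
    let ?I1 = "\<lambda>x::'a. indicator (cball 0 1) x * (norm x powr (2 * (k + m)) * exp (- (2 * c) * norm x powr P * t))"
    let ?I2 = "\<lambda>x::'a. indicator (cball 0 1) x * (norm x powr (2 * k) * exp (- (2 * c') * norm x powr (2 * \<sigma>) * t))"
    let ?E1 = "2 * D\<^sup>2 * (1 + t) powr (2 * e)"
    have psq: "(x powr y)\<^sup>2 = x powr (2 * y)" for x y :: real
      by (simp add: power2_eq_square powr_add[symmetric])
    have esq: "(exp (- z * x * t))\<^sup>2 = exp (- (2 * z) * x * t)" for x z t :: real
      by (simp add: power2_eq_square exp_add[symmetric])
    \<comment> \<open>Squaring doubles all exponents, and the square of the sum is at most twice the
      sum of the squares, whence the factors 2.\<close>
    have pw: "indicator (cball 0 r) \<xi> * (norm (?Z \<xi>))\<^sup>2 \<le> ?E1 * ?I1 \<xi> + 2 * D'\<^sup>2 * ?I2 \<xi>"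
      if M': "norm (p \<xi>) \<le> M" "norm (q \<xi>) \<le> M" for \<xi>
    proof (cases "\<xi> \<in> cball 0 r \<and> \<xi> \<noteq> 0")
      case True
      then have a: "0 < norm \<xi>" "norm \<xi> \<le> r" "norm \<xi> \<le> 1" using r by auto
      let ?a = "norm \<xi>"
      let ?T1 = "D * (1 + t) powr e * (?a powr (k + m) * exp (- c * ?a powr P * t))"
      let ?T2 = "D' * (?a powr k * exp (- c' * ?a powr (2 * \<sigma>) * t))"
      have "norm (?Z \<xi>) \<le> ?a powr k * (D * (1 + t) powr e * (?a powr m * exp (- c * ?a powr P * t)) + D' * exp (- c' * ?a powr (2 * \<sigma>) * t))"
        unfolding norm_weighted by (intro mult_left_mono F a t M') auto
      also have "\<dots> = ?T1 + ?T2" using a(1) by (simp add: powr_add algebra_simps)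
      finally have "(norm (?Z \<xi>))\<^sup>2 \<le> (?T1 + ?T2)\<^sup>2" by (intro power_mono) auto
      also have "\<dots> \<le> 2 * ?T1\<^sup>2 + 2 * ?T2\<^sup>2"
        using sum_squares_bound[of ?T1 ?T2] by (simp add: power2_sum)
      also have "?T1\<^sup>2 = D\<^sup>2 * (1 + t) powr (2 * e) * (?a powr (2 * (k + m)) * exp (- (2 * c) * ?a powr P * t))"
        by (simp only: power_mult_distrib psq esq)
      also have "?T2\<^sup>2 = D'\<^sup>2 * (?a powr (2 * k) * exp (- (2 * c') * ?a powr (2 * \<sigma>) * t))"
        by (simp only: power_mult_distrib psq esq)
      finally show ?thesis using True a by simp
    next
      case False
      then have "indicator (cball 0 r) \<xi> * (norm (?Z \<xi>))\<^sup>2 = 0" by (auto simp: norm_weighted)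
      moreover have "?E1 * ?I1 \<xi> + 2 * D'\<^sup>2 * ?I2 \<xi> \<ge> 0" by (intro add_nonneg_nonneg mult_nonneg_nonneg) auto
      ultimately show ?thesis by linarith
    qed
    have [measurable]: "cball (0::'a) 1 \<in> sets borel" by simp
    have "(\<integral>\<^sup>+\<xi>. ennreal (indicator (cball 0 r) \<xi> * (norm (?Z \<xi>))\<^sup>2) \<partial>lborel)
       \<le> (\<integral>\<^sup>+\<xi>. ennreal ?E1 * ennreal (?I1 \<xi>) + ennreal (2 * D'\<^sup>2) * ennreal (?I2 \<xi>) \<partial>lborel)"
    proof (rule nn_integral_mono_AE)
      show "AE \<xi> in lborel. ennreal (indicator (cball 0 r) \<xi> * (norm (?Z \<xi>))\<^sup>2)
         \<le> ennreal ?E1 * ennreal (?I1 \<xi>) + ennreal (2 * D'\<^sup>2) * ennreal (?I2 \<xi>)"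
        using M
      proof eventually_elim
        case (elim \<xi>)
        have "ennreal ?E1 * ennreal (?I1 \<xi>) + ennreal (2 * D'\<^sup>2) * ennreal (?I2 \<xi>) = ennreal (?E1 * ?I1 \<xi> + 2 * D'\<^sup>2 * ?I2 \<xi>)"
          by (subst ennreal_plus) (auto simp: ennreal_mult)
        then show ?case using ennreal_leI[OF pw[OF elim]] by (simp only:)
      qed
    qed
    also have "\<dots> = ennreal ?E1 * (\<integral>\<^sup>+\<xi>. ennreal (?I1 \<xi>) \<partial>lborel) + ennreal (2 * D'\<^sup>2) * (\<integral>\<^sup>+\<xi>. ennreal (?I2 \<xi>) \<partial>lborel)"
    proof -
      have [measurable]: "?I1 \<in> borel_measurable borel" "?I2 \<in> borel_measurable borel" by measurable
      show ?thesis by (subst nn_integral_add, measurable, simp add: nn_integral_cmult)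
    qed
    also have "\<dots> \<le> ennreal ?E1 * ennreal (C1 * (1 + t) powr (- (2 * (k + m) + ?n) / P))
        + ennreal (2 * D'\<^sup>2) * ennreal (C2 * (1 + t) powr (- (2 * k + ?n) / (2 * \<sigma>)))"
      using k by (intro add_mono mult_left_mono C1(2) C2(2) t) auto
    also have "\<dots> = ennreal (?E1 * (C1 * (1 + t) powr (- (2 * (k + m) + ?n) / P))
        + 2 * D'\<^sup>2 * (C2 * (1 + t) powr (- (2 * k + ?n) / (2 * \<sigma>))))"
      using C1(1) C2(1) by (subst ennreal_plus) (auto simp: ennreal_mult)
    also have "\<dots> \<le> ennreal ((A * ?G)\<^sup>2)"
    proof (rule ennreal_leI)
      have double: "2 * d + - x / y \<le> - 2 * z" if "z \<le> x / (2 * y) - d" for x y z d :: real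
      proof -
        have "- x / y = - 2 * (x / (2 * y))" by simp
        then show ?thesis using that by linarith
      qed
      have G2: "?G\<^sup>2 = (1 + t) powr (- 2 * \<gamma> k)" using t by (simp add: power2_eq_square powr_add[symmetric])
      have "?E1 * (C1 * (1 + t) powr (- (2 * (k + m) + ?n) / P))
         = 2 * D\<^sup>2 * C1 * ((1 + t) powr (2 * e) * (1 + t) powr (- (2 * (k + m) + ?n) / P))"
        by (simp only: mult_ac)
      also have "\<dots> = 2 * D\<^sup>2 * C1 * ((1 + t) powr (2 * e + - (2 * (k + m) + ?n) / P))"
        by (simp only: powr_add)
      also have "\<dots> \<le> 2 * D\<^sup>2 * C1 * ((1 + t) powr (- 2 * \<gamma> k))"
      proof (intro mult_left_mono powr_mono)
        show "2 * e + - (2 * (k + m) + ?n) / P \<le> - 2 * \<gamma> k" by (rule double[OF \<gamma>(1)[OF k(1)]])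
      qed (use t C1(1) in auto)
      finally have 1: "?E1 * (C1 * (1 + t) powr (- (2 * (k + m) + ?n) / P)) \<le> 2 * D\<^sup>2 * C1 * ?G\<^sup>2"
        unfolding G2 .
      have "2 * D'\<^sup>2 * (C2 * (1 + t) powr (- (2 * k + ?n) / (2 * \<sigma>))) \<le> 2 * D'\<^sup>2 * (C2 * ((1 + t) powr (- 2 * \<gamma> k)))"
      proof (intro mult_left_mono powr_mono)
        show "- (2 * k + ?n) / (2 * \<sigma>) \<le> - 2 * \<gamma> k"
          using double[of "\<gamma> k" "2 * k + ?n" "2 * \<sigma>" 0] \<gamma>(2)[OF k(1)] by simp
      qed (use t C2(1) in auto)
      then have 2: "2 * D'\<^sup>2 * (C2 * (1 + t) powr (- (2 * k + ?n) / (2 * \<sigma>))) \<le> 2 * D'\<^sup>2 * C2 * ?G\<^sup>2"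
        unfolding G2 by (simp only: mult.assoc)
      show "?E1 * (C1 * (1 + t) powr (- (2 * (k + m) + ?n) / P)) + 2 * D'\<^sup>2 * (C2 * (1 + t) powr (- (2 * k + ?n) / (2 * \<sigma>)))
         \<le> (A * ?G)\<^sup>2"
        unfolding power_mult_distrib A(2) distrib_right using 1 2 by linarith
    qed
    finally have L: "(\<integral>\<^sup>+\<xi>. ennreal (indicator (cball 0 r) \<xi> * (norm (?Z \<xi>))\<^sup>2) \<partial>lborel) \<le> ennreal ((A * ?G)\<^sup>2)" .
    have "norm_L2 ?Z \<le> A * ?G + K * exp (- c3 * t) * norm_L2 g"
    proof (rule L2_split_bound[OF weighted_measurable[OF meas] _ L _ _ g])
      show "AE \<xi> in lborel. \<xi> \<notin> cball 0 r \<longrightarrow> norm (?Z \<xi>) \<le> K * exp (- c3 * t) * g \<xi>"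
        unfolding norm_weighted by (intro AE_I2 impI K(3) t k) auto
    qed (use A(1) K(2) in auto)
    also have "\<dots> \<le> A * ?G + K * (K' * ?G) * norm_L2 g"
    proof (intro add_left_mono mult_right_mono mult_left_mono K'(2) t)
      show "\<gamma> k \<le> (2 * k1 + ?n) / (4 * \<sigma>)"
        using \<gamma>(2)[OF k(1)] divide_right_mono[of "2 * k + ?n" "2 * k1 + ?n" "4 * \<sigma>"] k \<sigma> by linarith
    qed (use K(2) in auto)
    also have "\<dots> = (A + K * K' * norm_L2 g) * ?G" by (simp add: algebra_simps)
    also have "\<dots> \<le> C * ?G" unfolding C_def by (intro mult_right_mono) auto
    finally show ?thesis .
  qed
  then show ?thesis using C by blast
qed

lemma damped_measurable:
  fixes a b :: "'a::euclidean_space \<Rightarrow> real" and p q :: "'a \<Rightarrow> complex"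
  assumes [measurable]: "a \<in> borel_measurable borel" "b \<in> borel_measurable borel"
    "p \<in> borel_measurable borel" "q \<in> borel_measurable borel"
  shows "(\<lambda>x. damped (a x) (b x) (p x) (q x) t) \<in> borel_measurable borel"
    and "(\<lambda>x. damped' (a x) (b x) (p x) (q x) t) \<in> borel_measurable borel"
proof -
  have [measurable]: "(exp :: complex \<Rightarrow> complex) \<in> borel_measurable borel"
    by (intro borel_measurable_continuous_onI continuous_intros)
  have [measurable]: "(\<lambda>x. damping_root (a x) (b x)) \<in> borel_measurable borel"
    unfolding damping_root_def Let_def by measurable
  have [measurable]: "(\<lambda>x. char_plus (a x) (b x)) \<in> borel_measurable borel"
     "(\<lambda>x. char_minus (a x) (b x)) \<in> borel_measurable borel"
    unfolding char_plus_def char_minus_def by measurable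
  have [measurable]: "(\<lambda>x. kernel (a x) (b x) (complex_of_real t)) \<in> borel_measurable borel"
    unfolding kernel_def by measurable
  show d [measurable]: "(\<lambda>x. damped (a x) (b x) (p x) (q x) t) \<in> borel_measurable borel"
    unfolding damped_def by measurable
  show "(\<lambda>x. damped' (a x) (b x) (p x) (q x) t) \<in> borel_measurable borel"
    unfolding damped'_def by measurable
qed

text \<open>The coefficients are real, so conjugation maps solutions to solutions and uniqueness
  applies. The branch chosen in \<open>damping_root\<close> need not be examined.\<close>

lemma damped_cnj:
  assumes ab: "a > 0" "b > 0" and t: "t \<ge> 0"
  shows "damped a b (cnj p) (cnj q) t = cnj (damped a b p q t)"
    and "damped' a b (cnj p) (cnj q) t = cnj (damped' a b p q t)"
proof -
  have dy: "((\<lambda>s. cnj (damped a b p q s)) has_vector_derivative cnj (damped' a b p q s)) (at s within S)" for s S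
    by (intro has_vector_derivative_cnj damped_deriv)
  have dy': "((\<lambda>s. cnj (damped' a b p q s)) has_vector_derivative
     - (complex_of_real b * cnj (damped' a b p q s) + complex_of_real (a\<^sup>2) * cnj (damped a b p q s))) (at s within S)" for s S
    using has_vector_derivative_cnj[OF damped'_deriv[of a b p q s S]] by simp
  have eq: "cnj (damped a b p q s) = damped a b (cnj p) (cnj q) s" if "s \<ge> 0" for s
    using damped_unique[OF ab _ _ dy dy' that] by (simp add: continuous_on_cnj damped_continuous)
  then show "damped a b (cnj p) (cnj q) t = cnj (damped a b p q t)" using t by simp
  have "((\<lambda>s. damped a b (cnj p) (cnj q) s) has_vector_derivative cnj (damped' a b p q t)) (at t within {0..})"
    by (rule has_vector_derivative_transform[OF _ _ dy]) (use t eq in auto)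
  then show "damped' a b (cnj p) (cnj q) t = cnj (damped' a b p q t)"
    by (rule vector_derivative_unique_within[OF at_within_atLeast_neq_bot[OF t] damped_deriv])
qed

section \<open>The Cauchy problem\<close>

lemma L2_norm_of: "f \<in> L2_space \<Longrightarrow> (\<lambda>x. norm (f x)) \<in> L2_space"
  by (auto simp: L2_space_def)

lemma L2_scale_real: "f \<in> L2_space \<Longrightarrow> (\<lambda>x. c * f x :: real) \<in> L2_space"
  by (auto simp: L2_space_def power_mult_distrib)

lemma L2_dominated':
  fixes f :: "'a::euclidean_space \<Rightarrow> complex" and g :: "'a \<Rightarrow> real"
  assumes "f \<in> borel_measurable borel" "g \<in> L2_space" "AE x in lborel. norm (f x) \<le> g x"
  shows "f \<in> L2_space"
proof (rule L2_dominated(1)[OF assms(1,2)])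
  show "AE x in lborel. norm (f x) \<le> 1 * norm (g x)"
    using assms(3) by eventually_elim (auto intro: order.trans)
qed simp

lemma powr_le_1_plus:
  fixes x :: real
  assumes "0 \<le> a" "a \<le> b" "0 \<le> x"
  shows "x powr a \<le> 1 + x powr b"
proof (cases "x \<le> 1")
  case True
  then have "x powr a \<le> 1" using assms powr_mono2[of a x 1] by simp
  then show ?thesis using powr_ge_zero[of x b] by linarith
next
  case False
  then have "x powr a \<le> x powr b" using assms by (intro powr_mono) auto
  then show ?thesis by linarith
qed

lemma weighted_interpolate:
  assumes f: "f \<in> L2_space" "weighted b f \<in> L2_space" and ab: "0 \<le> a" "a \<le> b"
  shows "weighted a f \<in> L2_space"
proof (rule L2_dominated'[OF _ L2_add(1)[OF L2_norm_of[OF f(1)] L2_norm_of[OF f(2)]]])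
  show "weighted a f \<in> borel_measurable borel" using L2_measurable[OF f(1)] by measurable
  show "AE x in lborel. norm (weighted a f x) \<le> norm (f x) + norm (weighted b f x)"
  proof (intro AE_I2)
    fix x
    have "norm x powr a * norm (f x) \<le> (1 + norm x powr b) * norm (f x)"
      by (intro mult_right_mono powr_le_1_plus ab) auto
    then show "norm (weighted a f x) \<le> norm (f x) + norm (weighted b f x)"
      by (simp add: norm_weighted distrib_right)
  qed
qed

locale damped_wave =
  fixes \<nu> \<sigma> k0 :: real and u0 u1 :: "'a::euclidean_space \<Rightarrow> real"
  assumes \<nu>: "\<nu> > 0" and \<sigma>: "0 < \<sigma>" "\<sigma> \<le> 1" and k0: "k0 \<ge> 0"
    and u0: "u0 \<in> sobolev (k0 + 1)" and u1: "u1 \<in> sobolev k0"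
begin

definition p :: "'a \<Rightarrow> complex" where "p = fourier_real u0"
definition q :: "'a \<Rightarrow> complex" where "q = fourier_real u1"
definition damp :: "'a \<Rightarrow> real" where "damp \<xi> = \<nu> * norm \<xi> powr (2 * \<sigma>)"
definition Y :: "real \<Rightarrow> 'a \<Rightarrow> complex" where "Y t \<xi> = damped (norm \<xi>) (damp \<xi>) (p \<xi>) (q \<xi>) t"
definition Y' :: "real \<Rightarrow> 'a \<Rightarrow> complex" where "Y' t \<xi> = damped' (norm \<xi>) (damp \<xi>) (p \<xi>) (q \<xi>) t"
text \<open>Up to a factor 2 this bounds the time derivative, and \<open>norm \<xi>\<close> times
  the solution, at frequency \<xi> for all times. Off the origin \<open>g\<close> is
  \<open>h\<close> with the weight of order k0.\<close>

definition h :: "'a \<Rightarrow> real" where "h \<xi> = norm (q \<xi>) + norm \<xi> * norm (p \<xi>)"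
definition g :: "'a \<Rightarrow> real" where "g \<xi> = norm \<xi> powr k0 * norm (q \<xi>) + norm \<xi> powr (k0 + 1) * norm (p \<xi>)"

lemma initial_fourier: "is_fourier_real u0 p" "is_fourier_real u1 q"
  unfolding p_def q_def using u0 u1 by (auto intro!: is_fourier_real_fourier_real simp: sobolev_def)

lemma initial_L2:
  "p \<in> L2_space" "q \<in> L2_space" "weighted (k0 + 1) p \<in> L2_space" "weighted k0 q \<in> L2_space"
  using is_fourier_L2(2)[OF initial_fourier(1)] is_fourier_L2(2)[OF initial_fourier(2)]
    sobolev_iff[OF initial_fourier(1)] sobolev_iff[OF initial_fourier(2)] u0 u1 by auto

lemma initial_measurable [measurable]: "p \<in> borel_measurable borel" "q \<in> borel_measurable borel"
  by (intro L2_measurable initial_L2)+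

lemma g_L2: "g \<in> L2_space"
  using L2_add(1)[OF L2_norm_of[OF initial_L2(4)] L2_norm_of[OF initial_L2(3)]]
  unfolding norm_weighted g_def[abs_def] .

lemma h_L2: "h \<in> L2_space"
proof -
  let ?w = "\<lambda>\<xi>. (norm (q \<xi>) + norm (p \<xi>)) + norm (weighted (k0 + 1) p \<xi>)"
  have w: "?w \<in> L2_space"
    by (intro L2_add(1) L2_norm_of initial_L2)
  have le: "norm (h \<xi>) \<le> 1 * norm (?w \<xi>)" for \<xi>
  proof -
    have "norm \<xi> \<le> 1 + norm \<xi> powr (k0 + 1)" using powr_le_1_plus[of 1 "k0 + 1" "norm \<xi>"] k0 by simp
    then have "norm \<xi> * norm (p \<xi>) \<le> (1 + norm \<xi> powr (k0 + 1)) * norm (p \<xi>)" by (intro mult_right_mono) auto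
    then show ?thesis by (simp add: h_def norm_weighted distrib_right)
  qed
  show ?thesis
    by (rule L2_dominated(1)[OF _ w AE_I2[OF le]]) (auto simp: h_def[abs_def])
qed

lemma h_nonneg: "h \<xi> \<ge> 0"
  by (simp add: h_def)

lemma g_eq: "\<xi> \<noteq> 0 \<Longrightarrow> g \<xi> = norm \<xi> powr k0 * h \<xi>"
  by (simp add: g_def h_def powr_add algebra_simps)

lemma damp_pos: "\<xi> \<noteq> 0 \<Longrightarrow> damp \<xi> > 0"
  using \<nu> by (simp add: damp_def)

lemma Y_measurable [measurable]: "Y t \<in> borel_measurable borel" "Y' t \<in> borel_measurable borel"
  unfolding Y_def[abs_def] Y'_def[abs_def] damp_def by (intro damped_measurable; measurable)+

text \<open>At the origin both coefficients of the oscillator vanish and the energy estimates fail;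
  that point is discarded as a null set.\<close>

lemma AE_nonzero: "AE \<xi> in lborel. \<xi> \<noteq> (0::'a)"
  by (rule AE_lborel_singleton)

context
  fixes \<xi> :: 'a
  assumes \<xi>: "\<xi> \<noteq> 0"
begin

lemma Y_bounds:
  assumes t: "t \<ge> 0"
  shows "norm (Y t \<xi>) \<le> norm (p \<xi>) + 2 * t * h \<xi>" "norm (Y' t \<xi>) \<le> 2 * h \<xi>"
    and "norm (weighted (k0 + 1) (Y t) \<xi>) \<le> 2 * g \<xi>" "norm (weighted k0 (Y' t) \<xi>) \<le> 2 * g \<xi>"
proof -
  have n: "norm \<xi> > 0" using \<xi> by simp
  note d = damp_pos[OF \<xi>]
  show 1: "norm (Y' t \<xi>) \<le> 2 * h \<xi>"
    unfolding Y'_def h_def by (rule damped_energy_bound[OF n d t])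
  have 2: "norm \<xi> * norm (Y t \<xi>) \<le> 2 * h \<xi>"
    unfolding Y_def h_def by (rule damped_energy_bound[OF n d t])
  show "norm (Y t \<xi>) \<le> norm (p \<xi>) + 2 * t * h \<xi>"
    unfolding Y_def h_def by (rule damped_linear_bound[OF n d t])
  have "norm \<xi> powr k0 * norm (Y' t \<xi>) \<le> norm \<xi> powr k0 * (2 * h \<xi>)"
    using 1 by (intro mult_left_mono) auto
  then show "norm (weighted k0 (Y' t) \<xi>) \<le> 2 * g \<xi>"
    by (simp add: norm_weighted g_eq[OF \<xi>] mult.left_commute)
  have "norm \<xi> powr k0 * (norm \<xi> * norm (Y t \<xi>)) \<le> norm \<xi> powr k0 * (2 * h \<xi>)"
    using 2 by (intro mult_left_mono) auto
  then show "norm (weighted (k0 + 1) (Y t) \<xi>) \<le> 2 * g \<xi>"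
    using n by (simp add: norm_weighted g_eq[OF \<xi>] powr_add mult_ac)
qed

lemma Y_increment:
  assumes "s \<ge> 0" "t \<ge> 0"
  shows "norm (Y t \<xi> - Y s \<xi>) \<le> 2 * h \<xi> * \<bar>t - s\<bar>"
  unfolding Y_def h_def using damped_increment[OF _ damp_pos[OF \<xi>] assms] \<xi> by simp

lemma Y_deriv: "((\<lambda>t. Y t \<xi>) has_vector_derivative Y' t \<xi>) (at t within S)"
  unfolding Y_def Y'_def by (rule damped_deriv)

lemma Y'_deriv: "((\<lambda>t. Y' t \<xi>) has_vector_derivative
    - (complex_of_real (damp \<xi>) * Y' t \<xi> + complex_of_real ((norm \<xi>)\<^sup>2) * Y t \<xi>)) (at t within S)"
  unfolding Y_def Y'_def by (rule damped'_deriv)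

lemma Y_tendsto: "((\<lambda>s. Y s \<xi>) \<longlongrightarrow> Y t \<xi>) (at t within S)" "((\<lambda>s. Y' s \<xi>) \<longlongrightarrow> Y' t \<xi>) (at t within S)"
  using has_vector_derivative_continuous[OF Y_deriv] has_vector_derivative_continuous[OF Y'_deriv]
  by (auto simp: continuous_within)

lemma difference_quotient_tendsto:
  "((\<lambda>s. (Y s \<xi> - Y t \<xi>) / complex_of_real (s - t) - Y' t \<xi>) \<longlongrightarrow> 0) (at t within S)"
proof -
  have "((\<lambda>s. norm (Y s \<xi> - Y t \<xi> - (s - t) *\<^sub>R Y' t \<xi>) / norm (s - t)) \<longlongrightarrow> 0) (at t within S)"
    using Y_deriv[of t S] unfolding has_vector_derivative_def has_derivative_iff_norm by (rule conjunct2)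
  moreover have "\<forall>\<^sub>F s in at t within S. norm (Y s \<xi> - Y t \<xi> - (s - t) *\<^sub>R Y' t \<xi>) / norm (s - t)
      = norm ((Y s \<xi> - Y t \<xi>) / complex_of_real (s - t) - Y' t \<xi>)"
    unfolding eventually_at_filter
  proof (intro always_eventually allI impI)
    fix s assume s: "s \<noteq> t"
    have "(Y s \<xi> - Y t \<xi>) / complex_of_real (s - t) - Y' t \<xi>
        = (Y s \<xi> - Y t \<xi> - (s - t) *\<^sub>R Y' t \<xi>) / complex_of_real (s - t)"
      using s by (simp add: diff_divide_distrib scaleR_conv_of_real del: of_real_diff)
    then show "norm (Y s \<xi> - Y t \<xi> - (s - t) *\<^sub>R Y' t \<xi>) / norm (s - t)
      = norm ((Y s \<xi> - Y t \<xi>) / complex_of_real (s - t) - Y' t \<xi>)"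
      by (simp only: norm_divide norm_of_real real_norm_def)
  qed
  ultimately have "((\<lambda>s. norm ((Y s \<xi> - Y t \<xi>) / complex_of_real (s - t) - Y' t \<xi>)) \<longlongrightarrow> 0) (at t within S)"
    by (rule Lim_transform_eventually)
  then show ?thesis by (rule tendsto_norm_zero_cancel)
qed

end

lemma Y_L2:
  assumes t: "t \<ge> 0"
  shows "Y t \<in> L2_space" "Y' t \<in> L2_space"
    and "weighted (k0 + 1) (Y t) \<in> L2_space" "weighted k0 (Y' t) \<in> L2_space"
proof -
  show "Y t \<in> L2_space"
    by (rule L2_dominated'[OF _ L2_add(1)[OF L2_norm_of[OF initial_L2(1)] L2_scale_real[OF h_L2, of "2 * t"]]])
       (use AE_nonzero Y_bounds(1)[OF _ t] in \<open>auto elim!: eventually_mono\<close>)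
  show "Y' t \<in> L2_space"
    by (rule L2_dominated'[OF _ L2_scale_real[OF h_L2, of 2]])
       (use AE_nonzero Y_bounds(2)[OF _ t] in \<open>auto elim!: eventually_mono\<close>)
  show "weighted (k0 + 1) (Y t) \<in> L2_space"
    by (rule L2_dominated'[OF _ L2_scale_real[OF g_L2, of 2]])
       (use AE_nonzero Y_bounds(3)[OF _ t] in \<open>auto elim!: eventually_mono\<close>)
  show "weighted k0 (Y' t) \<in> L2_space"
    by (rule L2_dominated'[OF _ L2_scale_real[OF g_L2, of 2]])
       (use AE_nonzero Y_bounds(4)[OF _ t] in \<open>auto elim!: eventually_mono\<close>)
qed

lemma Y_reflect:
  assumes t: "t \<ge> 0"
  shows "AE \<xi> in lborel. Y t (- \<xi>) = cnj (Y t \<xi>)" "AE \<xi> in lborel. Y' t (- \<xi>) = cnj (Y' t \<xi>)"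
proof -
  have pq: "AE \<xi> in lborel. p (- \<xi>) = cnj (p \<xi>)" "AE \<xi> in lborel. q (- \<xi>) = cnj (q \<xi>)"
    unfolding p_def q_def using u0 u1 by (auto intro!: fourier_real_reflect simp: sobolev_def)
  show "AE \<xi> in lborel. Y t (- \<xi>) = cnj (Y t \<xi>)"
    using pq AE_nonzero
  proof eventually_elim
    case (elim \<xi>)
    then show ?case unfolding Y_def using damped_cnj(1)[OF _ damp_pos t] by (simp add: damp_def)
  qed
  show "AE \<xi> in lborel. Y' t (- \<xi>) = cnj (Y' t \<xi>)"
    using pq AE_nonzero
  proof eventually_elim
    case (elim \<xi>)
    then show ?case unfolding Y'_def using damped_cnj(2)[OF _ damp_pos t] by (simp add: damp_def)
  qed
qed

section \<open>The solution in physical space, its time derivative and uniqueness\<close>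

definition U :: "real \<Rightarrow> 'a \<Rightarrow> real" where "U t = real_inverse (Y t)"
definition V :: "real \<Rightarrow> 'a \<Rightarrow> real" where "V t = real_inverse (Y' t)"

lemma U_fourier: "t \<ge> 0 \<Longrightarrow> is_fourier_real (U t) (Y t)"
  and V_fourier: "t \<ge> 0 \<Longrightarrow> is_fourier_real (V t) (Y' t)"
  unfolding U_def V_def by (intro is_fourier_real_inverse Y_L2 Y_reflect; assumption)+

text \<open>The class \<open>C1_sobolev k0\<close> asks for continuity in order k0 as well; its
  majorant is obtained by interpolating between order 0 and order k0 + 1.\<close>

lemma U_C0: "U \<in> C0_sobolev (k0 + 1)" and U_C0': "U \<in> C0_sobolev k0"
proof -
  \<comment> \<open>Sum of the linear bounds at the times s and t, with s replaced by its upper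
    bound B.\<close>
  define w where "w t B \<xi> = 2 * norm (p \<xi>) + (2 * \<bar>B\<bar> + 2 * t) * h \<xi>" for t B \<xi>
  have w: "w t B \<in> L2_space" for t B
    unfolding w_def[abs_def] by (intro L2_add(1) L2_scale_real L2_norm_of initial_L2 h_L2)
  have f: "s \<in> {0..} \<Longrightarrow> is_fourier_real (\<lambda>x. U s x - U t x) (\<lambda>\<xi>. Y s \<xi> - Y t \<xi>)" if "t \<ge> 0" for s t
    using that by (intro is_fourier_real_diff U_fourier) auto
  have le1: "AE \<xi> in lborel. norm (Y s \<xi> - Y t \<xi>) \<le> w t B \<xi>" if "t \<ge> 0" "s \<in> {0..}" "s \<le> B" for s t B
    using AE_nonzero
  proof eventually_elim
    case (elim \<xi>)
    have "norm (Y s \<xi> - Y t \<xi>) \<le> norm (Y s \<xi>) + norm (Y t \<xi>)" by (rule norm_triangle_ineq4)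
    also have "\<dots> \<le> (norm (p \<xi>) + 2 * s * h \<xi>) + (norm (p \<xi>) + 2 * t * h \<xi>)"
      using that by (intro add_mono Y_bounds elim) auto
    also have "\<dots> \<le> w t B \<xi>"
      using mult_right_mono[of s "\<bar>B\<bar>" "h \<xi>"] h_nonneg that by (simp add: w_def algebra_simps)
    finally show ?case .
  qed
  have le2: "AE \<xi> in lborel. norm (weighted (k0 + 1) (\<lambda>\<xi>. Y s \<xi> - Y t \<xi>) \<xi>) \<le> 4 * g \<xi>" if "t \<ge> 0" "s \<in> {0..}" for s t
    using AE_nonzero
  proof eventually_elim
    case (elim \<xi>)
    have "norm (weighted (k0 + 1) (Y s) \<xi> - weighted (k0 + 1) (Y t) \<xi>) \<le> 2 * g \<xi> + 2 * g \<xi>"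
      using that by (intro order.trans[OF norm_triangle_ineq4] add_mono Y_bounds elim) auto
    then show ?case by (simp add: weighted_diff)
  qed
  have lim: "AE \<xi> in lborel. ((\<lambda>s. Y s \<xi> - Y t \<xi>) \<longlongrightarrow> 0) (at t within {0..})" for t
    using AE_nonzero by eventually_elim (rule LIM_zero[OF Y_tendsto(1)])
  show "U \<in> C0_sobolev (k0 + 1)"
    unfolding C0_sobolev_def
  proof (intro CollectI conjI allI impI)
    fix t :: real assume t: "t \<ge> 0"
    show "U t \<in> sobolev (k0 + 1)" using sobolev_iff[OF U_fourier[OF t]] Y_L2[OF t] by simp
    show "((\<lambda>s. norm_sobolev (k0 + 1) (\<lambda>x. U s x - U t x)) \<longlongrightarrow> 0) (at t within {0..})"
      by (rule norm_sobolev_tendsto[where w = "w t" and v = "\<lambda>B \<xi>. 4 * g \<xi>", OF f[OF t] w L2_scale_real[OF g_L2] le1[OF t] le2[OF t] lim])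
  qed
  have le3: "AE \<xi> in lborel. norm (weighted k0 (\<lambda>\<xi>. Y s \<xi> - Y t \<xi>) \<xi>) \<le> w t B \<xi> + 4 * g \<xi>"
    if "t \<ge> 0" "s \<in> {0..}" "s \<le> B" for s t B
    using le1[OF that] le2[OF that(1,2)]
  proof eventually_elim
    case (elim \<xi>)
    have "norm \<xi> powr k0 * norm (Y s \<xi> - Y t \<xi>) \<le> (1 + norm \<xi> powr (k0 + 1)) * norm (Y s \<xi> - Y t \<xi>)"
      using k0 by (intro mult_right_mono powr_le_1_plus) auto
    then show ?case using elim by (simp add: norm_weighted distrib_right)
  qed
  show "U \<in> C0_sobolev k0"
    unfolding C0_sobolev_def
  proof (intro CollectI conjI allI impI)
    fix t :: real assume t: "t \<ge> 0"
    show "U t \<in> sobolev k0"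
      using sobolev_iff[OF U_fourier[OF t]] weighted_interpolate[OF Y_L2(1,3)[OF t]] k0 by simp
    show "((\<lambda>s. norm_sobolev k0 (\<lambda>x. U s x - U t x)) \<longlongrightarrow> 0) (at t within {0..})"
      by (rule norm_sobolev_tendsto[where w = "w t" and v = "\<lambda>B \<xi>. w t B \<xi> + 4 * g \<xi>",
            OF f[OF t] w L2_add(1)[OF w L2_scale_real[OF g_L2]] le1[OF t] le3[OF t] lim])
  qed
qed

lemma V_C0: "V \<in> C0_sobolev k0"
  unfolding C0_sobolev_def
proof (intro CollectI conjI allI impI)
  fix t :: real assume t: "t \<ge> 0"
  show "V t \<in> sobolev k0" using sobolev_iff[OF V_fourier[OF t]] Y_L2[OF t] by simp
  have f: "s \<in> {0..} \<Longrightarrow> is_fourier_real (\<lambda>x. V s x - V t x) (\<lambda>\<xi>. Y' s \<xi> - Y' t \<xi>)" for s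
    using t by (intro is_fourier_real_diff V_fourier) auto
  have le1: "AE \<xi> in lborel. norm (Y' s \<xi> - Y' t \<xi>) \<le> 4 * h \<xi>" if "s \<in> {0..}" for s
    using AE_nonzero
  proof eventually_elim
    case (elim \<xi>)
    have "norm (Y' s \<xi> - Y' t \<xi>) \<le> 2 * h \<xi> + 2 * h \<xi>"
      using that t by (intro order.trans[OF norm_triangle_ineq4] add_mono Y_bounds elim) auto
    then show ?case by simp
  qed
  have le2: "AE \<xi> in lborel. norm (weighted k0 (\<lambda>\<xi>. Y' s \<xi> - Y' t \<xi>) \<xi>) \<le> 4 * g \<xi>" if "s \<in> {0..}" for s
    using AE_nonzero
  proof eventually_elim
    case (elim \<xi>)
    have "norm (weighted k0 (Y' s) \<xi> - weighted k0 (Y' t) \<xi>) \<le> 2 * g \<xi> + 2 * g \<xi>"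
      using that t by (intro order.trans[OF norm_triangle_ineq4] add_mono Y_bounds elim) auto
    then show ?case by (simp add: weighted_diff)
  qed
  have lim: "AE \<xi> in lborel. ((\<lambda>s. Y' s \<xi> - Y' t \<xi>) \<longlongrightarrow> 0) (at t within {0..})"
    using AE_nonzero by eventually_elim (rule LIM_zero[OF Y_tendsto(2)])
  show "((\<lambda>s. norm_sobolev k0 (\<lambda>x. V s x - V t x)) \<longlongrightarrow> 0) (at t within {0..})"
    by (rule norm_sobolev_tendsto[where w = "\<lambda>B \<xi>. 4 * h \<xi>" and v = "\<lambda>B \<xi>. 4 * g \<xi>",
          OF f L2_scale_real[OF h_L2] L2_scale_real[OF g_L2] le1 le2 lim])
qed

text \<open>Dominated convergence for the difference quotients: the Lipschitz bound in time
  dominates each of them by \<open>h\<close>, with no loss in k0.\<close>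

lemma U_time_deriv:
  assumes t: "t \<ge> 0"
  shows "has_time_deriv k0 U (V t) t"
  unfolding has_time_deriv_def
proof (intro conjI)
  show "V t \<in> sobolev k0" using V_C0 t by (simp add: C0_sobolev_def)
  let ?D = "\<lambda>s \<xi>. (Y s \<xi> - Y t \<xi>) / complex_of_real (s - t) - Y' t \<xi>"
  have f: "s \<in> {0..} \<Longrightarrow> is_fourier_real (\<lambda>x. (U s x - U t x) / (s - t) - V t x) (?D s)" for s
    using t by (intro is_fourier_real_diff is_fourier_real_divide U_fourier V_fourier) auto
  have D: "norm (?D s \<xi>) \<le> 4 * h \<xi>" if "s \<in> {0..}" "\<xi> \<noteq> 0" for s \<xi>
  proof -
    \<comment> \<open>At \<open>s = t\<close> the quotient has the default value 0, so the bound
      persists there.\<close>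
    have "norm ((Y s \<xi> - Y t \<xi>) / complex_of_real (s - t)) \<le> 2 * h \<xi>"
      using Y_increment[OF that(2) t, of s] that(1) h_nonneg[of \<xi>]
      by (cases "s = t") (auto simp: norm_divide divide_le_eq simp del: of_real_diff)
    then have "norm (?D s \<xi>) \<le> 2 * h \<xi> + 2 * h \<xi>"
      by (intro order.trans[OF norm_triangle_ineq4] add_mono Y_bounds that t)
    then show ?thesis by simp
  qed
  have le1: "AE \<xi> in lborel. norm (?D s \<xi>) \<le> 4 * h \<xi>" if "s \<in> {0..}" for s
    using AE_nonzero by eventually_elim (rule D[OF that])
  have le2: "AE \<xi> in lborel. norm (weighted k0 (?D s) \<xi>) \<le> 4 * g \<xi>" if "s \<in> {0..}" for s
    using AE_nonzero
  proof eventually_elim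
    case (elim \<xi>)
    have "norm \<xi> powr k0 * norm (?D s \<xi>) \<le> norm \<xi> powr k0 * (4 * h \<xi>)"
      by (intro mult_left_mono D[OF that elim]) auto
    then show ?case by (simp only: norm_weighted g_eq[OF elim] mult_ac)
  qed
  have lim: "AE \<xi> in lborel. ((\<lambda>s. ?D s \<xi>) \<longlongrightarrow> 0) (at t within {0..})"
    using AE_nonzero by eventually_elim (rule difference_quotient_tendsto)
  show "((\<lambda>s. norm_sobolev k0 (\<lambda>x. (U s x - U t x) / (s - t) - V t x)) \<longlongrightarrow> 0) (at t within {0..})"
    by (rule norm_sobolev_tendsto[where w = "\<lambda>B \<xi>. 4 * h \<xi>" and v = "\<lambda>B \<xi>. 4 * g \<xi>",
          OF f L2_scale_real[OF h_L2] L2_scale_real[OF g_L2] le1 le2 lim])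
qed

lemma U_solution: "is_solution \<nu> \<sigma> k0 u0 u1 U"
  unfolding is_solution_def
proof (intro conjI exI[of _ Y])
  show "U \<in> C0_sobolev (k0 + 1)" by (rule U_C0)
  show "U \<in> C1_sobolev k0"
    unfolding C1_sobolev_def using U_C0' V_C0 U_time_deriv by blast
  show "\<forall>t\<ge>0. AE \<xi> in lborel. Y t \<xi> = fourier_real (U t) \<xi>"
  proof (intro allI impI)
    fix t :: real assume "t \<ge> 0"
    from is_fourier_real_AE[OF U_fourier[OF this]] show "AE \<xi> in lborel. Y t \<xi> = fourier_real (U t) \<xi>"
      by eventually_elim simp
  qed
  show "AE \<xi> in lborel. fourier_ode \<nu> \<sigma> \<xi> (fourier_real u0 \<xi>) (fourier_real u1 \<xi>) (\<lambda>t. Y t \<xi>)"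
    using AE_nonzero
  proof eventually_elim
    case (elim \<xi>)
    show ?case
      unfolding fourier_ode_def
    proof (intro exI conjI allI impI)
      show "((\<lambda>t. Y t \<xi>) has_vector_derivative Y' t \<xi>) (at t within {0..})" for t by (rule Y_deriv[OF elim])
      show "continuous_on {0..} (\<lambda>t. Y' t \<xi>)" unfolding Y'_def by (rule damped_continuous)
      show "((\<lambda>t. Y' t \<xi>) has_vector_derivative
          - (complex_of_real (damp \<xi>) * Y' t \<xi> + complex_of_real ((norm \<xi>)\<^sup>2) * Y t \<xi>)) (at t)" for t
        by (rule Y'_deriv[OF elim])
    qed (simp_all add: Y_def Y'_def p_def q_def damp_def)
  qed
qed

text \<open>Off a null set, which may depend on the fixed t, the representative \<open>v\<close>
  solves the frequency-wise equation and matches the transform of \<open>w t\<close>. Uniqueness for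
  the oscillator identifies it with \<open>Y\<close>, and injectivity of the transform returns to
  physical space.\<close>

lemma solution_unique:
  assumes w: "is_solution \<nu> \<sigma> k0 u0 u1 w" and t: "t \<ge> 0"
  shows "AE x in lborel. w t x = U t x"
proof -
  from w obtain v where v: "\<And>t. t \<ge> 0 \<Longrightarrow> AE \<xi> in lborel. v t \<xi> = fourier_real (w t) \<xi>"
      "AE \<xi> in lborel. fourier_ode \<nu> \<sigma> \<xi> (fourier_real u0 \<xi>) (fourier_real u1 \<xi>) (\<lambda>t. v t \<xi>)"
    unfolding is_solution_def by blast
  have "w t \<in> L2_space" using w t by (simp add: is_solution_def C0_sobolev_def sobolev_def)
  then have wf: "is_fourier_real (w t) (fourier_real (w t))" by (rule is_fourier_real_fourier_real)
  have "AE \<xi> in lborel. fourier_real (w t) \<xi> = Y t \<xi>"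
    using v(1)[OF t] v(2) AE_nonzero
  proof eventually_elim
    case (elim \<xi>)
    obtain y' y'' where y: "\<And>t. t \<ge> 0 \<Longrightarrow> ((\<lambda>t. v t \<xi>) has_vector_derivative y' t) (at t within {0..})"
        "continuous_on {0..} y'" "\<And>t. t > 0 \<Longrightarrow> (y' has_vector_derivative y'' t) (at t)"
        "\<And>t. t > 0 \<Longrightarrow> y'' t + complex_of_real ((norm \<xi>)\<^sup>2) * v t \<xi> + complex_of_real (\<nu> * norm \<xi> powr (2 * \<sigma>)) * y' t = 0"
        "v 0 \<xi> = p \<xi>" "y' 0 = q \<xi>"
      using elim(2) unfolding fourier_ode_def p_def q_def by blast
    have n: "norm \<xi> > 0" using elim(3) by simp
    have "v t \<xi> = damped (norm \<xi>) (damp \<xi>) (v 0 \<xi>) (y' 0) t"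
    proof (rule damped_unique[OF n damp_pos[OF elim(3)] _ y(2) _ _ t])
      show "continuous_on {0..} (\<lambda>t. v t \<xi>)"
        unfolding continuous_on_eq_continuous_within using has_vector_derivative_continuous[OF y(1)] by auto
      fix s :: real assume s: "s > 0"
      have "at s within {0..} = at s" using s by (intro at_within_interior) (auto simp: interior_Ici[of "-1"])
      then show "((\<lambda>t. v t \<xi>) has_vector_derivative y' s) (at s)" using y(1)[of s] s by simp
      have "y'' s = - (complex_of_real (damp \<xi>) * y' s + complex_of_real ((norm \<xi>)\<^sup>2) * v s \<xi>)"
      proof -
        have "x = - (c + b)" if "x + b + c = 0" for x b c :: complex
        proof -
          have "x + (c + b) = 0" using that by (simp only: add_ac)
          then show ?thesis by (simp only: eq_neg_iff_add_eq_0)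
        qed
        from this[OF y(4)[OF s]] show ?thesis by (simp only: damp_def)
      qed
      then show "(y' has_vector_derivative - (complex_of_real (damp \<xi>) * y' s + complex_of_real ((norm \<xi>)\<^sup>2) * v s \<xi>)) (at s)"
        using y(3)[OF s] by simp
    qed
    then show ?case using elim(1) by (simp add: Y_def y(5,6))
  qed
  then have "AE x in lborel. complex_of_real (w t x) = complex_of_real (U t x)"
    using is_fourier_AE_iff[OF wf U_fourier[OF t]] by simp
  then show ?thesis by simp
qed

text \<open>The chosen derivative agrees with \<open>V\<close> almost everywhere. Its own
  measurability, which the transfer of the transform requires, comes from membership in the Sobolev
  class.\<close>

lemma time_deriv_fourier:
  assumes t: "t \<ge> 0"
  shows "is_fourier_real (time_deriv k0 U t) (Y' t)"
proof -
  have d: "has_time_deriv k0 U (time_deriv k0 U t) t"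
    unfolding time_deriv_def by (rule someI[of "\<lambda>w. has_time_deriv k0 U w t", OF U_time_deriv[OF t]])
  have "time_deriv k0 U t \<in> L2_space"
    using conjunct1[OF d[unfolded has_time_deriv_def]] by (simp add: sobolev_def)
  then have m: "(\<lambda>x. complex_of_real (time_deriv k0 U t x)) \<in> borel_measurable borel"
    using L2_measurable of_real_L2_iff by blast
  have "AE x in lborel. time_deriv k0 U t x = V t x"
  proof (rule has_time_deriv_unique_AE[OF t _ d U_time_deriv[OF t]])
    show "U s \<in> L2_space" if "s \<ge> 0" for s
      using is_fourier_L2(1)[OF U_fourier[OF that]] of_real_L2_iff by blast
  qed
  then show ?thesis
    by (intro is_fourier_cong[OF V_fourier[OF t] _ _ m]) (auto elim: eventually_mono)
qed

section \<open>Transfer of the decay estimates to the solution\<close>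

lemma norm_nabla_U:
  assumes "t \<ge> 0" "0 \<le> k" "k \<le> k0 + 1"
  shows "norm_L2 (nabla k (U t)) = norm_L2 (weighted k (Y t))"
  by (intro norm_nabla U_fourier weighted_interpolate[OF Y_L2(1,3)] assms)

lemma norm_nabla_time_deriv:
  assumes "t \<ge> 0" "0 \<le> k" "k \<le> k0"
  shows "norm_L2 (nabla k (time_deriv k0 U t)) = norm_L2 (weighted k (Y' t))"
  by (intro norm_nabla time_deriv_fourier weighted_interpolate[OF Y_L2(2,4)] assms)

lemma high_frequency:
  assumes r: "0 < r" "r \<le> 1"
  shows "\<exists>c>0. \<exists>K>0. \<forall>\<xi> t k. norm \<xi> \<ge> r \<longrightarrow> t \<ge> 0 \<longrightarrow> 0 \<le> k \<longrightarrow> k \<le> k0 + 1 \<longrightarrow>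
       norm \<xi> powr k * norm (Y t \<xi>) \<le> K * exp (- c * t) * g \<xi>"
    and "\<exists>c>0. \<exists>K>0. \<forall>\<xi> t k. norm \<xi> \<ge> r \<longrightarrow> t \<ge> 0 \<longrightarrow> 0 \<le> k \<longrightarrow> k \<le> k0 \<longrightarrow>
       norm \<xi> powr k * norm (Y' t \<xi>) \<le> K * exp (- c * t) * g \<xi>"
  using high_frequency_bound[OF \<nu> \<sigma> r k0] unfolding Y_def Y'_def damp_def g_def by meson+

text \<open>Integrability of the data bounds both transforms by one \<open>M\<close>, which makes
  the low frequency hypotheses applicable. The rates \<gamma> and \<gamma>' stay abstract so that
  the three ranges of \<sigma> share the argument.\<close>

lemma solution_decay:
  assumes i: "integrable lborel u0" "integrable lborel u1"
    and low: "\<And>M. M \<ge> 0 \<Longrightarrow> low_frequency_decay (real DIM('a)) \<sigma> M \<gamma> (\<lambda>a. damped a (\<nu> * a powr (2 * \<sigma>)))"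
      "\<And>M. M \<ge> 0 \<Longrightarrow> low_frequency_decay (real DIM('a)) \<sigma> M \<gamma>' (\<lambda>a. damped' a (\<nu> * a powr (2 * \<sigma>)))"
  shows "\<exists>C>0. \<forall>t\<ge>0. \<forall>k\<ge>0. (k \<le> k0 + 1 \<longrightarrow> norm_L2 (nabla k (U t)) \<le> C * (1 + t) powr (- \<gamma> k)) \<and>
     (k \<le> k0 \<longrightarrow> norm_L2 (nabla k (time_deriv k0 U t)) \<le> C * (1 + t) powr (- \<gamma>' k))"
proof -
  have L2: "u0 \<in> L2_space" "u1 \<in> L2_space" using u0 u1 by (auto simp: sobolev_def)
  obtain M0 where M0: "M0 > 0" "AE \<xi> in lborel. norm (p \<xi>) \<le> M0"
    using fourier_real_bounded[OF L2(1) i(1)] unfolding p_def by blast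
  obtain M1 where M1: "M1 > 0" "AE \<xi> in lborel. norm (q \<xi>) \<le> M1"
    using fourier_real_bounded[OF L2(2) i(2)] unfolding q_def by blast
  define M where "M = max M0 M1"
  have M: "M \<ge> 0" "AE \<xi> in lborel. norm (p \<xi>) \<le> M" "AE \<xi> in lborel. norm (q \<xi>) \<le> M"
    using M0 M1 by (auto simp: M_def le_max_iff_disj elim: eventually_mono)
  obtain C where C: "C > 0" "\<And>t k. t \<ge> 0 \<Longrightarrow> 0 \<le> k \<Longrightarrow> k \<le> k0 + 1 \<Longrightarrow> norm_L2 (weighted k (Y t)) \<le> C * (1 + t) powr (- \<gamma> k)"
    using L2_decay[OF low(1)[OF M(1)] \<sigma>(1) M(2,3) Y_measurable(1)[unfolded Y_def[abs_def] damp_def]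
        high_frequency(1)[unfolded Y_def damp_def] g_L2]
    unfolding Y_def[abs_def] damp_def by blast
  obtain C' where C': "C' > 0" "\<And>t k. t \<ge> 0 \<Longrightarrow> 0 \<le> k \<Longrightarrow> k \<le> k0 \<Longrightarrow> norm_L2 (weighted k (Y' t)) \<le> C' * (1 + t) powr (- \<gamma>' k)"
    using L2_decay[OF low(2)[OF M(1)] \<sigma>(1) M(2,3) Y_measurable(2)[unfolded Y'_def[abs_def] damp_def]
        high_frequency(2)[unfolded Y'_def damp_def] g_L2]
    unfolding Y'_def[abs_def] damp_def by blast
  have mono: "c * (1 + t) powr x \<le> max C C' * (1 + t) powr x" if "c = C \<or> c = C'" for c t x
    using that by (intro mult_right_mono) auto
  show ?thesis
  proof (intro exI[of _ "max C C'"] conjI allI impI)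
    show "max C C' > 0" using C(1) by simp
    fix t k :: real assume t: "t \<ge> 0" and k: "k \<ge> 0"
    show "norm_L2 (nabla k (U t)) \<le> max C C' * (1 + t) powr (- \<gamma> k)" if "k \<le> k0 + 1"
      using norm_nabla_U[OF t k that] C(2)[OF t k that] mono[of C t "- \<gamma> k"] by linarith
    show "norm_L2 (nabla k (time_deriv k0 U t)) \<le> max C C' * (1 + t) powr (- \<gamma>' k)" if "k \<le> k0"
      using norm_nabla_time_deriv[OF t k that] C'(2)[OF t k that] mono[of C' t "- \<gamma>' k"] by linarith
  qed
qed

end

theorem proposition1p1:
  fixes \<nu> \<sigma> k0 :: real and u0 u1 :: "real ^ 'n \<Rightarrow> real"
  assumes "\<nu> > 0" and "k0 \<ge> 0"
    and "(0 < \<sigma> \<and> \<sigma> < 1/2 \<and> CARD('n) \<ge> 2) \<or> (\<sigma> = 1/2 \<and> CARD('n) \<ge> 1)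
         \<or> (1/2 < \<sigma> \<and> \<sigma> \<le> 1 \<and> CARD('n) \<ge> 3)"
    and "u0 \<in> sobolev (k0 + 1)" and "integrable lborel u0"
    and "u1 \<in> sobolev k0" and "integrable lborel u1"
  shows "\<exists>u. is_solution \<nu> \<sigma> k0 u0 u1 u \<and>
     (\<forall>w. is_solution \<nu> \<sigma> k0 u0 u1 w \<longrightarrow> (\<forall>t\<ge>0. AE x in lborel. w t x = u t x)) \<and>
     (\<exists>C>0. \<forall>t\<ge>0. \<forall>l\<in>{0, 1::nat}. \<forall>k\<in>{0..k0 + 1}. k + real l \<le> k0 + 1 \<longrightarrow>
        (\<sigma> \<le> 1/2 \<longrightarrow> norm_L2 (nabla k ((time_deriv k0 ^^ l) u t))
             \<le> C * (1 + t) powr (- decay_exponent CARD('n) \<sigma> k - real l)) \<and>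
        (\<sigma> > 1/2 \<longrightarrow> norm_L2 (nabla k ((time_deriv k0 ^^ l) u t))
             \<le> C * (1 + t) powr (- decay_exponent CARD('n) \<sigma> k - real l / (2 * \<sigma>))))"
proof -
  interpret damped_wave \<nu> \<sigma> k0 u0 u1
    using assms by unfold_locales auto
  \<comment> \<open>The gain of one time derivative, which lets a single rate function cover both
    displayed estimates.\<close>
  let ?\<delta> = "if \<sigma> \<le> 1/2 then 1 else 1 / (2 * \<sigma>)"
  let ?\<gamma> = "decay_exponent CARD('n) \<sigma>"
  have low: "low_frequency_decay (real CARD('n)) \<sigma> M ?\<gamma> (\<lambda>a. damped a (\<nu> * a powr (2 * \<sigma>)))"
    "low_frequency_decay (real CARD('n)) \<sigma> M (\<lambda>k. ?\<gamma> k + ?\<delta>) (\<lambda>a. damped' a (\<nu> * a powr (2 * \<sigma>)))"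
    if M: "M \<ge> 0" for M
    using assms(3) low_frequency_decay_lt[OF \<nu> _ _ _ M, of \<sigma> "CARD('n)"]
      low_frequency_decay_half[OF \<nu> _ _ M, of \<sigma> "CARD('n)"] low_frequency_decay_gt[OF \<nu> _ _ M, of \<sigma> "CARD('n)"]
    by auto
  have "DIM(real ^ 'n) = CARD('n)" by simp
  then obtain C where C: "C > 0" "\<And>t k. t \<ge> 0 \<Longrightarrow> k \<ge> 0 \<Longrightarrow> k \<le> k0 + 1 \<Longrightarrow> norm_L2 (nabla k (U t)) \<le> C * (1 + t) powr (- ?\<gamma> k)"
     "\<And>t k. t \<ge> 0 \<Longrightarrow> k \<ge> 0 \<Longrightarrow> k \<le> k0 \<Longrightarrow> norm_L2 (nabla k (time_deriv k0 U t)) \<le> C * (1 + t) powr (- (?\<gamma> k + ?\<delta>))"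
    using solution_decay[OF assms(5,7), of ?\<gamma> "\<lambda>k. ?\<gamma> k + ?\<delta>"] low by auto
  have powers: "(1 + t) powr (- ?\<gamma> k - real l) = (1 + t) powr (- (?\<gamma> k + real l))"
    "(1 + t) powr (- ?\<gamma> k - real l / (2 * \<sigma>)) = (1 + t) powr (- (?\<gamma> k + real l / (2 * \<sigma>)))" for t k l
    by (simp_all only: minus_add_distrib diff_conv_add_uminus)
  have "\<forall>t\<ge>0. \<forall>l\<in>{0, 1::nat}. \<forall>k\<in>{0..k0 + 1}. k + real l \<le> k0 + 1 \<longrightarrow>
        (\<sigma> \<le> 1/2 \<longrightarrow> norm_L2 (nabla k ((time_deriv k0 ^^ l) U t)) \<le> C * (1 + t) powr (- ?\<gamma> k - real l)) \<and>
        (\<sigma> > 1/2 \<longrightarrow> norm_L2 (nabla k ((time_deriv k0 ^^ l) U t)) \<le> C * (1 + t) powr (- ?\<gamma> k - real l / (2 * \<sigma>)))"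
    \<comment> \<open>For \<open>l = 1\<close> the restriction \<open>k + l \<le> k0 + 1\<close> is
      \<open>k \<le> k0\<close>, the range in which the derivative estimate holds.\<close>
    unfolding powers using C(2,3) by auto
  then show ?thesis using U_solution solution_unique C(1) by blast
qed

end
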